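(* Let $n\ge 3$ be finite and let $L$ be a signature with $L_{\mathsf{Df}_n}\subseteq L\subseteq L_{\mathsf{PEA}_n}$. Then the class of strongly representable $L$-atom structures is not elementary (it is not the class of models of any first-order theory in the signature $L_+$).
   Context: $L_{BA}=\{+,-,0,1\}$, $L_{\mathsf{Df}_n}=L_{BA}\cup\{c_i: i<n\}$, $L_{\mathsf{PEA}_n}=L_{BA}\cup\{c_i,d_{ij},s_\sigma: i,j<n,\ \sigma:n\to n\}$ ($c_i,s_\sigma$ unary function symbols, $d_{ij}$ constants). For such $L$, $L_+$ is the relational signature with an $(m+1)$-ary relation symbol $R_f$ for each $m$-ary $f\in L\setminus L_{BA}$; an $L$-atom structure is an $L_+$-structure $\mathcal S$. Its complex algebra $\mathcal S^+$ is $\wp(S)$ with the boolean set operations and $f(X_1,\dots,X_m)=\{s\in S: R_f(x_1,\dots,x_m,s)$ for some $x_k\in X_k\}$. $\mathcal S$ is strongly representable if $\mathcal S^+$ is representable, i.e. isomorphic to a subalgebra of a product of set algebras: diagonal-free set algebras $(\wp(\prod_{i<n}U_i),\dots,C_i)$ if $L=L_{\mathsf{Df}_n}$, and otherwise $L$-reducts of polyadic equality set algebras $(\wp({}^nU),\dots,C_i,D_{ij},S_\sigma)$ with $D_{ij}=\{x:x_i=x_j\}$, $C_iX=\{x:\exists y\in X\,\forall j\neq i\,(y_j=x_j)\}$, $S_\sigma X=\{x:x\circ\sigma\in X\}$. *)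

theory Defs
  imports Complex_Main "HOL-Library.FuncSet"
begin

text \<open>A map \<open>\<sigma> : n \<rightarrow> n\<close> is an element of \<open>{..<n} \<rightarrow>\<^sub>E {..<n}\<close>, so that distinct codes in
  \<open>L_PEA n\<close> denote distinct maps.\<close>

datatype fsym =
    BPlus | BMinus | BZero | BOne
  | Cyl nat | Diag nat nat | Subst "nat \<Rightarrow> nat"

fun arity :: "fsym \<Rightarrow> nat" where
  "arity BPlus = 2"
| "arity BMinus = 1"
| "arity BZero = 0"
| "arity BOne = 0"
| "arity (Cyl i) = 1"
| "arity (Diag i j) = 0"
| "arity (Subst \<sigma>) = 1"

definition L_BA :: "fsym set" where
  "L_BA = {BPlus, BMinus, BZero, BOne}"

definition L_Df :: "nat \<Rightarrow> fsym set" where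
  "L_Df n = L_BA \<union> {Cyl i | i. i < n}"

definition L_PEA :: "nat \<Rightarrow> fsym set" where
  "L_PEA n = L_BA \<union> {Cyl i | i. i < n} \<union> {Diag i j | i j. i < n \<and> j < n}
     \<union> {Subst \<sigma> | \<sigma>. \<sigma> \<in> {..<n} \<rightarrow>\<^sub>E {..<n}}"

text \<open>The relation symbol \<open>R_f\<close>, of arity \<open>Suc (arity f)\<close>, is represented by \<open>f\<close> itself.\<close>

definition L_plus :: "fsym set \<Rightarrow> fsym set" where
  "L_plus L = L - L_BA"

text \<open>One type of algebras serves all signatures: operations for symbols outside the signature
  \<open>L\<close> under consideration are never inspected, so taking \<open>L\<close>-reducts leaves the record as it is.\<close>

record 'b alg =
  carr :: "'b set"
  oper :: "fsym \<Rightarrow> 'b list \<Rightarrow> 'b"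

definition is_algebra :: "fsym set \<Rightarrow> 'b alg \<Rightarrow> bool" where
  "is_algebra L A \<longleftrightarrow>
     (\<forall>f\<in>L. \<forall>xs\<in>lists (carr A). length xs = arity f \<longrightarrow> oper A f xs \<in> carr A)"

definition subalgebra :: "fsym set \<Rightarrow> 'b alg \<Rightarrow> 'b alg \<Rightarrow> bool" where
  "subalgebra L B A \<longleftrightarrow> carr B \<subseteq> carr A \<and> is_algebra L B \<and>
     (\<forall>f\<in>L. \<forall>xs\<in>lists (carr B). length xs = arity f \<longrightarrow> oper B f xs = oper A f xs)"

definition hom_alg :: "fsym set \<Rightarrow> 'b alg \<Rightarrow> 'c alg \<Rightarrow> ('b \<Rightarrow> 'c) \<Rightarrow> bool" where
  "hom_alg L A B h \<longleftrightarrow> h \<in> carr A \<rightarrow> carr B \<and>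
     (\<forall>f\<in>L. \<forall>xs\<in>lists (carr A). length xs = arity f \<longrightarrow> h (oper A f xs) = oper B f (map h xs))"

definition isomorphic_alg :: "fsym set \<Rightarrow> 'b alg \<Rightarrow> 'c alg \<Rightarrow> bool" where
  "isomorphic_alg L A B \<longleftrightarrow> (\<exists>h. hom_alg L A B h \<and> bij_betw h (carr A) (carr B))"

definition embeddable :: "fsym set \<Rightarrow> 'b alg \<Rightarrow> 'c alg \<Rightarrow> bool" where
  "embeddable L A B \<longleftrightarrow> (\<exists>C. subalgebra L C B \<and> isomorphic_alg L A C)"

definition prod_alg :: "'i set \<Rightarrow> ('i \<Rightarrow> 'b alg) \<Rightarrow> ('i \<Rightarrow> 'b) alg" where
  "prod_alg I B = \<lparr>carr = (\<Pi>\<^sub>E k\<in>I. carr (B k)),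
     oper = (\<lambda>f xs. \<lambda>k\<in>I. oper (B k) f (map (\<lambda>x. x k) xs))\<rparr>"

fun boolean_op :: "'a set \<Rightarrow> fsym \<Rightarrow> 'a set list \<Rightarrow> 'a set" where
  "boolean_op V BPlus [X, Y] = X \<union> Y"
| "boolean_op V BMinus [X] = V - X"
| "boolean_op V BZero [] = {}"
| "boolean_op V BOne [] = V"
| "boolean_op V _ _ = undefined"

fun set_op :: "nat \<Rightarrow> (nat \<Rightarrow> 'u) set \<Rightarrow> fsym \<Rightarrow> (nat \<Rightarrow> 'u) set list \<Rightarrow> (nat \<Rightarrow> 'u) set" where
  "set_op n V (Cyl i) [X] = {x \<in> V. \<exists>y\<in>X. \<forall>j<n. j \<noteq> i \<longrightarrow> y j = x j}"
| "set_op n V (Diag i j) [] = {x \<in> V. x i = x j}"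
| "set_op n V (Subst \<sigma>) [X] = {x \<in> V. compose {..<n} x \<sigma> \<in> X}"
| "set_op n V f Xs = boolean_op V f Xs"

definition set_alg :: "nat \<Rightarrow> (nat \<Rightarrow> 'u) set \<Rightarrow> (nat \<Rightarrow> 'u) set alg" where
  "set_alg n V = \<lparr>carr = Pow V, oper = set_op n V\<rparr>"

definition Df_set_alg :: "nat \<Rightarrow> (nat \<Rightarrow> 'u set) \<Rightarrow> (nat \<Rightarrow> 'u) set alg" where
  "Df_set_alg n U = set_alg n (\<Pi>\<^sub>E i\<in>{..<n}. U i)"

definition PEA_set_alg :: "nat \<Rightarrow> 'u set \<Rightarrow> (nat \<Rightarrow> 'u) set alg" where
  "PEA_set_alg n U = set_alg n ({..<n} \<rightarrow>\<^sub>E U)"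

text \<open>HOL cannot quantify over types inside a definition, so index set and bases are drawn from
  types determined by the element type \<open>'b\<close> of the algebra. This is no restriction: by a
  downward Loewenheim--Skolem argument a representation over arbitrary types yields one of this
  kind; see \<open>representable_if_Df\<close> and \<open>representable_if_PEA\<close> below.\<close>

definition representable :: "nat \<Rightarrow> fsym set \<Rightarrow> 'b alg \<Rightarrow> bool" where
  "representable n L A \<longleftrightarrow>
     (if L = L_Df n
      then \<exists>(I :: 'b set) (U :: 'b \<Rightarrow> nat \<Rightarrow> ('b + nat) set).
             embeddable L A (prod_alg I (\<lambda>k. Df_set_alg n (U k)))
      else \<exists>(I :: 'b set) (U :: 'b \<Rightarrow> ('b + nat) set).
             embeddable L A (prod_alg I (\<lambda>k. PEA_set_alg n (U k))))"

record 'a struc =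
  univ :: "'a set"
  rel :: "fsym \<Rightarrow> 'a list set"

text \<open>As usual in first-order model theory, universes are non-empty.\<close>

definition atom_structure :: "fsym set \<Rightarrow> 'a struc \<Rightarrow> bool" where
  "atom_structure L S \<longleftrightarrow> univ S \<noteq> {} \<and>
     (\<forall>f\<in>L_plus L. rel S f \<subseteq> {xs \<in> lists (univ S). length xs = Suc (arity f)})"

definition complex_op :: "'a struc \<Rightarrow> fsym \<Rightarrow> 'a set list \<Rightarrow> 'a set" where
  "complex_op S f Xs =
     (if f \<in> L_BA then boolean_op (univ S) f Xs
      else {s \<in> univ S. \<exists>xs. list_all2 (\<in>) xs Xs \<and> xs @ [s] \<in> rel S f})"

definition complex_algebra :: "'a struc \<Rightarrow> 'a set alg" where
  "complex_algebra S = \<lparr>carr = Pow (univ S), oper = complex_op S\<rparr>"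

definition strongly_representable :: "nat \<Rightarrow> fsym set \<Rightarrow> 'a struc \<Rightarrow> bool" where
  "strongly_representable n L S \<longleftrightarrow> atom_structure L S \<and> representable n L (complex_algebra S)"

datatype fm =
    Eql nat nat
  | Atm fsym "nat list"
  | Neg fm
  | Conj fm fm
  | Exi nat fm

fun formula_of :: "fsym set \<Rightarrow> fm \<Rightarrow> bool" where
  "formula_of L (Eql u v) \<longleftrightarrow> True"
| "formula_of L (Atm f vs) \<longleftrightarrow> f \<in> L_plus L \<and> length vs = Suc (arity f)"
| "formula_of L (Neg \<phi>) \<longleftrightarrow> formula_of L \<phi>"
| "formula_of L (Conj \<phi> \<psi>) \<longleftrightarrow> formula_of L \<phi> \<and> formula_of L \<psi>"
| "formula_of L (Exi v \<phi>) \<longleftrightarrow> formula_of L \<phi>"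

fun free_vars :: "fm \<Rightarrow> nat set" where
  "free_vars (Eql u v) = {u, v}"
| "free_vars (Atm f vs) = set vs"
| "free_vars (Neg \<phi>) = free_vars \<phi>"
| "free_vars (Conj \<phi> \<psi>) = free_vars \<phi> \<union> free_vars \<psi>"
| "free_vars (Exi v \<phi>) = free_vars \<phi> - {v}"

definition sentence_of :: "fsym set \<Rightarrow> fm \<Rightarrow> bool" where
  "sentence_of L \<phi> \<longleftrightarrow> formula_of L \<phi> \<and> free_vars \<phi> = {}"

fun sat :: "'a struc \<Rightarrow> (nat \<Rightarrow> 'a) \<Rightarrow> fm \<Rightarrow> bool" where
  "sat S e (Eql u v) \<longleftrightarrow> e u = e v"
| "sat S e (Atm f vs) \<longleftrightarrow> map e vs \<in> rel S f"
| "sat S e (Neg \<phi>) \<longleftrightarrow> \<not> sat S e \<phi>"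
| "sat S e (Conj \<phi> \<psi>) \<longleftrightarrow> sat S e \<phi> \<and> sat S e \<psi>"
| "sat S e (Exi v \<phi>) \<longleftrightarrow> (\<exists>a\<in>univ S. sat S (e(v := a)) \<phi>)"

definition models :: "'a struc \<Rightarrow> fm set \<Rightarrow> bool" where
  "models S T \<longleftrightarrow> (\<forall>\<phi>\<in>T. \<forall>e. range e \<subseteq> univ S \<longrightarrow> sat S e \<phi>)"

text \<open>A class of structures is represented by those of its members whose universe is a subset of
  the type \<open>'a\<close>. If a proper class is axiomatised by a theory, then so are its members over any
  given type; hence failure over one type refutes axiomatisability of the proper class. (Over a
  finite type failure cannot be expected, as finite structures are determined up to isomorphism
  by their theory.)\<close>

definition elementary_class :: "fsym set \<Rightarrow> 'a struc set \<Rightarrow> bool" where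
  "elementary_class L K \<longleftrightarrow>
     (\<exists>T. (\<forall>\<phi>\<in>T. sentence_of L \<phi>) \<and> K = {S. atom_structure L S \<and> models S T})"

lemma embeddableI:
  assumes "is_algebra L A" "hom_alg L A B h" "inj_on h (carr A)"
  shows "embeddable L A B"
proof -
  let ?C = "\<lparr>carr = h ` carr A, oper = oper B\<rparr>"
  have "oper B f xs \<in> h ` carr A"
    if f: "f \<in> L" and xs: "xs \<in> lists (h ` carr A)" and len: "length xs = arity f" for f xs
  proof -
    obtain ys where ys: "ys \<in> lists (carr A)" "xs = map h ys"
      using xs by (metis lists_image imageE)
    then have "oper B f xs = h (oper A f ys)"
      using assms(2) f len by (auto simp: hom_alg_def)
    then show ?thesis
      using assms(1) f len ys by (auto simp: is_algebra_def)
  qed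
  then have "subalgebra L ?C B"
    using assms(2) by (auto simp: subalgebra_def is_algebra_def hom_alg_def)
  moreover have "isomorphic_alg L A ?C"
    unfolding isomorphic_alg_def
  proof (intro exI conjI)
    show "hom_alg L A ?C h" using assms(2) by (auto simp: hom_alg_def)
    show "bij_betw h (carr A) (carr ?C)" using assms(3) by (simp add: bij_betw_def)
  qed
  ultimately show ?thesis by (auto simp: embeddable_def)
qed

lemma embeddableE:
  assumes "embeddable L A B"
  obtains h where "hom_alg L A B h" "inj_on h (carr A)"
proof -
  obtain C h where C: "subalgebra L C B" and h: "hom_alg L A C h" "bij_betw h (carr A) (carr C)"
    using assms by (auto simp: embeddable_def isomorphic_alg_def)
  have "hom_alg L A B h"
    unfolding hom_alg_def
  proof (intro conjI ballI impI)
    show "h \<in> carr A \<rightarrow> carr B"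
      using C h by (auto simp: hom_alg_def subalgebra_def)
    fix f xs assume a: "f \<in> L" "xs \<in> lists (carr A)" "length xs = arity f"
    have "map h xs \<in> lists (carr C)"
      using a h by (auto simp: hom_alg_def Pi_iff)
    then show "h (oper A f xs) = oper B f (map h xs)"
      using a C h by (auto simp: hom_alg_def subalgebra_def)
  qed
  then show ?thesis
    using that h by (auto simp: bij_betw_def)
qed

lemma card_of_finite_le:
  assumes "finite A" "infinite B"
  shows "ordLeq3 (card_of A) (card_of B)"
  using assms card_of_ordLeq_finite ordLeq_total card_of_Well_order by metis

lemma card_of_PiE_le:
  assumes K: "infinite (UNIV :: 'k set)" and W: "ordLeq3 (card_of W) (card_of (UNIV :: 'k set))"
  shows "ordLeq3 (card_of ({..<n::nat} \<rightarrow>\<^sub>E W)) (card_of (UNIV :: 'k set))"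
proof (induction n)
  case 0
  show ?case by (rule card_of_finite_le) (use K in auto)
next
  case (Suc n)
  let ?g = "\<lambda>(y, g). g(n := y)"
  have "{..<Suc n} \<rightarrow>\<^sub>E W = ?g ` (W \<times> ({..<n} \<rightarrow>\<^sub>E W))"
    by (simp add: lessThan_Suc PiE_insert_eq)
  moreover have "ordLeq3 (card_of (?g ` (W \<times> ({..<n} \<rightarrow>\<^sub>E W)))) (card_of (W \<times> ({..<n} \<rightarrow>\<^sub>E W)))"
    by (rule card_of_image)
  moreover have "ordLeq3 (card_of (W \<times> ({..<n} \<rightarrow>\<^sub>E W))) (card_of (UNIV :: 'k set))"
    by (rule card_of_Times_ordLeq_infinite_Field) (use K W Suc in \<open>simp_all only: Field_card_of card_of_card_order_on not_False_eq_True\<close>)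
  ultimately show ?case
    by (metis ordLeq_transitive)
qed

lemma closed_small_set:
  fixes F :: "'b \<Rightarrow> nat \<Rightarrow> (nat \<Rightarrow> 'u) \<Rightarrow> 'u"
  assumes "finite W0"
  obtains W and e :: "'u \<Rightarrow> 'b + nat"
  where "W0 \<subseteq> W" "\<And>b i y. y \<in> {..<n} \<rightarrow>\<^sub>E W \<Longrightarrow> F b i y \<in> W" "inj_on e W"
proof -
  let ?K = "card_of (UNIV :: ('b + nat) set)"
  have inf: "infinite (UNIV :: ('b + nat) set)"
    by (simp add: finite_Plus_UNIV_iff)
  have Kf: "infinite (Field ?K)" "Card_order ?K"
    using inf by (simp_all only: Field_card_of card_of_card_order_on not_False_eq_True)
  have bK: "ordLeq3 (card_of (UNIV :: 'b set)) ?K"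
    by (rule card_of_ordLeqI[of Inl]) auto
  have nK: "ordLeq3 (card_of (UNIV :: nat set)) ?K"
    by (rule card_of_ordLeqI[of Inr]) auto
  define step where
    "step = (\<lambda>W. W \<union> (\<lambda>(b, i, y). F b i y) ` ((UNIV :: 'b set) \<times> (UNIV :: nat set) \<times> ({..<n} \<rightarrow>\<^sub>E W)))"
  define Ws where "Ws = (\<lambda>m. (step ^^ m) W0)"
  have small: "ordLeq3 (card_of (Ws m)) ?K" for m
  proof (induction m)
    case 0
    then show ?case
      using inf assms by (auto simp: Ws_def intro: card_of_finite_le)
  next
    case (Suc m)
    have "ordLeq3 (card_of ((UNIV :: 'b set) \<times> (UNIV :: nat set) \<times> ({..<n} \<rightarrow>\<^sub>E Ws m))) ?K"
      by (intro card_of_Times_ordLeq_infinite_Field Kf bK nK card_of_PiE_le inf Suc)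
    then have "ordLeq3 (card_of ((\<lambda>(b, i, y). F b i y) `
        ((UNIV :: 'b set) \<times> (UNIV :: nat set) \<times> ({..<n} \<rightarrow>\<^sub>E Ws m)))) ?K"
      using card_of_image ordLeq_transitive by blast
    then show ?case
      using Suc inf by (simp add: Ws_def step_def card_of_Un_ordLeq_infinite_Field[OF Kf(1) _ _ Kf(2)])
  qed
  define W where "W = (\<Union>m. Ws m)"
  have "ordLeq3 (card_of W) ?K"
    unfolding W_def using small by (intro card_of_UNION_ordLeq_infinite inf nK) auto
  then obtain e :: "'u \<Rightarrow> 'b + nat" where e: "inj_on e W"
    using card_of_ordLeq[of W "UNIV :: ('b + nat) set"] by auto
  have "mono Ws"
    unfolding mono_iff_le_Suc by (auto simp: Ws_def step_def)
  have closed: "F b i y \<in> W" if y: "y \<in> {..<n} \<rightarrow>\<^sub>E W" for b i y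
  proof -
    have "\<exists>m. \<forall>j<k. y j \<in> Ws m" if "k \<le> n" for k
      using that
    proof (induction k)
      case (Suc k)
      then obtain m where m: "\<forall>j<k. y j \<in> Ws m" by (auto dest: Suc_leD)
      have "y k \<in> W" by (rule PiE_mem[OF y]) (use Suc.prems in simp)
      then obtain m' where m': "y k \<in> Ws m'" by (auto simp: W_def)
      have "Ws m \<subseteq> Ws (max m m')" "Ws m' \<subseteq> Ws (max m m')"
        by (rule monoD[OF \<open>mono Ws\<close>], simp)+
      then show ?case
        using m m' by (intro exI[of _ "max m m'"]) (auto simp: less_Suc_eq)
    qed auto
    then obtain m where "\<forall>j<n. y j \<in> Ws m" by blast
    then have "y \<in> {..<n} \<rightarrow>\<^sub>E Ws m" using y by (auto simp: PiE_iff)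
    then have "F b i y \<in> Ws (Suc m)"
      by (auto simp: Ws_def step_def intro!: image_eqI[of _ _ "(b, i, y)"])
    then show ?thesis by (auto simp: W_def)
  qed
  have "W0 = Ws 0" by (simp add: Ws_def)
  then have "W0 \<subseteq> W" by (auto simp: W_def)
  from that[OF this closed e] show ?thesis .
qed

text \<open>Downward Loewenheim--Skolem for homomorphisms into set algebras.\<close>

lemma small_base:
  fixes A :: "'b alg" and U :: "nat \<Rightarrow> 'u set"
  assumes L: "L_BA \<subseteq> L" "L \<subseteq> L_PEA n"
    and eq: "L \<subseteq> L_Df n \<or> (\<forall>i j. U i = U j)"
    and alg: "is_algebra L A"
    and g: "hom_alg L A (Df_set_alg n U) g"
    and x: "x \<in> (\<Pi>\<^sub>E i\<in>{..<n}. U i)"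
  shows "\<exists>(U' :: nat \<Rightarrow> ('b + nat) set) g' x'. hom_alg L A (Df_set_alg n U') g' \<and>
           ((\<forall>i j. U i = U j) \<longrightarrow> (\<forall>i j. U' i = U' j)) \<and>
           (\<forall>a\<in>carr A. x' \<in> g' a \<longleftrightarrow> x \<in> g a)"
proof -
  define F where "F = (\<lambda>(b::'b) i (y :: nat \<Rightarrow> 'u). SOME u. y(i := u) \<in> g b)"
  obtain W and e :: "'u \<Rightarrow> 'b + nat" where W: "x ` {..<n} \<subseteq> W"
    "\<And>b i y. y \<in> {..<n} \<rightarrow>\<^sub>E W \<Longrightarrow> F b i y \<in> W" and e: "inj_on e W"
    using closed_small_set[of "x ` {..<n}" n F] by auto
  define U' where "U' = (\<lambda>i. e ` (W \<inter> U i))"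
  define d where "d = inv_into W e"
  have de [simp]: "d (e u) = u" if "u \<in> W" for u
    using that e by (simp add: d_def)
  let ?V = "\<Pi>\<^sub>E i\<in>{..<n}. U i"
  let ?V' = "\<Pi>\<^sub>E i\<in>{..<n}. U' i"
  define p where "p = (\<lambda>y. \<lambda>i\<in>{..<n}. d (y i))"
  define q where "q = (\<lambda>z. \<lambda>i\<in>{..<n}. e (z i))"
  define g' where "g' = (\<lambda>a. {y \<in> ?V'. p y \<in> g a})"
  have dU: "d u \<in> W \<inter> U i" "e (d u) = u" if "u \<in> U' i" for u i
    using that by (auto simp: U'_def)
  have pV: "p y \<in> (\<Pi>\<^sub>E i\<in>{..<n}. W \<inter> U i)" if "y \<in> ?V'" for y
    using that dU(1) by (fastforce simp: p_def PiE_iff)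
  have pVU: "p y \<in> ?V" if "y \<in> ?V'" for y
    using pV[OF that] by (auto simp: PiE_iff)
  have qV: "q z \<in> ?V'" "p (q z) = z" if "z \<in> (\<Pi>\<^sub>E i\<in>{..<n}. W \<inter> U i)" for z
  proof -
    show "q z \<in> ?V'" using that by (auto simp: q_def U'_def PiE_iff)
    show "p (q z) = z"
    proof
      fix i show "p (q z) i = z i"
        using that by (cases "i < n") (auto simp: p_def q_def PiE_iff extensional_def)
    qed
  qed
  have gV: "g a \<subseteq> ?V" if "a \<in> carr A" for a
    using g that by (auto simp: hom_alg_def Df_set_alg_def set_alg_def)
  have gop: "g (oper A f xs) = set_op n ?V f (map g xs)"
    if "f \<in> L" "xs \<in> lists (carr A)" "length xs = arity f" for f xs
    using g that by (simp add: hom_alg_def Df_set_alg_def set_alg_def)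
  have hom: "g' (oper A f xs) = set_op n ?V' f (map g' xs)"
    if f: "f \<in> L" and xs: "xs \<in> lists (carr A)" and len: "length xs = arity f" for f xs
  proof (cases f)
    case BPlus
    then obtain a b where "xs = [a, b]"
      using len by (auto simp: numeral_2_eq_2 length_Suc_conv)
    then show ?thesis using gop[OF f xs len] BPlus by (auto simp: g'_def)
  next
    case BMinus
    then obtain a where "xs = [a]" using len by (auto simp: length_Suc_conv)
    then show ?thesis using gop[OF f xs len] BMinus pVU by (auto simp: g'_def del: PiE_I)
  next
    case BZero
    then show ?thesis using gop[OF f xs len] len by (auto simp: g'_def)
  next
    case BOne
    then show ?thesis using gop[OF f xs len] len pVU by (auto simp: g'_def del: PiE_I)
  next
    case (Cyl i)
    then obtain a where a: "xs = [a]" using len by (auto simp: length_Suc_conv)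
    have aA: "a \<in> carr A" using a xs by auto
    have i: "i < n" using f Cyl L by (auto simp: L_PEA_def L_BA_def)
    have "(\<exists>z\<in>g a. \<forall>j<n. j \<noteq> i \<longrightarrow> z j = p y j) \<longleftrightarrow>
          (\<exists>y'\<in>g' a. \<forall>j<n. j \<noteq> i \<longrightarrow> y' j = y j)" if y: "y \<in> ?V'" for y
    proof
      assume "\<exists>z\<in>g a. \<forall>j<n. j \<noteq> i \<longrightarrow> z j = p y j"
      then obtain z where z: "z \<in> g a" "\<forall>j<n. j \<noteq> i \<longrightarrow> z j = p y j" by blast
      have zV: "z \<in> ?V" using z gV aA by auto
      have "z = (p y)(i := z i)"
      proof
        fix j show "z j = ((p y)(i := z i)) j"
          using z zV by (cases "j < n") (auto simp: p_def PiE_iff extensional_def)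
      qed
      then have "(p y)(i := z i) \<in> g a" using z by simp
      then have Fg: "(p y)(i := F a i (p y)) \<in> g a" unfolding F_def by (rule someI)
      let ?u = "F a i (p y)"
      have "p y \<in> {..<n} \<rightarrow>\<^sub>E W" using pV[OF y] by (auto simp: PiE_iff)
      then have uW: "?u \<in> W" by (rule W)
      have "((p y)(i := ?u)) i \<in> U i" using Fg gV[OF aA] i by (blast dest: PiE_mem)
      then have uU: "?u \<in> U i" by simp
      have yV: "y(i := e ?u) \<in> ?V'"
        using y i uW uU by (auto simp: PiE_iff U'_def extensional_def)
      have "p (y(i := e ?u)) = (p y)(i := ?u)"
        using i uW by (auto simp: p_def fun_eq_iff)
      then have "y(i := e ?u) \<in> g' a" using Fg yV by (simp add: g'_def)
      then show "\<exists>y'\<in>g' a. \<forall>j<n. j \<noteq> i \<longrightarrow> y' j = y j" by (rule bexI[rotated]) simp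
    next
      assume "\<exists>y'\<in>g' a. \<forall>j<n. j \<noteq> i \<longrightarrow> y' j = y j"
      then obtain y' where "y' \<in> g' a" "\<forall>j<n. j \<noteq> i \<longrightarrow> y' j = y j" by blast
      then show "\<exists>z\<in>g a. \<forall>j<n. j \<noteq> i \<longrightarrow> z j = p y j"
        by (intro bexI[of _ "p y'"]) (auto simp: g'_def p_def)
    qed
    then show ?thesis using gop[OF f xs len] a Cyl pVU by (auto simp: g'_def del: PiE_I)
  next
    case (Diag i j)
    have ij: "i < n" "j < n" using f Diag L by (auto simp: L_PEA_def L_BA_def)
    have "d (y i) = d (y j) \<longleftrightarrow> y i = y j" if "y \<in> ?V'" for y
      using that ij dU(2) by (metis PiE_mem lessThan_iff)
    then have "p y i = p y j \<longleftrightarrow> y i = y j" if "y \<in> ?V'" for y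
      using that ij by (simp add: p_def)
    then show ?thesis using gop[OF f xs len] len Diag pVU by (auto simp: g'_def del: PiE_I)
  next
    case (Subst \<sigma>)
    then obtain a where a: "xs = [a]" using len by (auto simp: length_Suc_conv)
    have \<sigma>: "\<sigma> \<in> {..<n} \<rightarrow>\<^sub>E {..<n}" using f Subst L by (auto simp: L_PEA_def L_BA_def)
    have "\<not> L \<subseteq> L_Df n" using f Subst by (auto simp: L_Df_def L_BA_def)
    then have U'c: "U' i = U' j" for i j using eq by (metis U'_def)
    have "compose {..<n} y \<sigma> \<in> ?V'" if "y \<in> ?V'" for y
      unfolding PiE_iff
    proof (intro conjI ballI)
      fix i assume i: "i \<in> {..<n}"
      then have "y (\<sigma> i) \<in> U' (\<sigma> i)" using that \<sigma> by (meson PiE_mem)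
      then show "compose {..<n} y \<sigma> i \<in> U' i" using i U'c[of i "\<sigma> i"] by (simp add: compose_def)
    qed (auto simp: compose_def)
    moreover have "p (compose {..<n} y \<sigma>) = compose {..<n} (p y) \<sigma>" for y
      using \<sigma> by (auto simp: p_def compose_def fun_eq_iff PiE_iff)
    ultimately show ?thesis using gop[OF f xs len] a Subst pVU by (auto simp: g'_def del: PiE_I)
  qed
  have xV: "x \<in> (\<Pi>\<^sub>E i\<in>{..<n}. W \<inter> U i)"
    using x W(1) by (auto simp: PiE_iff)
  show ?thesis
  proof (intro exI conjI)
    show "hom_alg L A (Df_set_alg n U') g'"
      using hom by (auto simp: hom_alg_def Df_set_alg_def set_alg_def g'_def)
    show "(\<forall>i j. U i = U j) \<longrightarrow> (\<forall>i j. U' i = U' j)"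
      by (metis U'_def)
    show "\<forall>a\<in>carr A. q x \<in> g' a \<longleftrightarrow> x \<in> g a"
      using qV[OF xV] by (auto simp: g'_def)
  qed
qed

lemma small_representation:
  fixes A :: "'b alg" and I :: "'i set" and U :: "'i \<Rightarrow> nat \<Rightarrow> 'u set"
  assumes L: "L_BA \<subseteq> L" "L \<subseteq> L_PEA n"
    and eq: "L \<subseteq> L_Df n \<or> (\<forall>k i j. U k i = U k j)"
    and alg: "is_algebra L A"
    and emb: "embeddable L A (prod_alg I (\<lambda>k. Df_set_alg n (U k)))"
  shows "\<exists>(J :: 'b set) (U' :: 'b \<Rightarrow> nat \<Rightarrow> ('b + nat) set).
           embeddable L A (prod_alg J (\<lambda>k. Df_set_alg n (U' k))) \<and>
           ((\<forall>k i j. U k i = U k j) \<longrightarrow> (\<forall>k\<in>J. \<forall>i j. U' k i = U' k j))"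
proof -
  obtain h where h: "hom_alg L A (prod_alg I (\<lambda>k. Df_set_alg n (U k))) h" "inj_on h (carr A)"
    using emb by (rule embeddableE)
  have hE: "h a \<in> (\<Pi>\<^sub>E k\<in>I. Pow (\<Pi>\<^sub>E i\<in>{..<n}. U k i))" if "a \<in> carr A" for a
    using h that by (auto simp: hom_alg_def prod_alg_def Df_set_alg_def set_alg_def)
  have hk: "hom_alg L A (Df_set_alg n (U k)) (\<lambda>a. h a k)" if "k \<in> I" for k
    using h(1) that by (auto simp: hom_alg_def prod_alg_def comp_def PiE_iff Pi_iff)
  define J where "J = {b \<in> carr A. \<exists>k\<in>I. h b k \<noteq> {}}"
  have "\<forall>b\<in>J. \<exists>k x. k \<in> I \<and> x \<in> h b k" by (auto simp: J_def)
  then obtain k x where kx: "\<And>b. b \<in> J \<Longrightarrow> k b \<in> I" "\<And>b. b \<in> J \<Longrightarrow> x b \<in> h b (k b)"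
    by metis
  have "\<forall>b\<in>J. \<exists>(U' :: nat \<Rightarrow> ('b + nat) set) g' x'. hom_alg L A (Df_set_alg n U') g' \<and>
           ((\<forall>i j. U (k b) i = U (k b) j) \<longrightarrow> (\<forall>i j. U' i = U' j)) \<and>
           (\<forall>a\<in>carr A. x' \<in> g' a \<longleftrightarrow> x b \<in> h a (k b))"
  proof
    fix b assume b: "b \<in> J"
    have "x b \<in> (\<Pi>\<^sub>E i\<in>{..<n}. U (k b) i)"
      using PiE_mem[OF hE kx(1)[OF b]] kx(2)[OF b] b by (auto simp only: J_def)
    with eq show "\<exists>(U' :: nat \<Rightarrow> ('b + nat) set) g' x'. hom_alg L A (Df_set_alg n U') g' \<and>
           ((\<forall>i j. U (k b) i = U (k b) j) \<longrightarrow> (\<forall>i j. U' i = U' j)) \<and>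
           (\<forall>a\<in>carr A. x' \<in> g' a \<longleftrightarrow> x b \<in> h a (k b))"
      by (intro small_base[OF L _ alg hk]) (use kx(1)[OF b] in blast)+
  qed
  then obtain U' :: "'b \<Rightarrow> nat \<Rightarrow> ('b + nat) set" and g' x' where
    U': "\<And>b. b \<in> J \<Longrightarrow> hom_alg L A (Df_set_alg n (U' b)) (g' b)"
      "\<And>b. b \<in> J \<Longrightarrow> (\<forall>i j. U (k b) i = U (k b) j) \<longrightarrow> (\<forall>i j. U' b i = U' b j)"
      "\<And>b a. b \<in> J \<Longrightarrow> a \<in> carr A \<Longrightarrow> x' b \<in> g' b a \<longleftrightarrow> x b \<in> h a (k b)"
    by metis
  define h' where "h' = (\<lambda>a. \<lambda>b\<in>J. g' b a)"
  have "hom_alg L A (prod_alg J (\<lambda>b. Df_set_alg n (U' b))) h'"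
    unfolding hom_alg_def
  proof (intro conjI ballI impI)
    show "h' \<in> carr A \<rightarrow> carr (prod_alg J (\<lambda>b. Df_set_alg n (U' b)))"
      using U'(1) by (auto simp: hom_alg_def prod_alg_def h'_def Pi_iff)
    fix f xs assume a: "f \<in> L" "xs \<in> lists (carr A)" "length xs = arity f"
    have "g' b (oper A f xs) = oper (Df_set_alg n (U' b)) f (map (g' b) xs)" if "b \<in> J" for b
      using U'(1)[OF that] a by (simp add: hom_alg_def)
    then show "h' (oper A f xs) = oper (prod_alg J (\<lambda>b. Df_set_alg n (U' b))) f (map h' xs)"
      by (auto simp: h'_def prod_alg_def comp_def fun_eq_iff)
  qed
  moreover have "inj_on h' (carr A)"
  proof -
    have sub: "h a l \<subseteq> h b l" if ab: "a \<in> carr A" "b \<in> carr A" "h' a = h' b" and l: "l \<in> I" for a b l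
    proof (rule ccontr)
      assume "\<not> h a l \<subseteq> h b l"
      then obtain z where z: "z \<in> h a l" "z \<notin> h b l" by auto
      have LB: "BMinus \<in> L" "BPlus \<in> L" using L by (auto simp: L_BA_def)
      define c where "c = oper A BMinus [a]"
      define c' where "c' = oper A BPlus [c, b]"
      define b' where "b' = oper A BMinus [c']"
      have cA: "c \<in> carr A" "c' \<in> carr A" "b' \<in> carr A"
        using alg LB ab by (auto simp: is_algebra_def c_def c'_def b'_def)
      have hb': "h b' m = (\<Pi>\<^sub>E i\<in>{..<n}. U m i) - (((\<Pi>\<^sub>E i\<in>{..<n}. U m i) - h a m) \<union> h b m)"
        if "m \<in> I" for m
      proof -
        have op: "h (oper A f xs) m = set_op n (\<Pi>\<^sub>E i\<in>{..<n}. U m i) f (map (\<lambda>a. h a m) xs)"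
          if "f \<in> L" "xs \<in> lists (carr A)" "length xs = arity f" for f xs
          using hk[OF \<open>m \<in> I\<close>] that by (simp add: hom_alg_def Df_set_alg_def set_alg_def)
        show ?thesis
          using op[of BMinus "[a]"] op[of BPlus "[c, b]"] op[of BMinus "[c']"] LB cA ab
          by (simp add: b'_def c'_def c_def)
      qed
      have "z \<in> (\<Pi>\<^sub>E i\<in>{..<n}. U l i)" using PiE_mem[OF hE[OF ab(1)] l] z(1) by blast
      then have "z \<in> h b' l" using hb'[OF l] z by auto
      then have J: "b' \<in> J" using cA l by (auto simp: J_def)
      from kx(2)[OF J] hb'[OF kx(1)[OF J]]
      have "x b' \<in> h a (k b')" "x b' \<notin> h b (k b')" by auto
      then have "g' b' a \<noteq> g' b' b" using U'(3)[OF J] ab by auto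
      moreover have "h' a b' = h' b b'" using ab by simp
      ultimately show False using J by (simp add: h'_def)
    qed
    show ?thesis
    proof (rule inj_onI)
      fix a b assume ab: "a \<in> carr A" "b \<in> carr A" "h' a = h' b"
      have "h a l = h b l" if "l \<in> I" for l
        using sub[OF ab that] sub[OF ab(2,1) ab(3)[symmetric] that] by auto
      then have "h a = h b" using hE[OF ab(1)] hE[OF ab(2)] by (intro PiE_ext) auto
      then show "a = b" using h(2) ab by (auto dest: inj_onD)
    qed
  qed
  ultimately have "embeddable L A (prod_alg J (\<lambda>b. Df_set_alg n (U' b)))"
    by (intro embeddableI alg)
  moreover have "(\<forall>k i j. U k i = U k j) \<longrightarrow> (\<forall>k\<in>J. \<forall>i j. U' k i = U' k j)"
    using U'(2) by blast
  ultimately show ?thesis by blast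
qed

theorem representable_if_Df:
  fixes A :: "'b alg" and I :: "'i set" and U :: "'i \<Rightarrow> nat \<Rightarrow> 'u set"
  assumes "L = L_Df n" "is_algebra L A"
    and "embeddable L A (prod_alg I (\<lambda>k. Df_set_alg n (U k)))"
  shows "representable n L A"
proof -
  have "L_BA \<subseteq> L" "L \<subseteq> L_PEA n" using assms(1) by (auto simp: L_Df_def L_PEA_def)
  from small_representation[OF this _ assms(2,3)] show ?thesis
    using assms(1) by (auto simp: representable_def)
qed

theorem representable_if_PEA:
  fixes A :: "'b alg" and I :: "'i set" and U :: "'i \<Rightarrow> 'u set"
  assumes "L_Df n \<subseteq> L" "L \<subseteq> L_PEA n" "L \<noteq> L_Df n" "is_algebra L A"
    and emb: "embeddable L A (prod_alg I (\<lambda>k. PEA_set_alg n (U k)))"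
  shows "representable n L A"
proof -
  have eq: "PEA_set_alg n X = Df_set_alg n (\<lambda>_. X)" for X :: "'x set"
    by (simp add: PEA_set_alg_def Df_set_alg_def)
  have L: "L_BA \<subseteq> L" using assms(1) by (auto simp: L_Df_def)
  obtain J :: "'b set" and U' :: "'b \<Rightarrow> nat \<Rightarrow> ('b + nat) set" where
    J: "embeddable L A (prod_alg J (\<lambda>k. Df_set_alg n (U' k)))" "\<forall>k\<in>J. \<forall>i j. U' k i = U' k j"
    using small_representation[OF L assms(2) _ assms(4), of "\<lambda>k _. U k" I] emb by (auto simp: eq)
  have "Df_set_alg n (U' k) = PEA_set_alg n (U' k 0)" if "k \<in> J" for k
  proof -
    have "U' k = (\<lambda>_. U' k 0)" using J(2) that by (intro ext) blast
    then show ?thesis unfolding eq by (rule arg_cong)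
  qed
  then have "prod_alg J (\<lambda>k. Df_set_alg n (U' k)) = prod_alg J (\<lambda>k. PEA_set_alg n (U' k 0))"
    by (auto simp: prod_alg_def fun_eq_iff intro!: PiE_cong)
  with J(1) show ?thesis
    using assms(3) unfolding representable_def by auto
qed

lemma is_algebra_complex_algebra:
  assumes "L \<subseteq> L_PEA n"
  shows "is_algebra L (complex_algebra S)"
  unfolding is_algebra_def
proof (intro ballI impI)
  fix f Xs assume *: "f \<in> L" "Xs \<in> lists (carr (complex_algebra S))" "length Xs = arity f"
  show "oper (complex_algebra S) f Xs \<in> carr (complex_algebra S)"
    using * by (cases f) (auto simp: complex_algebra_def complex_op_def L_BA_def
      numeral_2_eq_2 length_Suc_conv)
qed

end

theory Submission
  imports Defs "HOL-Library.Ramsey" "HOL-Library.Countable_Set"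
begin

text \<open>
  Given a graph on \<open>V\<close>, take \<open>n\<close> copies of \<open>V\<close> and make vertices in different copies adjacent. An atom
  describes an \<open>n\<close>-tuple of points: which entries coincide, and the colours, taken from the \<open>n\<close>
  copies of \<open>V\<close>, of its faces with \<open>n - 1\<close> distinct points; the faces of an injective tuple must have
  two adjacent colours.

  If the graph has infinite chromatic number, there is an ultrafilter on \<open>V\<close> all of whose members
  contain an edge. A representation is built by adding points one at a time, with faces labelled by
  ultrafilters on the colours: all faces at the new point that are not prescribed get this
  ultrafilter, placed in a copy that is not used by the prescribed ones. If the graph is infinite and
  finitely colourable, Ramsey's theorem yields, in any representation of the diagonal-free reduct, an
  injective tuple whose faces all lie in one colour class, which is impossible.

  The shift graphs on increasing \<open>k\<close>-tuples of natural numbers have infinite chromatic number but no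
  short odd closed walks, so their ultraproduct is bipartite. By Los's theorem and the downward
  Loewenheim--Skolem theorem any first-order theory that holds in all strongly representable
  structures has a countable model that is not strongly representable.
\<close>

section \<open>Atom structures over a graph\<close>

text \<open>The obstacle on the positive side is amalgamation. A new point acquires many faces at
  once, and no injective tuple may end up with pairwise non-adjacent faces. Giving one colour to all
  free faces fails if that colour is not adjacent to itself. An ultrafilter without independent
  members acts as a colour adjacent to itself, so it can sit on any number of faces. The price is
  that the representation need not respect infinite unions.

  The number of copies comes from the prescribed faces: at a new point they correspond to the
  subsets of size \<open>n - 2\<close> of a set with at most \<open>n - 1\<close> points. There are
  at most \<open>n - 1\<close> of them, so one of \<open>n\<close> copies is free.

  On the negative side a homomorphism respects finite unions only. A face therefore need not have a
  colour, but it does lie in one of finitely many colour classes, which is why finite colourability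
  is the right hypothesis.

  A countable model is sought because the theorem concerns structures over an arbitrary infinite
  type, which may be too small for the ultraproduct.\<close>

text \<open>In an atom, \<open>keq\<close> is the kernel of a tuple of length \<open>n\<close>, and \<open>hue s i\<close> is the colour of the face
  omitting the entry \<open>i\<close>. It is \<open>None\<close> if the remaining entries are not distinct.\<close>

datatype 'v atom = Atom (keq: "(nat \<times> nat) set") (hue: "nat \<Rightarrow> ('v \<times> nat) option")

abbreviation off :: "nat \<Rightarrow> nat \<Rightarrow> nat set" where
  "off n i \<equiv> {..<n} - {i}"

definition atom :: "nat \<Rightarrow> (nat \<Rightarrow> 'p) \<Rightarrow> ('p set \<Rightarrow> 'v \<times> nat) \<Rightarrow> 'v atom" where
  "atom n t \<kappa> = Atom {(i, j). i < n \<and> j < n \<and> t i = t j}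
     (\<lambda>i. if i < n \<and> inj_on t (off n i) then Some (\<kappa> (t ` off n i)) else None)"

definition cadj :: "('v \<Rightarrow> 'v \<Rightarrow> bool) \<Rightarrow> 'v \<times> nat \<Rightarrow> 'v \<times> nat \<Rightarrow> bool" where
  "cadj adj c d \<longleftrightarrow> snd c \<noteq> snd d \<or> adj (fst c) (fst d)"

text \<open>For \<open>n \<ge> 3\<close> all hues are defined exactly when the tuple is injective,
  so the last condition constrains injective tuples only. Points in \<open>nat\<close> suffice,
  because \<open>atom_shape\<close> replaces each entry by its least position.\<close>

definition atoms :: "nat \<Rightarrow> ('v \<Rightarrow> 'v \<Rightarrow> bool) \<Rightarrow> 'v set \<Rightarrow> 'v atom set" where
  "atoms n adj V = {s. (\<exists>(t :: nat \<Rightarrow> nat) \<kappa>. s = atom n t \<kappa>) \<and>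
     (\<forall>i c. hue s i = Some c \<longrightarrow> c \<in> V \<times> {..<n}) \<and>
     ((\<forall>i<n. hue s i \<noteq> None) \<longrightarrow> (\<exists>i<n. \<exists>j<n. cadj adj (the (hue s i)) (the (hue s j))))}"

definition cyl_eq :: "nat \<Rightarrow> nat \<Rightarrow> 'v atom \<Rightarrow> 'v atom \<Rightarrow> bool" where
  "cyl_eq n i s s' \<longleftrightarrow> hue s i = hue s' i \<and>
     (\<forall>a\<in>off n i. \<forall>b\<in>off n i. (a, b) \<in> keq s \<longleftrightarrow> (a, b) \<in> keq s')"

definition cylinder :: "nat \<Rightarrow> ('v \<Rightarrow> 'v \<Rightarrow> bool) \<Rightarrow> 'v set \<Rightarrow> nat \<Rightarrow> 'v atom set \<Rightarrow> 'v atom set" where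
  "cylinder n adj V i X = {s \<in> atoms n adj V. \<exists>s'\<in>X. cyl_eq n i s s'}"

text \<open>Computes the atom of \<open>t \<circ> \<sigma>\<close> from the atom of \<open>t\<close>
  alone, see \<open>sub_atom_atom\<close>. If the entries of \<open>t \<circ> \<sigma>\<close> off
  \<open>i\<close> are distinct, \<open>\<sigma>\<close> maps these \<open>n - 1\<close> positions
  onto all positions but one, so the chosen \<open>j\<close> is unique.\<close>

definition sub_atom :: "nat \<Rightarrow> (nat \<Rightarrow> nat) \<Rightarrow> 'v atom \<Rightarrow> 'v atom" where
  "sub_atom n \<sigma> s = Atom {(i, j). i < n \<and> j < n \<and> (\<sigma> i, \<sigma> j) \<in> keq s}
     (\<lambda>i. if i < n \<and> (\<forall>a\<in>off n i. \<forall>b\<in>off n i. (\<sigma> a, \<sigma> b) \<in> keq s \<longrightarrow> a = b)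
         then hue s (SOME j. j < n \<and> j \<notin> \<sigma> ` off n i) else None)"

definition atom_struc :: "nat \<Rightarrow> ('v \<Rightarrow> 'v \<Rightarrow> bool) \<Rightarrow> 'v set \<Rightarrow> 'v atom struc" where
  "atom_struc n adj V = \<lparr>univ = atoms n adj V, rel = (\<lambda>f. case f of
       Cyl i \<Rightarrow> {[s', s] | s s'. s \<in> atoms n adj V \<and> s' \<in> atoms n adj V \<and> cyl_eq n i s s'}
     | Diag i j \<Rightarrow> {[s] | s. s \<in> atoms n adj V \<and> (i, j) \<in> keq s}
     | Subst \<sigma> \<Rightarrow> {[s', s] | s s'. s \<in> atoms n adj V \<and> s' \<in> atoms n adj V \<and> s' = sub_atom n \<sigma> s}
     | _ \<Rightarrow> {})\<rparr>"

lemma third_index: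
  assumes "n \<ge> 3"
  shows "\<exists>i<n. i \<noteq> a \<and> i \<noteq> (b::nat)"
proof (rule ccontr)
  assume "\<not> ?thesis"
  then have "i = a \<or> i = b" if "i < n" for i using that by blast
  from this[of 0] this[of 1] this[of 2] show False using assms by auto
qed

lemma keq_atom [simp]: "(i, j) \<in> keq (atom n t \<kappa>) \<longleftrightarrow> i < n \<and> j < n \<and> t i = t j"
  by (simp add: atom_def)

lemma hue_atom: "hue (atom n t \<kappa>) i =
    (if i < n \<and> inj_on t (off n i) then Some (\<kappa> (t ` off n i)) else None)"
  by (simp add: atom_def)

text \<open>A face of \<open>t'\<close> determines the positions whose entries lie in it, and these
  determine the corresponding face of \<open>t\<close>. Pulling the colouring back along this
  correspondence shows that the choice of points is irrelevant.\<close>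

lemma atom_same_kernel:
  assumes ker: "keq (atom n t \<kappa>) = keq (atom n t' \<kappa>'')"
  shows "atom n t \<kappa> = atom n t' (\<lambda>H. \<kappa> (t ` {i. i < n \<and> t' i \<in> H}))"
proof -
  have eq: "t i = t j \<longleftrightarrow> t' i = t' j" if "i < n" "j < n" for i j
    using ker that keq_atom[of i j n t \<kappa>] keq_atom[of i j n t' \<kappa>''] by simp
  have inj: "inj_on t (off n i) \<longleftrightarrow> inj_on t' (off n i)" for i
    using eq by (auto simp: inj_on_def)
  have "t ` {j. j < n \<and> t' j \<in> t' ` off n i} = t ` off n i" for i
  proof (intro equalityI subsetI)
    fix y assume "y \<in> t ` {j. j < n \<and> t' j \<in> t' ` off n i}"
    then obtain j l where "y = t j" "j < n" "t' j = t' l" "l \<in> off n i" by blast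
    then show "y \<in> t ` off n i" using eq[of j l] by auto
  qed blast
  moreover have "{(i, j). i < n \<and> j < n \<and> t i = t j} = {(i, j). i < n \<and> j < n \<and> t' i = t' j}"
    using eq by auto
  ultimately show ?thesis
    by (simp add: atom_def inj fun_eq_iff)
qed

lemma atom_cong:
  assumes "\<And>i. i < n \<Longrightarrow> t i = t' i"
    and "\<And>i. i < n \<Longrightarrow> inj_on t (off n i) \<Longrightarrow> \<kappa> (t ` off n i) = \<kappa>' (t ` off n i)"
  shows "atom n t \<kappa> = atom n t' \<kappa>'"
proof -
  have "inj_on t (off n i) \<longleftrightarrow> inj_on t' (off n i)" for i
    using assms(1) by (intro inj_on_cong) auto
  moreover have "t ` off n i = t' ` off n i" for i
    using assms(1) by (intro image_cong) auto
  ultimately show ?thesis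
    using assms by (auto simp: atom_def fun_eq_iff)
qed

lemma atom_shape:
  fixes t :: "nat \<Rightarrow> 'p"
  shows "\<exists>(t' :: nat \<Rightarrow> nat) \<kappa>'. atom n t \<kappa> = atom n t' \<kappa>'"
proof -
  define t' where "t' = (\<lambda>i. LEAST j. t j = t i)"
  have "t (t' i) = t i" for i
    unfolding t'_def by (rule LeastI) simp
  then have "t i = t j \<longleftrightarrow> t' i = t' j" for i j
    by (metis t'_def)
  then have "keq (atom n t \<kappa>) = keq (atom n t' undefined)"
    by (simp add: atom_def)
  from atom_same_kernel[OF this] show ?thesis by blast
qed

lemma atom_in_atomsI:
  assumes "range \<kappa> \<subseteq> V \<times> {..<n}"
    and "inj_on t {..<n} \<Longrightarrow> \<exists>i<n. \<exists>j<n. cadj adj (\<kappa> (t ` off n i)) (\<kappa> (t ` off n j))"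
    and "n \<ge> 3"
  shows "atom n t \<kappa> \<in> atoms n adj V"
proof -
  have "\<exists>i<n. \<exists>j<n. cadj adj (the (hue (atom n t \<kappa>) i)) (the (hue (atom n t \<kappa>) j))"
    if *: "\<forall>i<n. hue (atom n t \<kappa>) i \<noteq> None"
  proof -
    have off: "inj_on t (off n i)" if "i < n" for i
      using * that by (auto simp: hue_atom split: if_splits)
    have "inj_on t {..<n}"
    proof (rule inj_onI)
      fix a b assume ab: "a \<in> {..<n}" "b \<in> {..<n}" "t a = t b"
      \<comment> \<open>Any two positions lie together in some \<open>off n i\<close>, because there
        are at least three.\<close>
      obtain i where "i < n" "i \<noteq> a" "i \<noteq> b"
        using third_index[OF \<open>n \<ge> 3\<close>] by blast
      then show "a = b" using off[of i] ab by (auto simp: inj_on_def)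
    qed
    then show ?thesis
      using assms(2) off by (auto simp: hue_atom)
  qed
  moreover have "c \<in> V \<times> {..<n}" if "hue (atom n t \<kappa>) i = Some c" for i c
    using that assms(1) by (metis option.distinct(1) option.inject rangeI hue_atom subsetD)
  ultimately show ?thesis
    using atom_shape[of n t \<kappa>] unfolding atoms_def by blast
qed

lemma atom_in_atomsE:
  assumes "atom n t \<kappa> \<in> atoms n adj V" "inj_on t {..<n}"
  shows "\<exists>i<n. \<exists>j<n. cadj adj (\<kappa> (t ` off n i)) (\<kappa> (t ` off n j))"
proof -
  have "inj_on t (off n i)" for i
    using assms(2) by (rule inj_on_subset) auto
  then have *: "hue (atom n t \<kappa>) i = Some (\<kappa> (t ` off n i))" if "i < n" for i
    using that by (simp add: hue_atom)
  then have "\<exists>i<n. \<exists>j<n. cadj adj (the (hue (atom n t \<kappa>) i)) (the (hue (atom n t \<kappa>) j))"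
    using assms(1) unfolding atoms_def by blast
  then show ?thesis using * by (metis option.sel)
qed

text \<open>Networks use ultrafilters on colourings of all sets of points, so a colouring that
  realises an atom must take legal values everywhere. Sets that are not faces get the default
  \<open>(v, 0)\<close>.\<close>

lemma atom_of_kernel:
  fixes t :: "nat \<Rightarrow> 'p"
  assumes s: "s \<in> atoms n adj V" and ker: "\<And>i j. i < n \<Longrightarrow> j < n \<Longrightarrow> (i, j) \<in> keq s \<longleftrightarrow> t i = t j"
    and V: "V \<noteq> {}" and "n > 0"
  shows "\<exists>\<kappa>. s = atom n t \<kappa> \<and> range \<kappa> \<subseteq> V \<times> {..<n}"
proof -
  obtain t0 :: "nat \<Rightarrow> nat" and \<kappa>0 where s0: "s = atom n t0 \<kappa>0"
    using s by (auto simp: atoms_def)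
  have "keq (atom n t0 \<kappa>0) = keq (atom n t undefined)"
    using ker by (auto simp: s0 atom_def)
  from atom_same_kernel[OF this] obtain \<kappa>1 where s1: "s = atom n t \<kappa>1"
    using s0 by metis
  obtain v where v: "v \<in> V" using V by blast
  define \<kappa> where "\<kappa> = (\<lambda>H. if \<exists>i<n. inj_on t (off n i) \<and> H = t ` off n i then \<kappa>1 H else (v, 0))"
  have "s = atom n t \<kappa>"
    unfolding s1
  proof (rule atom_cong)
    fix i assume "i < n" "inj_on t (off n i)"
    then have "\<exists>j<n. inj_on t (off n j) \<and> t ` off n i = t ` off n j" by blast
    then show "\<kappa>1 (t ` off n i) = \<kappa> (t ` off n i)" by (simp only: \<kappa>_def if_True)
  qed simp
  moreover have "\<kappa>1 (t ` off n i) \<in> V \<times> {..<n}" if "i < n" "inj_on t (off n i)" for i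
  proof -
    have "hue s i = Some (\<kappa>1 (t ` off n i))" using that by (simp add: s1 hue_atom)
    then show ?thesis using s unfolding atoms_def by blast
  qed
  then have "\<kappa> H \<in> V \<times> {..<n}" for H
    using v \<open>n > 0\<close> unfolding \<kappa>_def by (simp split: if_split) blast
  then have "range \<kappa> \<subseteq> V \<times> {..<n}" by blast
  ultimately show ?thesis by blast
qed

lemma sub_atom_atom:
  assumes \<sigma>: "\<sigma> \<in> {..<n} \<rightarrow> {..<n}"
  shows "sub_atom n \<sigma> (atom n t \<kappa>) = atom n (t \<circ> \<sigma>) \<kappa>"
proof -
  have \<sigma>n: "\<sigma> i < n" if "i < n" for i using \<sigma> that by auto
  have inj: "(\<forall>a\<in>off n i. \<forall>b\<in>off n i. (\<sigma> a, \<sigma> b) \<in> keq (atom n t \<kappa>) \<longrightarrow> a = b) \<longleftrightarrow>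
      inj_on (t \<circ> \<sigma>) (off n i)" for i
    using \<sigma>n by (auto simp: inj_on_def)
  have "hue (atom n t \<kappa>) (SOME j. j < n \<and> j \<notin> \<sigma> ` off n i) = Some (\<kappa> ((t \<circ> \<sigma>) ` off n i))"
    if i: "i < n" and inj: "inj_on (t \<circ> \<sigma>) (off n i)" for i
  proof -
    have "inj_on \<sigma> (off n i)" using inj by (rule inj_on_imageI2)
    then have card: "card (\<sigma> ` off n i) = n - 1" using i by (simp add: card_image)
    have sub: "\<sigma> ` off n i \<subseteq> {..<n}" using \<sigma>n by auto
    define j where "j = (SOME j. j < n \<and> j \<notin> \<sigma> ` off n i)"
    have "\<exists>j. j < n \<and> j \<notin> \<sigma> ` off n i"
    proof (rule ccontr)
      assume "\<not> ?thesis"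
      then have "{..<n} \<subseteq> \<sigma> ` off n i" by auto
      then have "n \<le> n - 1" using card by (metis card_mono card_lessThan finite_Diff finite_imageI finite_lessThan)
      then show False using i by simp
    qed
    then have j: "j < n" "j \<notin> \<sigma> ` off n i" unfolding j_def by (rule someI2_ex, simp)+
    have "\<sigma> ` off n i = off n j"
      by (rule card_subset_eq) (use sub j card in auto)
    moreover have "inj_on t (\<sigma> ` off n i)" using inj by (simp add: inj_on_imageI)
    ultimately have "inj_on t (off n j)" "(t \<circ> \<sigma>) ` off n i = t ` off n j"
      by (simp, metis image_comp)
    then show ?thesis
      unfolding j_def[symmetric] using j(1) by (simp add: hue_atom)
  qed
  then show ?thesis
    unfolding sub_atom_def inj by (auto simp: atom_def \<sigma>n)
qed

lemma cyl_eq_atom: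
  assumes "\<And>a. a \<in> off n i \<Longrightarrow> t a = t' a" "i < n"
  shows "cyl_eq n i (atom n t \<kappa>) (atom n t' \<kappa>') \<longleftrightarrow>
    (inj_on t (off n i) \<longrightarrow> \<kappa> (t ` off n i) = \<kappa>' (t ` off n i))"
proof -
  have "inj_on t (off n i) \<longleftrightarrow> inj_on t' (off n i)"
    using assms(1) by (intro inj_on_cong) auto
  moreover have "t ` off n i = t' ` off n i"
    using assms(1) by (intro image_cong) auto
  ultimately show ?thesis
    using assms by (auto simp: cyl_eq_def hue_atom)
qed

lemma cyl_eq_sym: "cyl_eq n i s s' \<longleftrightarrow> cyl_eq n i s' s"
  by (auto simp: cyl_eq_def)

lemma cyl_eq_refl: "cyl_eq n i s s"
  by (auto simp: cyl_eq_def)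

lemma complex_op_atom_struc:
  assumes "X \<subseteq> atoms n adj V"
  shows "complex_op (atom_struc n adj V) (Cyl i) [X] = cylinder n adj V i X"
    and "complex_op (atom_struc n adj V) (Diag i j) [] = {s \<in> atoms n adj V. (i, j) \<in> keq s}"
    and "complex_op (atom_struc n adj V) (Subst \<sigma>) [X] = {s \<in> atoms n adj V. sub_atom n \<sigma> s \<in> X}"
proof -
  have 1: "(\<exists>xs. list_all2 (\<in>) xs [X] \<and> P xs) \<longleftrightarrow> (\<exists>x\<in>X. P [x])" for P :: "'a atom list \<Rightarrow> bool"
    by (auto simp: list_all2_Cons2)
  show "complex_op (atom_struc n adj V) (Cyl i) [X] = cylinder n adj V i X"
    "complex_op (atom_struc n adj V) (Subst \<sigma>) [X] = {s \<in> atoms n adj V. sub_atom n \<sigma> s \<in> X}"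
    unfolding complex_op_def cylinder_def 1 using assms by (auto simp: atom_struc_def L_BA_def)
  show "complex_op (atom_struc n adj V) (Diag i j) [] = {s \<in> atoms n adj V. (i, j) \<in> keq s}"
    unfolding complex_op_def by (auto simp: atom_struc_def L_BA_def)
qed

section \<open>Ultrafilters and networks\<close>

definition ultra :: "'x set set \<Rightarrow> bool" where
  "ultra U \<longleftrightarrow> {} \<notin> U \<and> (\<forall>A\<in>U. \<forall>B. A \<subseteq> B \<longrightarrow> B \<in> U) \<and> (\<forall>A\<in>U. \<forall>B\<in>U. A \<inter> B \<in> U) \<and>
     (\<forall>A. A \<in> U \<or> - A \<in> U)"

definition push :: "('x \<Rightarrow> 'y) \<Rightarrow> 'x set set \<Rightarrow> 'y set set" where
  "push f U = {Y. f -` Y \<in> U}"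

lemma ultra_mono: "ultra U \<Longrightarrow> A \<in> U \<Longrightarrow> A \<subseteq> B \<Longrightarrow> B \<in> U"
  by (simp add: ultra_def)

lemma ultra_Int: "ultra U \<Longrightarrow> A \<in> U \<Longrightarrow> B \<in> U \<Longrightarrow> A \<inter> B \<in> U"
  by (simp add: ultra_def)

lemma ultra_nonempty: "ultra U \<Longrightarrow> A \<in> U \<Longrightarrow> \<exists>x. x \<in> A"
  by (cases "A = {}") (simp_all add: ultra_def ex_in_conv)

lemma ultra_Compl:
  assumes "ultra U"
  shows "- A \<in> U \<longleftrightarrow> A \<notin> U"
proof
  assume "- A \<in> U"
  show "A \<notin> U"
  proof
    assume "A \<in> U"
    from ultra_Int[OF assms this \<open>- A \<in> U\<close>] show False using assms by (simp add: ultra_def)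
  qed
next
  assume "A \<notin> U"
  then show "- A \<in> U" using assms unfolding ultra_def by blast
qed

lemma ultra_Collect_not: "ultra U \<Longrightarrow> {x. \<not> P x} \<in> U \<longleftrightarrow> {x. P x} \<notin> U"
  using ultra_Compl[of U "{x. P x}"] by (simp add: Collect_neg_eq)

lemma ultra_Collect_conj:
  assumes "ultra U"
  shows "{x. P x \<and> Q x} \<in> U \<longleftrightarrow> {x. P x} \<in> U \<and> {x. Q x} \<in> U"
proof
  assume *: "{x. P x \<and> Q x} \<in> U"
  show "{x. P x} \<in> U \<and> {x. Q x} \<in> U"
    by (intro conjI ultra_mono[OF assms *]) auto
next
  assume "{x. P x} \<in> U \<and> {x. Q x} \<in> U"
  then show "{x. P x \<and> Q x} \<in> U" using ultra_Int[OF assms] by (simp add: Collect_conj_eq)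
qed

lemma ultra_UNIV:
  assumes "ultra U"
  shows "UNIV \<in> U"
proof -
  have "{} \<notin> U" using assms by (simp add: ultra_def)
  then show ?thesis using ultra_Compl[OF assms, of "{}"] by simp
qed

lemma ultra_Collect_cong:
  assumes "ultra U" "{x. P x = Q x} \<in> U"
  shows "{x. P x} \<in> U \<longleftrightarrow> {x. Q x} \<in> U"
proof
  assume "{x. P x} \<in> U"
  then have "{x. P x} \<inter> {x. P x = Q x} \<in> U" using assms by (simp add: ultra_Int)
  then show "{x. Q x} \<in> U" by (rule ultra_mono[OF assms(1)]) auto
next
  assume "{x. Q x} \<in> U"
  then have "{x. Q x} \<inter> {x. P x = Q x} \<in> U" using assms by (simp add: ultra_Int)
  then show "{x. P x} \<in> U" by (rule ultra_mono[OF assms(1)]) auto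
qed

lemma ultra_finite_UN:
  assumes U: "ultra U" and "finite I" "(\<Union>i\<in>I. A i) \<in> U"
  shows "\<exists>i\<in>I. A i \<in> U"
  using assms(2,3)
proof (induction I rule: finite_induct)
  case empty
  then show ?case using U by (simp add: ultra_def)
next
  case (insert i I)
  show ?case
  proof (cases "A i \<in> U")
    case False
    then have "- A i \<in> U" using U by (simp add: ultra_Compl)
    then have "- A i \<inter> (\<Union>j\<in>insert i I. A j) \<in> U" using insert.prems U by (simp add: ultra_Int)
    then have "(\<Union>j\<in>I. A j) \<in> U" by (rule ultra_mono[OF U]) auto
    then show ?thesis using insert.IH by auto
  qed auto
qed

lemma ultra_finite_INT:
  assumes U: "ultra U" and "finite I" "\<And>i. i \<in> I \<Longrightarrow> A i \<in> U"
  shows "(\<Inter>i\<in>I. A i) \<in> U"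
  using assms(2,3) by (induction I rule: finite_induct) (auto simp: ultra_Int ultra_UNIV U)

lemma ultra_push:
  assumes "ultra U"
  shows "ultra (push f U)"
  unfolding ultra_def push_def
proof (intro conjI allI ballI impI; clarsimp)
  show "{} \<in> U \<Longrightarrow> False" using assms by (simp add: ultra_def)
  show "f -` A \<in> U \<Longrightarrow> A \<subseteq> B \<Longrightarrow> f -` B \<in> U" for A B
    using assms by (metis ultra_mono vimage_mono)
  show "f -` A \<in> U \<Longrightarrow> f -` B \<in> U \<Longrightarrow> f -` A \<inter> f -` B \<in> U" for A B
    using assms by (simp add: ultra_Int)
  show "f -` (- A) \<notin> U \<Longrightarrow> f -` A \<in> U" for A
    using assms by (simp add: ultra_Compl vimage_Compl)
qed

lemma ultra_subset_eq: "ultra U \<Longrightarrow> ultra W \<Longrightarrow> U \<subseteq> W \<Longrightarrow> U = W"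
proof (intro equalityI subsetI)
  fix A assume *: "ultra U" "ultra W" "U \<subseteq> W" "A \<in> W"
  show "A \<in> U"
  proof (rule ccontr)
    assume "A \<notin> U"
    then have "- A \<in> W" using * ultra_Compl[of U A] by blast
    then show False using * ultra_Compl[of W A] by blast
  qed
qed blast

lemma ultra_extend:
  assumes "\<B> \<noteq> {}" "{} \<notin> \<B>" "\<And>A B. A \<in> \<B> \<Longrightarrow> B \<in> \<B> \<Longrightarrow> \<exists>C\<in>\<B>. C \<subseteq> A \<inter> B"
  obtains U where "ultra U" "\<B> \<subseteq> U"
proof -
  define fil where "fil = (\<lambda>F :: 'a set set. {} \<notin> F \<and> (\<forall>A\<in>F. \<forall>B. A \<subseteq> B \<longrightarrow> B \<in> F) \<and>
    (\<forall>A\<in>F. \<forall>B\<in>F. A \<inter> B \<in> F))"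
  define Z where "Z = {F. \<B> \<subseteq> F \<and> fil F}"
  define F0 where "F0 = {X. \<exists>B\<in>\<B>. B \<subseteq> X}"
  have "F0 \<in> Z"
    unfolding Z_def fil_def
  proof (intro CollectI conjI ballI allI impI)
    fix A B assume "A \<in> F0" "B \<in> F0"
    then obtain A' B' where "A' \<in> \<B>" "A' \<subseteq> A" "B' \<in> \<B>" "B' \<subseteq> B" by (auto simp: F0_def)
    then show "A \<inter> B \<in> F0" using assms(3)[of A' B'] unfolding F0_def by blast
  qed (use assms(2) in \<open>auto simp: F0_def\<close>)
  then have "Z \<noteq> {}" by blast
  moreover have "\<Union>\<C> \<in> Z" if C: "\<C> \<noteq> {}" "subset.chain Z \<C>" for \<C>
    unfolding Z_def fil_def
  proof (intro CollectI conjI ballI allI impI)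
    have CZ: "F \<in> Z" if "F \<in> \<C>" for F using C that by (auto simp: subset.chain_def)
    show "\<B> \<subseteq> \<Union>\<C>" using C(1) CZ by (auto simp: Z_def)
    show "{} \<notin> \<Union>\<C>" using CZ by (auto simp: Z_def fil_def)
    show "B \<in> \<Union>\<C>" if AB: "A \<in> \<Union>\<C>" "A \<subseteq> B" for A B
    proof -
      obtain E where "E \<in> \<C>" "A \<in> E" using AB by blast
      moreover have "B \<in> E" using CZ[OF \<open>E \<in> \<C>\<close>] \<open>A \<in> E\<close> AB(2) unfolding Z_def fil_def by blast
      ultimately show ?thesis by blast
    qed
    fix A B assume "A \<in> \<Union>\<C>" "B \<in> \<Union>\<C>"
    then obtain F G where FG: "F \<in> \<C>" "A \<in> F" "G \<in> \<C>" "B \<in> G" by blast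
    then have "F \<subseteq> G \<or> G \<subseteq> F" using C(2) by (auto simp: subset.chain_def)
    then obtain E where "E \<in> \<C>" "A \<in> E" "B \<in> E" using FG by blast
    moreover have "A \<inter> B \<in> E"
      using CZ[OF \<open>E \<in> \<C>\<close>] \<open>A \<in> E\<close> \<open>B \<in> E\<close> unfolding Z_def fil_def by blast
    ultimately show "A \<inter> B \<in> \<Union>\<C>" by blast
  qed
  ultimately obtain U where U: "U \<in> Z" "\<And>X. X \<in> Z \<Longrightarrow> U \<subseteq> X \<Longrightarrow> X = U"
    using subset_Zorn_nonempty[of Z] by blast
  have fU: "{} \<notin> U" "\<And>A B. A \<in> U \<Longrightarrow> A \<subseteq> B \<Longrightarrow> B \<in> U" "\<And>A B. A \<in> U \<Longrightarrow> B \<in> U \<Longrightarrow> A \<inter> B \<in> U"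
    "\<B> \<subseteq> U"
    using U(1) by (auto simp: Z_def fil_def)
  have "A \<in> U \<or> - A \<in> U" for A
  proof (rule ccontr)
    assume A: "\<not> (A \<in> U \<or> - A \<in> U)"
    define X where "X = {X. \<exists>B\<in>U. A \<inter> B \<subseteq> X}"
    have "X \<in> Z"
      unfolding Z_def fil_def
    proof (intro CollectI conjI ballI allI impI)
      show "\<B> \<subseteq> X" using fU(4) by (auto simp: X_def)
      show "{} \<notin> X"
      proof
        assume "{} \<in> X"
        then obtain B where "B \<in> U" "A \<inter> B \<subseteq> {}" by (auto simp: X_def)
        then have "B \<subseteq> - A" by auto
        then show False using fU(2) A \<open>B \<in> U\<close> by blast
      qed
      show "C \<in> X" if "B \<in> X" "B \<subseteq> C" for B C
        using that unfolding X_def by blast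
      fix B C assume "B \<in> X" "C \<in> X"
      then obtain B' C' where "B' \<in> U" "C' \<in> U" "A \<inter> B' \<subseteq> B" "A \<inter> C' \<subseteq> C" by (auto simp: X_def)
      then have "B' \<inter> C' \<in> U" "A \<inter> (B' \<inter> C') \<subseteq> B \<inter> C" using fU(3) by auto
      then show "B \<inter> C \<in> X" unfolding X_def by blast
    qed
    moreover have "U \<subseteq> X" by (auto simp: X_def)
    ultimately have "X = U" using U(2) by blast
    moreover have "U \<noteq> {}" using fU(4) assms(1) by auto
    then have "A \<in> X" unfolding X_def by auto
    ultimately show False using A by simp
  qed
  then have "ultra U" using fU(1-3) unfolding ultra_def by blast
  then show ?thesis using that fU(4) by blast
qed

section \<open>Graphs of infinite chromatic number and the ultrafilters they carry\<close>

definition infinite_chromatic :: "('v \<Rightarrow> 'v \<Rightarrow> bool) \<Rightarrow> 'v set \<Rightarrow> bool" where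
  "infinite_chromatic adj V \<longleftrightarrow>
     (\<forall>\<I>. finite \<I> \<and> (\<forall>I\<in>\<I>. \<forall>x\<in>I. \<forall>y\<in>I. \<not> adj x y) \<longrightarrow> \<not> V \<subseteq> \<Union>\<I>)"

text \<open>The complements in \<open>V\<close> of finite unions of independent sets are nonempty
  and closed under intersection. An ultrafilter containing all of them has no independent
  member.\<close>

lemma infinite_chromatic_ultra:
  assumes "infinite_chromatic adj V"
  obtains \<mu> where "ultra \<mu>" "V \<in> \<mu>" "\<And>X. X \<in> \<mu> \<Longrightarrow> \<exists>x\<in>X. \<exists>y\<in>X. adj x y"
proof -
  define ind where "ind = (\<lambda>\<I>. finite \<I> \<and> (\<forall>I\<in>\<I>. \<forall>x\<in>I. \<forall>y\<in>I. \<not> adj x y))"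
  define \<B> where "\<B> = {V - \<Union>\<I> | \<I>. ind \<I>}"
  have "ind {}" by (simp add: ind_def)
  then have VB: "V \<in> \<B>" unfolding \<B>_def by (intro CollectI exI[of _ "{}"]) simp
  obtain \<mu> where \<mu>: "ultra \<mu>" "\<B> \<subseteq> \<mu>"
  proof (rule ultra_extend)
    show "\<B> \<noteq> {}" using VB by blast
    show "{} \<notin> \<B>" using assms by (auto simp: \<B>_def ind_def infinite_chromatic_def)
    fix A B assume "A \<in> \<B>" "B \<in> \<B>"
    then obtain \<I> \<J> where "ind \<I>" "ind \<J>" "A = V - \<Union>\<I>" "B = V - \<Union>\<J>" by (auto simp: \<B>_def)
    moreover have "ind (\<I> \<union> \<J>)" using \<open>ind \<I>\<close> \<open>ind \<J>\<close> by (auto simp: ind_def)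
    then have "V - \<Union>(\<I> \<union> \<J>) \<in> \<B>" unfolding \<B>_def by blast
    moreover have "V - \<Union>(\<I> \<union> \<J>) \<subseteq> A \<inter> B"
      unfolding \<open>A = _\<close> \<open>B = _\<close> by auto
    ultimately show "\<exists>C\<in>\<B>. C \<subseteq> A \<inter> B" by (auto intro: bexI)
  qed
  moreover have "\<exists>x\<in>X. \<exists>y\<in>X. adj x y" if X: "X \<in> \<mu>" for X
  proof (rule ccontr)
    assume "\<not> ?thesis"
    then have "ind {X}" by (simp add: ind_def)
    then have "V - \<Union>{X} \<in> \<B>" unfolding \<B>_def by blast
    then have "V - X \<in> \<mu>" using \<mu>(2) by auto
    then have "- X \<in> \<mu>" by (rule ultra_mono[OF \<mu>(1)]) auto
    then show False using X \<mu>(1) by (simp add: ultra_Compl)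
  qed
  ultimately show ?thesis using that VB by blast
qed

section \<open>Networks labelled by ultrafilters and their one-point extensions\<close>

locale reflexive_ultrafilter =
  fixes n :: nat and adj :: "'v \<Rightarrow> 'v \<Rightarrow> bool" and V :: "'v set" and \<mu> :: "'v set set"
  assumes n3: "n \<ge> 3" and ultra_\<mu>: "ultra \<mu>" and V_\<mu>: "V \<in> \<mu>"
    and \<mu>_adj: "\<And>X. X \<in> \<mu> \<Longrightarrow> \<exists>x\<in>X. \<exists>y\<in>X. adj x y"
begin

definition proper :: "('p set \<Rightarrow> 'v \<times> nat) \<Rightarrow> bool" where
  "proper \<kappa> \<longleftrightarrow> range \<kappa> \<subseteq> V \<times> {..<n}"

definition good :: "'p set \<Rightarrow> ('p set \<Rightarrow> 'v \<times> nat) \<Rightarrow> bool" where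
  "good G \<kappa> \<longleftrightarrow> (\<exists>g\<in>G. \<exists>h\<in>G. cadj adj (\<kappa> (G - {g})) (\<kappa> (G - {h})))"

text \<open>The label of a set \<open>G\<close> of at most \<open>n\<close> points is an ultrafilter on colourings of all sets of points;
  only the colours of the faces contained in \<open>G\<close> matter.\<close>

definition net :: "'p set \<Rightarrow> ('p set \<Rightarrow> ('p set \<Rightarrow> 'v \<times> nat) set set) \<Rightarrow> bool" where
  "net M \<Lambda> \<longleftrightarrow> (\<forall>G. G \<subseteq> M \<and> finite G \<and> card G \<le> n \<longrightarrow>
     ultra (\<Lambda> G) \<and> {\<kappa>. proper \<kappa>} \<in> \<Lambda> G \<and> (card G = n \<longrightarrow> {\<kappa>. good G \<kappa>} \<in> \<Lambda> G) \<and>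
     (\<forall>H\<subseteq>G. card H = n - 1 \<longrightarrow> push (\<lambda>\<kappa>. \<kappa> H) (\<Lambda> G) = push (\<lambda>\<kappa>. \<kappa> H) (\<Lambda> H)))"

lemma V_nonempty: "V \<noteq> {}"
  using ultra_nonempty[OF ultra_\<mu> V_\<mu>] by blast

text \<open>Constraints can be intersected face by face, so the sets \<open>b Y\<close> form a
  filter base once \<open>ex\<close> makes them nonempty. An ultrafilter above this base projects
  onto \<open>c H\<close>, because an inclusion between ultrafilters is an equality.\<close>

lemma amalgam:
  fixes c :: "'p set \<Rightarrow> ('v \<times> nat) set set" and P :: "('p set \<Rightarrow> 'v \<times> nat) \<Rightarrow> bool"
  assumes c: "\<And>H. H \<in> \<H> \<Longrightarrow> ultra (c H)"
    and ex: "\<And>Y. (\<And>H. H \<in> \<H> \<Longrightarrow> Y H \<in> c H) \<Longrightarrow> \<exists>\<kappa>. proper \<kappa> \<and> P \<kappa> \<and> (\<forall>H\<in>\<H>. \<kappa> H \<in> Y H)"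
  obtains u where "ultra u" "{\<kappa>. proper \<kappa>} \<in> u" "{\<kappa>. P \<kappa>} \<in> u"
    "\<And>H. H \<in> \<H> \<Longrightarrow> push (\<lambda>\<kappa>. \<kappa> H) u = c H"
proof -
  define b where "b = (\<lambda>Y. {\<kappa>. proper \<kappa> \<and> P \<kappa> \<and> (\<forall>H\<in>\<H>. \<kappa> H \<in> Y H)})"
  define \<B> where "\<B> = {b Y | Y. \<forall>H\<in>\<H>. Y H \<in> c H}"
  have top: "b (\<lambda>_. UNIV) \<in> \<B>" unfolding \<B>_def using c by (blast intro: ultra_UNIV)
  obtain u where u: "ultra u" "\<B> \<subseteq> u"
  proof (rule ultra_extend)
    show "\<B> \<noteq> {}" using top by blast
    show "{} \<notin> \<B>" using ex unfolding \<B>_def b_def by blast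
    fix A B assume "A \<in> \<B>" "B \<in> \<B>"
    then obtain Y Z where YZ: "\<forall>H\<in>\<H>. Y H \<in> c H" "\<forall>H\<in>\<H>. Z H \<in> c H" "A = b Y" "B = b Z"
      by (auto simp: \<B>_def)
    then have "b (\<lambda>H. Y H \<inter> Z H) \<in> \<B>" unfolding \<B>_def using c ultra_Int by blast
    moreover have "b (\<lambda>H. Y H \<inter> Z H) \<subseteq> A \<inter> B" unfolding YZ b_def by blast
    ultimately show "\<exists>C\<in>\<B>. C \<subseteq> A \<inter> B" by blast
  qed
  have topu: "b (\<lambda>_. UNIV) \<in> u" using top u by blast
  have "{\<kappa>. proper \<kappa>} \<in> u" "{\<kappa>. P \<kappa>} \<in> u"
    by (rule ultra_mono[OF u(1) topu], auto simp: b_def)+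
  moreover have "push (\<lambda>\<kappa>. \<kappa> H) u = c H" if H: "H \<in> \<H>" for H
  proof (rule ultra_subset_eq[symmetric])
    show "c H \<subseteq> push (\<lambda>\<kappa>. \<kappa> H) u"
    proof
      fix A assume A: "A \<in> c H"
      have "b ((\<lambda>_. UNIV)(H := A)) \<in> \<B>" unfolding \<B>_def
        using c A by (intro CollectI exI[of _ "(\<lambda>_. UNIV)(H := A)"]) (auto intro: ultra_UNIV)
      then have "b ((\<lambda>_. UNIV)(H := A)) \<in> u" using u by blast
      then have "(\<lambda>\<kappa>. \<kappa> H) -` A \<in> u"
        by (rule ultra_mono[OF u(1)]) (use H in \<open>auto simp: b_def\<close>)
      then show "A \<in> push (\<lambda>\<kappa>. \<kappa> H) u" by (simp add: push_def)
    qed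
  qed (use c H u ultra_push in auto)
  ultimately show ?thesis using that u by blast
qed

text \<open>Once the label of \<open>insert x F\<close> is fixed, every other set containing
  \<open>x\<close> needs a compatible one. Faces at \<open>x\<close> inside
  \<open>insert x F\<close> inherit their ultrafilter from \<open>W\<close>, faces without
  \<open>x\<close> keep the old one, and all remaining faces share \<open>\<nu>\<close>, the given
  ultrafilter in a free copy.\<close>

lemma net_extend:
  fixes \<Lambda> :: "'p set \<Rightarrow> ('p set \<Rightarrow> 'v \<times> nat) set set"
  assumes net: "net M \<Lambda>" and x: "x \<notin> M" and F: "F \<subseteq> M" "finite F" "card F \<le> n - 1"
    and W: "ultra W" "{\<kappa>. proper \<kappa>} \<in> W"
    and Wg: "card F = n - 1 \<Longrightarrow> {\<kappa>. good (insert x F) \<kappa>} \<in> W"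
    and WF: "card F = n - 1 \<Longrightarrow> push (\<lambda>\<kappa>. \<kappa> F) W = push (\<lambda>\<kappa>. \<kappa> F) (\<Lambda> F)"
  obtains \<Lambda>' where "net (insert x M) \<Lambda>'" "\<And>G. x \<notin> G \<Longrightarrow> \<Lambda>' G = \<Lambda> G" "\<Lambda>' (insert x F) = W"
proof -
  have xF: "x \<notin> F" using x F by auto
  \<comment> \<open>Fewer than \<open>n\<close> faces at \<open>x\<close> are prescribed, so some copy \<open>k\<close> is not used by them.\<close>
  define S where "S = {H. H \<subseteq> F \<and> card H = n - 2}"
  have "card F choose (n - 2) \<le> (n - 1) choose (n - 2)"
    using F(3) by (rule binomial_right_mono)
  also have "\<dots> = n - 1"
    using n3 binomial_symmetric[of "n - 2" "n - 1"] by (simp add: numeral_2_eq_2 numeral_3_eq_3 Suc_diff_Suc)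
  finally have "card S \<le> n - 1" unfolding S_def using F(2) by (simp add: n_subsets)
  have "finite S" unfolding S_def using F(2) by simp
  have colW: "V \<times> {..<n} \<in> push (\<lambda>\<kappa>. \<kappa> H) W" for H
    unfolding push_def by (intro CollectI ultra_mono[OF W]) (auto simp: proper_def)
  \<comment> \<open>Finitely many copies cover all colours, so \<open>W\<close> concentrates the
    colour of each face on one of them. This is recorded as \<open>cp H\<close>.\<close>
  have "\<exists>k\<in>{..<n}. V \<times> {k} \<in> push (\<lambda>\<kappa>. \<kappa> (insert x H)) W" for H
  proof (rule ultra_finite_UN[OF ultra_push[OF W(1)]])
    have "(\<Union>k\<in>{..<n}. V \<times> {k}) = V \<times> {..<n}" by auto
    then show "(\<Union>k\<in>{..<n}. V \<times> {k}) \<in> push (\<lambda>\<kappa>. \<kappa> (insert x H)) W" using colW by simp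
  qed simp
  then obtain cp where cp: "\<And>H. cp H < n" "\<And>H. V \<times> {cp H} \<in> push (\<lambda>\<kappa>. \<kappa> (insert x H)) W"
    by (metis lessThan_iff)
  have "card (cp ` S) < card {..<n}"
    using card_image_le[OF \<open>finite S\<close>, of cp] \<open>card S \<le> n - 1\<close> n3 by simp
  then have "\<not> {..<n} \<subseteq> cp ` S"
    by (meson \<open>finite S\<close> card_mono finite_imageI linorder_not_less)
  then obtain k where k: "k < n" "k \<notin> cp ` S" by auto
  define \<nu> where "\<nu> = push (\<lambda>v. (v, k)) \<mu>"
  have ultra_\<nu>: "ultra \<nu>" unfolding \<nu>_def by (intro ultra_push ultra_\<mu>)
  have "(\<lambda>v. (v, k)) -` (V \<times> {k}) = V" by auto
  then have V_\<nu>: "V \<times> {k} \<in> \<nu>" unfolding \<nu>_def push_def using V_\<mu> by simp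
  have \<nu>_adj: "\<exists>a\<in>X. \<exists>b\<in>X. cadj adj a b" if X: "X \<in> \<nu>" for X
  proof -
    have "(\<lambda>v. (v, k)) -` X \<in> \<mu>" using X by (simp add: \<nu>_def push_def)
    then obtain a b where "(a, k) \<in> X" "(b, k) \<in> X" "adj a b" using \<mu>_adj by fastforce
    then show ?thesis by (force simp: cadj_def)
  qed
  define c where "c = (\<lambda>H. if x \<notin> H then push (\<lambda>\<kappa>. \<kappa> H) (\<Lambda> H)
     else if H \<subseteq> insert x F then push (\<lambda>\<kappa>. \<kappa> H) W else \<nu>)"
  define Q where "Q = (\<lambda>G u. ultra u \<and> {\<kappa>. proper \<kappa>} \<in> u \<and> (card G = n \<longrightarrow> {\<kappa>. good G \<kappa>} \<in> u) \<and>
     (\<forall>H\<subseteq>G. card H = n - 1 \<longrightarrow> push (\<lambda>\<kappa>. \<kappa> H) u = c H))"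
  have netD: "ultra (\<Lambda> G)" "{\<kappa>. proper \<kappa>} \<in> \<Lambda> G" "card G = n \<Longrightarrow> {\<kappa>. good G \<kappa>} \<in> \<Lambda> G"
    "\<And>H. H \<subseteq> G \<Longrightarrow> card H = n - 1 \<Longrightarrow> push (\<lambda>\<kappa>. \<kappa> H) (\<Lambda> G) = push (\<lambda>\<kappa>. \<kappa> H) (\<Lambda> H)"
    if "G \<subseteq> M" "finite G" "card G \<le> n" for G
    using net that unfolding net_def by blast+
  have c: "ultra (c H) \<and> V \<times> {..<n} \<in> c H" if H: "H \<subseteq> insert x M" "finite H" "card H = n - 1" for H
  proof -
    consider "x \<notin> H" | "x \<in> H" "H \<subseteq> insert x F" | "x \<in> H" "\<not> H \<subseteq> insert x F" by blast
    then show ?thesis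
    proof cases
      case 1
      then have "H \<subseteq> M" "card H \<le> n" using H by auto
      note * = netD[OF this(1) H(2) this(2)]
      have "V \<times> {..<n} \<in> push (\<lambda>\<kappa>. \<kappa> H) (\<Lambda> H)"
        unfolding push_def by (intro CollectI ultra_mono[OF *(1,2)]) (auto simp: proper_def)
      then show ?thesis using 1 * by (simp add: c_def ultra_push)
    next
      case 2
      then show ?thesis using W(1) colW by (simp add: c_def ultra_push)
    next
      case 3
      have "V \<times> {k} \<subseteq> V \<times> {..<n}" using k by auto
      then show ?thesis using 3 ultra_mono[OF ultra_\<nu> V_\<nu>] ultra_\<nu> by (simp add: c_def)
    qed
  qed
  have exQ: "\<exists>u. Q G u" if G: "G \<subseteq> insert x M" "finite G" "card G \<le> n" "x \<in> G" "\<not> G \<subseteq> insert x F" for G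
  proof -
    let ?H = "{H. H \<subseteq> G \<and> card H = n - 1}"
    have cH: "ultra (c H)" "V \<times> {..<n} \<in> c H" if "H \<in> ?H" for H
      using c[of H] that G finite_subset by auto
    obtain u where "ultra u" "{\<kappa>. proper \<kappa>} \<in> u" "{\<kappa>. card G = n \<longrightarrow> good G \<kappa>} \<in> u"
      "\<And>H. H \<in> ?H \<Longrightarrow> push (\<lambda>\<kappa>. \<kappa> H) u = c H"
    proof (rule amalgam[of ?H c "\<lambda>\<kappa>. card G = n \<longrightarrow> good G \<kappa>"])
      fix Y assume Y: "\<And>H. H \<in> ?H \<Longrightarrow> Y H \<in> c H"
      have "\<exists>a. a \<in> Y H \<inter> V \<times> {..<n}" if "H \<in> ?H" for H
        using ultra_nonempty[OF cH(1)[OF that] ultra_Int[OF cH(1)[OF that] Y[OF that] cH(2)[OF that]]] .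
      then obtain \<kappa>0 where \<kappa>0: "\<And>H. H \<in> ?H \<Longrightarrow> \<kappa>0 H \<in> Y H \<inter> V \<times> {..<n}" by metis
      obtain v where "v \<in> V" using V_nonempty by blast
      then have "(v, 0) \<in> V \<times> {..<n}" using n3 by auto
      then obtain d where d: "d \<in> V \<times> {..<n}" by blast
      show "\<exists>\<kappa>. proper \<kappa> \<and> (card G = n \<longrightarrow> good G \<kappa>) \<and> (\<forall>H\<in>?H. \<kappa> H \<in> Y H)"
      proof (cases "card G = n")
        case False
        define \<kappa> where "\<kappa> = (\<lambda>H. if H \<in> ?H then \<kappa>0 H else d)"
        have "\<kappa> H \<in> V \<times> {..<n}" for H
          using \<kappa>0[of H] d unfolding \<kappa>_def by (simp split: if_split)
        then have "proper \<kappa>" unfolding proper_def by blast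
        moreover have "\<kappa> H \<in> Y H" if "H \<in> ?H" for H
          using \<kappa>0[OF that] that unfolding \<kappa>_def by simp
        ultimately show ?thesis using False by blast
      next
        case True
        \<comment> \<open>Two faces provide the adjacent pair. \<open>H1\<close> contains
          \<open>x\<close> and the outside point \<open>y\<close>, so it carries
          \<open>\<nu>\<close>; \<open>H2\<close> omits \<open>y\<close>. Either \<open>H2\<close>
          is prescribed and lies in a copy other than \<open>k\<close>, or it carries
          \<open>\<nu>\<close> too, and then a member of \<open>\<nu>\<close> common to both
          constraints contains an edge.\<close>
        obtain y where y: "y \<in> G" "y \<notin> insert x F" using G by blast
        have "\<not> G \<subseteq> {x, y}"
        proof
          assume "G \<subseteq> {x, y}"
          then have "card G \<le> card {x, y}" by (intro card_mono) auto
          also have "\<dots> \<le> 2" by (simp add: card_insert_if)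
          finally show False using True n3 by simp
        qed
        then obtain g where g: "g \<in> G" "g \<noteq> x" "g \<noteq> y" by blast
        define H1 where "H1 = G - {g}"
        define H2 where "H2 = G - {y}"
        have H12: "H1 \<in> ?H" "H2 \<in> ?H" "H1 \<noteq> H2"
          using True g y G by (auto simp: H1_def H2_def)
        have c1: "c H1 = \<nu>" using y g G by (auto simp: c_def H1_def)
        have "\<exists>a\<in>Y H1 \<inter> V \<times> {..<n}. \<exists>b\<in>Y H2 \<inter> V \<times> {..<n}. cadj adj a b"
        proof (cases "H2 \<subseteq> insert x F")
          case T: True
          have xH2: "x \<in> H2" using G y by (auto simp: H2_def)
          have "H2 - {x} \<in> S"
            using T xH2 H12(2) G finite_subset[of H2 G] by (auto simp: S_def)
          then have "cp (H2 - {x}) \<noteq> k" using k by auto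
          moreover have "insert x (H2 - {x}) = H2" using xH2 by auto
          then have "V \<times> {cp (H2 - {x})} \<in> c H2"
            using cp(2)[of "H2 - {x}"] T xH2 by (simp add: c_def)
          then obtain b where "b \<in> Y H2 \<inter> V \<times> {cp (H2 - {x})}"
            using cH(1)[OF H12(2)] Y[OF H12(2)] ultra_nonempty ultra_Int by metis
          moreover obtain a where "a \<in> Y H1 \<inter> V \<times> {k}"
            using Y[OF H12(1)] c1 ultra_\<nu> V_\<nu> ultra_nonempty ultra_Int by metis
          ultimately have "a \<in> Y H1 \<inter> V \<times> {..<n}" "b \<in> Y H2 \<inter> V \<times> {..<n}" "cadj adj a b"
            using k(1) cp(1)[of "H2 - {x}"] by (auto simp: cadj_def)
          then show ?thesis by blast
        next
          case False
          then have "c H2 = \<nu>" using G y by (auto simp: c_def H2_def)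
          then have "Y H1 \<inter> Y H2 \<inter> V \<times> {k} \<in> \<nu>"
            using Y[OF H12(1)] Y[OF H12(2)] c1 V_\<nu> ultra_\<nu> by (simp add: ultra_Int)
          from \<nu>_adj[OF this] show ?thesis using k(1) by blast
        qed
        then obtain a b where ab: "a \<in> Y H1 \<inter> V \<times> {..<n}" "b \<in> Y H2 \<inter> V \<times> {..<n}" "cadj adj a b"
          by blast
        define \<kappa> where "\<kappa> = (\<lambda>H. if H = H1 then a else if H = H2 then b else if H \<in> ?H then \<kappa>0 H else d)"
        have "\<kappa> H \<in> V \<times> {..<n}" for H
          using \<kappa>0[of H] d ab unfolding \<kappa>_def by (simp split: if_split)
        then have "proper \<kappa>" unfolding proper_def by blast
        moreover have "good G \<kappa>"
        proof -
          have "cadj adj (\<kappa> (G - {g})) (\<kappa> (G - {y}))"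
            using ab H12(3) by (simp add: \<kappa>_def flip: H1_def H2_def)
          then show ?thesis using g y unfolding good_def by blast
        qed
        moreover have "\<kappa> H \<in> Y H" if "H \<in> ?H" for H
          using \<kappa>0[OF that] ab that unfolding \<kappa>_def by simp
        ultimately show ?thesis by blast
      qed
    qed (use cH in auto)
    then have "Q G u" unfolding Q_def by auto
    then show ?thesis by blast
  qed
  \<comment> \<open>Smaller sets inside \<open>insert x F\<close> that contain \<open>x\<close> may
    carry \<open>W\<close> itself, since labels are compared only through the colours of
    faces.\<close>
  define \<Lambda>' where "\<Lambda>' = (\<lambda>G. if x \<notin> G then \<Lambda> G else if G \<subseteq> insert x F then W else SOME u. Q G u)"
  have Q: "Q G (\<Lambda>' G)" if G: "G \<subseteq> insert x M" "finite G" "card G \<le> n" for G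
  proof -
    consider "x \<notin> G" | "x \<in> G" "G \<subseteq> insert x F" | "x \<in> G" "\<not> G \<subseteq> insert x F" by blast
    then show ?thesis
    proof cases
      case 1
      then have "G \<subseteq> M" using G by auto
      note * = netD[OF this G(2,3)]
      have "push (\<lambda>\<kappa>. \<kappa> H) (\<Lambda> G) = c H" if "H \<subseteq> G" "card H = n - 1" for H
        using *(4)[OF that] 1 that by (auto simp: c_def)
      then show ?thesis using * 1 unfolding Q_def \<Lambda>'_def by simp
    next
      case 2
      have "G = insert x F \<and> card F = n - 1" if "card G = n"
      proof -
        have "n \<le> card (insert x F)" using 2 that F by (metis card_mono finite_insert)
        then have "card (insert x F) = n" using F n3 xF by simp
        then show ?thesis using 2 that F xF n3 card_subset_eq[of "insert x F" G] by simp
      qed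
      then have "card G = n \<longrightarrow> {\<kappa>. good G \<kappa>} \<in> W" using Wg by blast
      moreover have "push (\<lambda>\<kappa>. \<kappa> H) W = c H" if H: "H \<subseteq> G" "card H = n - 1" for H
      proof (cases "x \<in> H")
        case True
        then show ?thesis using 2 H by (auto simp: c_def)
      next
        case False
        then have "H \<subseteq> F" using 2 H by auto
        then have "H = F" using card_subset_eq[OF F(2), of H] F(3) H(2) card_mono[OF F(2), of H] by simp
        then show ?thesis using False WF H by (simp add: c_def)
      qed
      ultimately show ?thesis using W 2 unfolding Q_def \<Lambda>'_def by simp
    next
      case 3
      then have "\<Lambda>' G = (SOME u. Q G u)" by (simp add: \<Lambda>'_def)
      then show ?thesis using someI_ex[OF exQ[OF G 3]] by simp
    qed
  qed
  have "net (insert x M) \<Lambda>'"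
    unfolding net_def
  proof (intro allI impI)
    fix G assume G: "G \<subseteq> insert x M \<and> finite G \<and> card G \<le> n"
    then have QG: "Q G (\<Lambda>' G)" using Q by blast
    have "push (\<lambda>\<kappa>. \<kappa> H) (\<Lambda>' G) = push (\<lambda>\<kappa>. \<kappa> H) (\<Lambda>' H)" if H: "H \<subseteq> G" "card H = n - 1" for H
    proof -
      have "Q H (\<Lambda>' H)" using Q[of H] G H by (meson card_mono finite_subset le_trans order_trans)
      then show ?thesis using QG H unfolding Q_def by auto
    qed
    then show "ultra (\<Lambda>' G) \<and> {\<kappa>. proper \<kappa>} \<in> \<Lambda>' G \<and> (card G = n \<longrightarrow> {\<kappa>. good G \<kappa>} \<in> \<Lambda>' G) \<and>
     (\<forall>H\<subseteq>G. card H = n - 1 \<longrightarrow> push (\<lambda>\<kappa>. \<kappa> H) (\<Lambda>' G) = push (\<lambda>\<kappa>. \<kappa> H) (\<Lambda>' H))"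
      using QG unfolding Q_def by blast
  qed
  moreover have "\<Lambda>' (insert x F) = W" by (simp add: \<Lambda>'_def)
  ultimately show ?thesis using that by (auto simp: \<Lambda>'_def)
qed

end

text \<open>The point \<open>New t i X\<close> is reserved as a witness for cylindrifying \<open>X\<close> along \<open>i\<close> at the tuple \<open>t\<close>. An
  unmet demand thus always has an unused point at its disposal, so a maximal network meets all
  demands, with no counting of points.\<close>

datatype 'x pt = Root nat | New "nat \<Rightarrow> 'x pt" nat "'x set"

section \<open>Labels of tuples, maximal networks and the representation\<close>

context reflexive_ultrafilter
begin

text \<open>The sets \<open>X\<close> with \<open>lab \<Lambda> t X\<close> are the image of the
  label under the map from colourings to atoms of \<open>t\<close>. This is the ultrafilter of
  elements that hold at \<open>t\<close> in the representation.\<close>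

definition lab :: "('p set \<Rightarrow> ('p set \<Rightarrow> 'v \<times> nat) set set) \<Rightarrow> (nat \<Rightarrow> 'p) \<Rightarrow> 'v atom set \<Rightarrow> bool" where
  "lab \<Lambda> t X \<longleftrightarrow> {\<kappa>. atom n t \<kappa> \<in> X} \<in> \<Lambda> (t ` {..<n})"

abbreviation "cyl \<equiv> cylinder n adj V"

lemma net_tuple:
  assumes "net M \<Lambda>" "t ` {..<n} \<subseteq> M"
  shows "ultra (\<Lambda> (t ` {..<n}))" "{\<kappa>. proper \<kappa>} \<in> \<Lambda> (t ` {..<n})"
    "card (t ` {..<n}) = n \<Longrightarrow> {\<kappa>. good (t ` {..<n}) \<kappa>} \<in> \<Lambda> (t ` {..<n})"
    "H \<subseteq> t ` {..<n} \<Longrightarrow> card H = n - 1 \<Longrightarrow>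
      push (\<lambda>\<kappa>. \<kappa> H) (\<Lambda> (t ` {..<n})) = push (\<lambda>\<kappa>. \<kappa> H) (\<Lambda> H)"
proof -
  have "card (t ` {..<n}) \<le> n" by (metis card_image_le card_lessThan finite_lessThan)
  then show "ultra (\<Lambda> (t ` {..<n}))" "{\<kappa>. proper \<kappa>} \<in> \<Lambda> (t ` {..<n})"
    "card (t ` {..<n}) = n \<Longrightarrow> {\<kappa>. good (t ` {..<n}) \<kappa>} \<in> \<Lambda> (t ` {..<n})"
    "H \<subseteq> t ` {..<n} \<Longrightarrow> card H = n - 1 \<Longrightarrow>
      push (\<lambda>\<kappa>. \<kappa> H) (\<Lambda> (t ` {..<n})) = push (\<lambda>\<kappa>. \<kappa> H) (\<Lambda> H)"
    using assms unfolding net_def by blast+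
qed

lemma image_off_inj:
  assumes "inj_on t {..<n}" "i < n"
  shows "t ` off n i = t ` {..<n} - {t i}"
  using assms by (auto simp: inj_on_def)

lemma good_iff:
  assumes "inj_on t {..<n}"
  shows "good (t ` {..<n}) \<kappa> \<longleftrightarrow> (\<exists>i<n. \<exists>j<n. cadj adj (\<kappa> (t ` off n i)) (\<kappa> (t ` off n j)))"
proof -
  have "good (t ` {..<n}) \<kappa> \<longleftrightarrow>
      (\<exists>i<n. \<exists>j<n. cadj adj (\<kappa> (t ` {..<n} - {t i})) (\<kappa> (t ` {..<n} - {t j})))"
    unfolding good_def by blast
  also have "\<dots> \<longleftrightarrow> (\<exists>i<n. \<exists>j<n. cadj adj (\<kappa> (t ` off n i)) (\<kappa> (t ` off n j)))"
    using image_off_inj[OF assms] by metis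
  finally show ?thesis .
qed

lemma lab_atoms:
  assumes "net M \<Lambda>" "t ` {..<n} \<subseteq> M"
  shows "lab \<Lambda> t (atoms n adj V)"
proof (cases "inj_on t {..<n}")
  case True
  then have "card (t ` {..<n}) = n" by (simp add: card_image)
  then have "{\<kappa>. proper \<kappa>} \<inter> {\<kappa>. good (t ` {..<n}) \<kappa>} \<in> \<Lambda> (t ` {..<n})"
    using net_tuple(1-3)[OF assms] by (simp only: ultra_Int)
  then show ?thesis
    unfolding lab_def
  proof (rule ultra_mono[OF net_tuple(1)[OF assms]], intro subsetI CollectI)
    fix \<kappa> assume "\<kappa> \<in> {\<kappa>. proper \<kappa>} \<inter> {\<kappa>. good (t ` {..<n}) \<kappa>}"
    then show "atom n t \<kappa> \<in> atoms n adj V"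
      using good_iff[OF True] n3 by (intro atom_in_atomsI) (auto simp: proper_def)
  qed
next
  case False
  show ?thesis
    unfolding lab_def
    by (rule ultra_mono[OF net_tuple(1,2)[OF assms]]) (use False n3 in \<open>auto simp: proper_def intro!: atom_in_atomsI\<close>)
qed

text \<open>If \<open>t'\<close> misses a point of \<open>t\<close>, it has at most
  \<open>n - 1\<close> points. With exactly \<open>n - 1\<close> its atom depends only on the colour
  of the set of all its points, where the two labels project alike; with fewer there is no coloured
  face and the atom is constant.\<close>

lemma lab_subtuple:
  fixes t t' :: "nat \<Rightarrow> 'p"
  assumes net: "net M \<Lambda>" and t: "t ` {..<n} \<subseteq> M" and t': "t' ` {..<n} \<subseteq> t ` {..<n}"
  shows "{\<kappa>. atom n t' \<kappa> \<in> X} \<in> \<Lambda> (t ` {..<n}) \<longleftrightarrow> lab \<Lambda> t' X"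
proof (cases "t' ` {..<n} = t ` {..<n}")
  case False
  define F where "F = t' ` {..<n}"
  have "card F < card (t ` {..<n})"
    unfolding F_def using False t' by (intro psubset_card_mono) auto
  also have "\<dots> \<le> n" by (metis card_image_le card_lessThan finite_lessThan)
  finally have cF: "card F \<le> n - 1" by simp
  have FM: "t' ` {..<n} \<subseteq> M" using t t' by blast
  note n1 = net_tuple[OF net t] and n2 = net_tuple[OF net FM]
  have F: "card F = n - 1 \<and> t' ` off n i = F" if "i < n" "inj_on t' (off n i)" for i
  proof -
    have "card (t' ` off n i) = n - 1" using that by (simp add: card_image)
    moreover have "t' ` off n i \<subseteq> F" "finite F" by (auto simp: F_def)
    ultimately show ?thesis using cF card_seteq[of F "t' ` off n i"] by simp
  qed
  show ?thesis
  proof (cases "card F = n - 1")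
    case True
    define Y where "Y = {\<gamma>. atom n t' (\<lambda>_. \<gamma>) \<in> X}"
    have eq: "atom n t' \<kappa> = atom n t' (\<lambda>_. \<kappa> F)" for \<kappa> :: "'p set \<Rightarrow> 'v \<times> nat"
      by (rule atom_cong) (use F in auto)
    have *: "atom n t' \<kappa> \<in> X \<longleftrightarrow> \<kappa> F \<in> Y" for \<kappa>
      by (subst eq[of \<kappa>]) (simp only: Y_def mem_Collect_eq)
    have "{\<kappa>. atom n t' \<kappa> \<in> X} = (\<lambda>\<kappa>. \<kappa> F) -` Y" by (simp only: * vimage_def)
    moreover have "Y \<in> push (\<lambda>\<kappa>. \<kappa> F) (\<Lambda> (t ` {..<n})) \<longleftrightarrow> Y \<in> push (\<lambda>\<kappa>. \<kappa> F) (\<Lambda> F)"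
      using n1(4)[of F] True t' by (simp add: F_def)
    ultimately show ?thesis by (simp add: lab_def push_def F_def)
  next
    case F': False
    define s :: "'v atom" where "s = atom n t' undefined"
    have "atom n t' \<kappa> = s" for \<kappa>
      unfolding s_def by (rule atom_cong) (use F F' in auto)
    then have "{\<kappa>. atom n t' \<kappa> \<in> X} = (if s \<in> X then UNIV else {})" by simp
    moreover have "UNIV \<in> \<Lambda> (t ` {..<n})" "UNIV \<in> \<Lambda> (t' ` {..<n})" "{} \<notin> \<Lambda> (t ` {..<n})" "{} \<notin> \<Lambda> (t' ` {..<n})"
      using n1(1) n2(1) by (auto simp: ultra_UNIV) (auto simp: ultra_def)
    ultimately show ?thesis unfolding lab_def by (simp split: if_split)
  qed
qed (simp add: lab_def)

text \<open>Tuples that agree off \<open>i\<close> share the face \<open>F\<close>, and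
  \<open>cyl_eq\<close> sees only the kernel off \<open>i\<close> and the colour of
  \<open>F\<close>. If \<open>F\<close> is coloured, both labels project to the same ultrafilter
  there, so colours realised in \<open>X\<close> can be matched. Otherwise one member of the label
  suffices.\<close>

lemma lab_cyl:
  assumes net: "net M \<Lambda>" and t: "t ` {..<n} \<subseteq> M" and t': "t' ` {..<n} \<subseteq> M"
    and eq: "\<And>a. a \<in> off n i \<Longrightarrow> t a = t' a" and i: "i < n" and X: "lab \<Lambda> t X"
  shows "lab \<Lambda> t' (cyl i X)"
proof -
  note n1 = net_tuple[OF net t] and n2 = net_tuple[OF net t']
  define F where "F = t ` off n i"
  have "F = t' ` off n i" unfolding F_def using eq by (intro image_cong) auto
  then have Ft: "F \<subseteq> t ` {..<n}" "F \<subseteq> t' ` {..<n}"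
    unfolding F_def by auto
  define B where "B = {\<kappa>. atom n t \<kappa> \<in> X}"
  have B: "B \<in> \<Lambda> (t ` {..<n})" using X by (simp add: lab_def B_def)
  have A: "{\<kappa>. atom n t' \<kappa> \<in> atoms n adj V} \<in> \<Lambda> (t' ` {..<n})"
    using lab_atoms[OF net t'] by (simp add: lab_def)
  show ?thesis
  proof (cases "inj_on t (off n i)")
    case False
    obtain \<kappa> where \<kappa>: "\<kappa> \<in> B" using ultra_nonempty[OF n1(1) B] by blast
    have "cyl_eq n i (atom n t' \<kappa>') (atom n t \<kappa>)" for \<kappa>'
      using cyl_eq_atom[of n i t t' \<kappa> \<kappa>'] eq i False by (simp add: cyl_eq_sym)
    then show ?thesis
      unfolding lab_def
      by (intro ultra_mono[OF n2(1) A]) (use \<kappa> in \<open>auto simp: cylinder_def B_def\<close>)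
  next
    case True
    then have cF: "card F = n - 1" using i by (simp add: F_def card_image)
    define Y where "Y = (\<lambda>\<kappa>. \<kappa> F) ` B"
    have "(\<lambda>\<kappa>. \<kappa> F) -` Y \<in> \<Lambda> (t ` {..<n})"
      by (rule ultra_mono[OF n1(1) B]) (auto simp: Y_def)
    then have "Y \<in> push (\<lambda>\<kappa>. \<kappa> F) (\<Lambda> (t ` {..<n}))" by (simp add: push_def)
    then have "Y \<in> push (\<lambda>\<kappa>. \<kappa> F) (\<Lambda> (t' ` {..<n}))"
      using n1(4)[OF Ft(1) cF] n2(4)[OF Ft(2) cF] by simp
    then have "(\<lambda>\<kappa>. \<kappa> F) -` Y \<in> \<Lambda> (t' ` {..<n})" by (simp add: push_def)
    from ultra_Int[OF n2(1) this A] show ?thesis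
      unfolding lab_def
    proof (rule ultra_mono[OF n2(1)], intro subsetI CollectI)
      fix \<kappa>' assume "\<kappa>' \<in> (\<lambda>\<kappa>. \<kappa> F) -` Y \<inter> {\<kappa>. atom n t' \<kappa> \<in> atoms n adj V}"
      then obtain \<kappa> where "\<kappa> \<in> B" "\<kappa>' F = \<kappa> F" "atom n t' \<kappa>' \<in> atoms n adj V" by (auto simp: Y_def)
      moreover have "cyl_eq n i (atom n t' \<kappa>') (atom n t \<kappa>)"
        using cyl_eq_atom[of n i t t' \<kappa> \<kappa>'] eq i \<open>\<kappa>' F = \<kappa> F\<close> by (simp add: cyl_eq_sym F_def)
      ultimately show "atom n t' \<kappa>' \<in> cyl i X" by (auto simp: cylinder_def B_def)
    qed
  qed
qed

text \<open>A reserved point may enter only with the tuple it completes and with its demand met.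
  Extensions leave the labels of old sets unchanged, so they cannot break earlier promises.\<close>

definition sys :: "'v atom pt set \<Rightarrow> ('v atom pt set \<Rightarrow> ('v atom pt set \<Rightarrow> 'v \<times> nat) set set) \<Rightarrow> bool" where
  "sys M \<Lambda> \<longleftrightarrow> net M \<Lambda> \<and> (\<forall>t i X. New t i X \<in> M \<longrightarrow> i < n \<longrightarrow>
     (t(i := New t i X)) ` {..<n} \<subseteq> M \<and> lab \<Lambda> (t(i := New t i X)) X)"

text \<open>Every condition concerns finitely many points, and a finite subset of the union lies in
  one member of the chain.\<close>

lemma sys_chain:
  assumes R: "\<And>M \<Lambda> M' \<Lambda>'. (M, \<Lambda>) \<in> \<C> \<Longrightarrow> (M', \<Lambda>') \<in> \<C> \<Longrightarrow>
      M \<subseteq> M' \<and> (\<forall>G\<subseteq>M. finite G \<longrightarrow> \<Lambda>' G = \<Lambda> G) \<or> M' \<subseteq> M \<and> (\<forall>G\<subseteq>M'. finite G \<longrightarrow> \<Lambda>' G = \<Lambda> G)"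
    and sys: "\<And>M \<Lambda>. (M, \<Lambda>) \<in> \<C> \<Longrightarrow> sys M \<Lambda>" and ne: "\<C> \<noteq> {}"
  obtains \<Lambda>u where "sys (\<Union>(fst ` \<C>)) \<Lambda>u"
    "\<And>M \<Lambda> G. (M, \<Lambda>) \<in> \<C> \<Longrightarrow> G \<subseteq> M \<Longrightarrow> finite G \<Longrightarrow> \<Lambda>u G = \<Lambda> G"
proof -
  define Mu where "Mu = \<Union>(fst ` \<C>)"
  have fin: "\<exists>M \<Lambda>. (M, \<Lambda>) \<in> \<C> \<and> G \<subseteq> M" if "finite G" "G \<subseteq> Mu" for G
    using that
  proof (induction G rule: finite_induct)
    case empty
    then show ?case using ne by force
  next
    case (insert x G)
    then obtain M \<Lambda> M' \<Lambda>' where M: "(M, \<Lambda>) \<in> \<C>" "G \<subseteq> M" "(M', \<Lambda>') \<in> \<C>" "x \<in> M'"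
      by (auto simp: Mu_def)
    from R[OF M(1,3)] have "insert x G \<subseteq> M \<or> insert x G \<subseteq> M'" using M by blast
    then show ?case using M by blast
  qed
  define \<Lambda>u where "\<Lambda>u = (\<lambda>G. (SOME u. \<exists>M \<Lambda>. (M, \<Lambda>) \<in> \<C> \<and> G \<subseteq> M \<and> u = \<Lambda> G))"
  have u: "\<Lambda>u G = \<Lambda> G" if M: "(M, \<Lambda>) \<in> \<C>" "G \<subseteq> M" "finite G" for M \<Lambda> G
  proof -
    have "\<exists>M' \<Lambda>'. (M', \<Lambda>') \<in> \<C> \<and> G \<subseteq> M' \<and> \<Lambda>u G = \<Lambda>' G"
      unfolding \<Lambda>u_def by (rule someI_ex) (use M in blast)
    then obtain M' \<Lambda>' where M': "(M', \<Lambda>') \<in> \<C>" "G \<subseteq> M'" "\<Lambda>u G = \<Lambda>' G" by blast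
    then show ?thesis using R[OF M(1) M'(1)] M by auto
  qed
  have "net Mu \<Lambda>u"
    unfolding net_def
  proof (intro allI impI)
    fix G assume G: "G \<subseteq> Mu \<and> finite G \<and> card G \<le> n"
    then obtain M \<Lambda> where M: "(M, \<Lambda>) \<in> \<C>" "G \<subseteq> M" using fin by blast
    have e: "\<Lambda>u H = \<Lambda> H" if "H \<subseteq> G" for H
      using u[OF M(1), of H] that M(2) G finite_subset[of H G] by blast
    have "net M \<Lambda>" using sys[OF M(1)] by (simp add: sys_def)
    then have *: "ultra (\<Lambda> G)" "{\<kappa>. proper \<kappa>} \<in> \<Lambda> G" "card G = n \<longrightarrow> {\<kappa>. good G \<kappa>} \<in> \<Lambda> G"
      "\<And>H. H \<subseteq> G \<Longrightarrow> card H = n - 1 \<Longrightarrow> push (\<lambda>\<kappa>. \<kappa> H) (\<Lambda> G) = push (\<lambda>\<kappa>. \<kappa> H) (\<Lambda> H)"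
      using G M(2) unfolding net_def by blast+
    have "push (\<lambda>\<kappa>. \<kappa> H) (\<Lambda>u G) = push (\<lambda>\<kappa>. \<kappa> H) (\<Lambda>u H)" if "H \<subseteq> G" "card H = n - 1" for H
      using *(4)[OF that] e[OF that(1)] e[of G] by simp
    then show "ultra (\<Lambda>u G) \<and> {\<kappa>. proper \<kappa>} \<in> \<Lambda>u G \<and> (card G = n \<longrightarrow> {\<kappa>. good G \<kappa>} \<in> \<Lambda>u G) \<and>
     (\<forall>H\<subseteq>G. card H = n - 1 \<longrightarrow> push (\<lambda>\<kappa>. \<kappa> H) (\<Lambda>u G) = push (\<lambda>\<kappa>. \<kappa> H) (\<Lambda>u H))"
      using *(1-3) e[of G] by simp
  qed
  moreover have "(t(i := New t i X)) ` {..<n} \<subseteq> Mu \<and> lab \<Lambda>u (t(i := New t i X)) X"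
    if N: "New t i X \<in> Mu" "i < n" for t i X
  proof -
    obtain M \<Lambda> where M: "(M, \<Lambda>) \<in> \<C>" "New t i X \<in> M" using N by (auto simp: Mu_def)
    then have *: "(t(i := New t i X)) ` {..<n} \<subseteq> M" "lab \<Lambda> (t(i := New t i X)) X"
      using sys[OF M(1)] N unfolding sys_def by blast+
    moreover have "M \<subseteq> Mu" using M(1) by (force simp: Mu_def)
    moreover have "lab \<Lambda>u (t(i := New t i X)) X"
      using *(2) u[OF M(1) *(1)] unfolding lab_def by (simp only: finite_imageI finite_lessThan)
    ultimately show ?thesis by blast
  qed
  ultimately have "sys Mu \<Lambda>u" unfolding sys_def by blast
  then show ?thesis using that u unfolding Mu_def by blast
qed

text \<open>Turns extension of networks into inclusion, the form needed for Zorn's lemma. Labels of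
  infinite sets carry no information, so they are left out and cannot obstruct unions.\<close>

definition graph_of :: "'p set \<Rightarrow> ('p set \<Rightarrow> 'w) \<Rightarrow> ('p set \<times> 'w) set" where
  "graph_of M \<Lambda> = {(G, \<Lambda> G) | G. G \<subseteq> M \<and> finite G}"

lemma graph_of_subset_iff:
  "graph_of M \<Lambda> \<subseteq> graph_of M' \<Lambda>' \<longleftrightarrow> M \<subseteq> M' \<and> (\<forall>G\<subseteq>M. finite G \<longrightarrow> \<Lambda>' G = \<Lambda> G)"
proof
  assume *: "graph_of M \<Lambda> \<subseteq> graph_of M' \<Lambda>'"
  have G: "G \<subseteq> M' \<and> \<Lambda>' G = \<Lambda> G" if "G \<subseteq> M" "finite G" for G
  proof -
    have "(G, \<Lambda> G) \<in> graph_of M' \<Lambda>'" using * that unfolding graph_of_def by blast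
    then show ?thesis by (simp add: graph_of_def)
  qed
  have "x \<in> M'" if "x \<in> M" for x using G[of "{x}"] that by simp
  then show "M \<subseteq> M' \<and> (\<forall>G\<subseteq>M. finite G \<longrightarrow> \<Lambda>' G = \<Lambda> G)" using G by blast
next
  assume "M \<subseteq> M' \<and> (\<forall>G\<subseteq>M. finite G \<longrightarrow> \<Lambda>' G = \<Lambda> G)"
  then show "graph_of M \<Lambda> \<subseteq> graph_of M' \<Lambda>'" by (auto simp: graph_of_def)
qed

lemma sys_maximal:
  assumes sys0: "sys M0 \<Lambda>0"
  obtains M \<Lambda> where "sys M \<Lambda>" "M0 \<subseteq> M" "\<And>G. G \<subseteq> M0 \<Longrightarrow> finite G \<Longrightarrow> \<Lambda> G = \<Lambda>0 G"
    "\<And>M' \<Lambda>'. sys M' \<Lambda>' \<Longrightarrow> M \<subseteq> M' \<Longrightarrow> (\<And>G. G \<subseteq> M \<Longrightarrow> finite G \<Longrightarrow> \<Lambda>' G = \<Lambda> G) \<Longrightarrow> M' = M"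
proof -
  define Z where "Z = {graph_of M \<Lambda> | M \<Lambda>. sys M \<Lambda> \<and> graph_of M0 \<Lambda>0 \<subseteq> graph_of M \<Lambda>}"
  have "graph_of M0 \<Lambda>0 \<in> Z" using sys0 unfolding Z_def by blast
  then have "Z \<noteq> {}" by blast
  moreover have "\<Union>\<C> \<in> Z" if C: "\<C> \<noteq> {}" "subset.chain Z \<C>" for \<C>
  proof -
    have CZ: "\<C> \<subseteq> Z" using C by (auto simp: subset.chain_def)
    define \<D> where "\<D> = {(M, \<Lambda>). sys M \<Lambda> \<and> graph_of M \<Lambda> \<in> \<C>}"
    have CD: "\<exists>M \<Lambda>. (M, \<Lambda>) \<in> \<D> \<and> R = graph_of M \<Lambda> \<and> graph_of M0 \<Lambda>0 \<subseteq> R" if "R \<in> \<C>" for R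
      using that CZ unfolding Z_def \<D>_def by blast
    obtain \<Lambda>u where u: "sys (\<Union>(fst ` \<D>)) \<Lambda>u"
      "\<And>M \<Lambda> G. (M, \<Lambda>) \<in> \<D> \<Longrightarrow> G \<subseteq> M \<Longrightarrow> finite G \<Longrightarrow> \<Lambda>u G = \<Lambda> G"
    proof (rule sys_chain[of \<D>])
      fix M \<Lambda> M' \<Lambda>' assume "(M, \<Lambda>) \<in> \<D>" "(M', \<Lambda>') \<in> \<D>"
      then have "graph_of M \<Lambda> \<subseteq> graph_of M' \<Lambda>' \<or> graph_of M' \<Lambda>' \<subseteq> graph_of M \<Lambda>"
        using C(2) by (auto simp: \<D>_def subset.chain_def)
      then show "M \<subseteq> M' \<and> (\<forall>G\<subseteq>M. finite G \<longrightarrow> \<Lambda>' G = \<Lambda> G) \<or> M' \<subseteq> M \<and> (\<forall>G\<subseteq>M'. finite G \<longrightarrow> \<Lambda>' G = \<Lambda> G)"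
        unfolding graph_of_subset_iff by metis
    next
      show "\<D> \<noteq> {}" using C(1) CD by blast
    qed (auto simp: \<D>_def)
    have sub: "graph_of M \<Lambda> \<subseteq> graph_of (\<Union>(fst ` \<D>)) \<Lambda>u" if "(M, \<Lambda>) \<in> \<D>" for M \<Lambda>
      unfolding graph_of_subset_iff using u(2)[OF that] that by force
    have "\<Union>\<C> = graph_of (\<Union>(fst ` \<D>)) \<Lambda>u"
    proof (intro equalityI subsetI)
      fix p assume "p \<in> \<Union>\<C>"
      then show "p \<in> graph_of (\<Union>(fst ` \<D>)) \<Lambda>u" using CD sub by blast
    next
      fix p assume "p \<in> graph_of (\<Union>(fst ` \<D>)) \<Lambda>u"
      then obtain G where G: "p = (G, \<Lambda>u G)" "G \<subseteq> \<Union>(fst ` \<D>)" "finite G" by (auto simp: graph_of_def)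
      have "\<exists>M\<in>fst ` \<D>. G \<subseteq> M"
      proof (rule finite_subset_Union_chain[OF G(3,2)])
        show "fst ` \<D> \<noteq> {}" using C(1) CD by blast
        have "M \<subseteq> M' \<or> M' \<subseteq> M" if "(M, \<Lambda>) \<in> \<D>" "(M', \<Lambda>') \<in> \<D>" for M \<Lambda> M' \<Lambda>'
        proof -
          have "graph_of M \<Lambda> \<subseteq> graph_of M' \<Lambda>' \<or> graph_of M' \<Lambda>' \<subseteq> graph_of M \<Lambda>"
            using C(2) that by (auto simp: \<D>_def subset.chain_def)
          then show ?thesis unfolding graph_of_subset_iff by blast
        qed
        then show "subset.chain UNIV (fst ` \<D>)" unfolding subset_chain_def by fastforce
      qed auto
      then obtain M \<Lambda> where M: "(M, \<Lambda>) \<in> \<D>" "G \<subseteq> M" by auto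
      then have "p \<in> graph_of M \<Lambda>" using u(2)[OF M G(3)] G unfolding graph_of_def by blast
      then show "p \<in> \<Union>\<C>" using M(1) by (auto simp: \<D>_def)
    qed
    moreover have "graph_of M0 \<Lambda>0 \<subseteq> \<Union>\<C>" using C(1) CD by blast
    ultimately show ?thesis using u(1) unfolding Z_def by blast
  qed
  ultimately obtain R where R: "R \<in> Z" "\<And>X. X \<in> Z \<Longrightarrow> R \<subseteq> X \<Longrightarrow> X = R"
    using subset_Zorn_nonempty[of Z] by blast
  then obtain M \<Lambda> where M: "R = graph_of M \<Lambda>" "sys M \<Lambda>" "graph_of M0 \<Lambda>0 \<subseteq> graph_of M \<Lambda>"
    unfolding Z_def by blast
  show ?thesis
  proof (rule that[OF M(2)])
    show "M0 \<subseteq> M" "\<And>G. G \<subseteq> M0 \<Longrightarrow> finite G \<Longrightarrow> \<Lambda> G = \<Lambda>0 G"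
      using M(3) unfolding graph_of_subset_iff by blast+
    fix M' \<Lambda>' assume *: "sys M' \<Lambda>'" "M \<subseteq> M'" "\<And>G. G \<subseteq> M \<Longrightarrow> finite G \<Longrightarrow> \<Lambda>' G = \<Lambda> G"
    then have le: "graph_of M \<Lambda> \<subseteq> graph_of M' \<Lambda>'" unfolding graph_of_subset_iff by blast
    moreover have "graph_of M' \<Lambda>' \<in> Z" using *(1) M(3) le unfolding Z_def by blast
    ultimately have "graph_of M' \<Lambda>' = graph_of M \<Lambda>" using R(2) M(1) by blast
    then have "M' \<subseteq> M" using graph_of_subset_iff[of M' \<Lambda>' M \<Lambda>] by simp
    then show "M' = M" using *(2) by blast
  qed
qed

lemma keq_atoms:
  assumes "s \<in> atoms n adj V"
  obtains t :: "nat \<Rightarrow> nat" where "\<And>i j. (i, j) \<in> keq s \<longleftrightarrow> i < n \<and> j < n \<and> t i = t j"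
proof -
  obtain t :: "nat \<Rightarrow> nat" and \<kappa> where "s = atom n t \<kappa>" using assms unfolding atoms_def by blast
  then show ?thesis using that[of t] by simp
qed

text \<open>If the entry \<open>i\<close> of \<open>s\<close> repeats the entry \<open>j\<close>,
  every coloured face of the new tuple is the set of all its points. That set is the face off
  \<open>i\<close>, on which \<open>cyl_eq\<close> fixes the colour, so the old colouring realises
  \<open>s\<close> without a new point.\<close>

lemma atom_update_eq:
  assumes s: "s \<in> atoms n adj V" "cyl_eq n i (atom n t \<kappa>) s" and ij: "i < n" "j < n" "i \<noteq> j" "(i, j) \<in> keq s"
  shows "atom n (t(i := t j)) \<kappa> = s"
proof -
  let ?t = "t(i := t j)"
  obtain t0 :: "nat \<Rightarrow> nat" where t0: "\<And>a b. (a, b) \<in> keq s \<longleftrightarrow> a < n \<and> b < n \<and> t0 a = t0 b"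
    using keq_atoms[OF s(1)] by metis
  have off: "(a, b) \<in> keq s \<longleftrightarrow> t a = t b" if "a \<in> off n i" "b \<in> off n i" for a b
    using s(2) that by (auto simp: cyl_eq_def)
  have t0ij: "t0 i = t0 j" using t0 ij by simp
  have ker: "(a, b) \<in> keq s \<longleftrightarrow> ?t a = ?t b" if "a < n" "b < n" for a b
  proof -
    define p where "p = (\<lambda>a. if a = i then j else a)"
    have "p a \<in> off n i" "p b \<in> off n i" using that ij by (auto simp: p_def)
    from off[OF this] have "(p a, p b) \<in> keq s \<longleftrightarrow> t (p a) = t (p b)" .
    moreover have "(p a, p b) \<in> keq s \<longleftrightarrow> (a, b) \<in> keq s"
      using t0 that ij t0ij by (auto simp: p_def)
    moreover have "t (p a) = ?t a" "t (p b) = ?t b" by (simp_all add: p_def)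
    ultimately show ?thesis by simp
  qed
  have "\<exists>\<kappa>'. s = atom n ?t \<kappa>' \<and> range \<kappa>' \<subseteq> V \<times> {..<n}"
    by (rule atom_of_kernel[OF s(1) ker V_nonempty]) (use n3 in auto)
  then obtain \<kappa>' where \<kappa>': "s = atom n ?t \<kappa>'" by blast
  have im: "?t ` off n i = ?t ` {..<n}" "?t ` off n j = ?t ` {..<n}"
    using ij by (auto simp: image_iff)
  show ?thesis
    unfolding \<kappa>'
  proof (rule atom_cong)
    fix l assume l: "l < n" "inj_on ?t (off n l)"
    have "l = i \<or> l = j"
    proof (rule ccontr)
      assume "\<not> ?thesis"
      then have "i \<in> off n l" "j \<in> off n l" using ij by auto
      then show False using l(2) ij(3) by (auto simp: inj_on_def)
    qed
    then have iml: "?t ` off n l = ?t ` off n i" using im by auto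
    have "card (?t ` off n i) = card (off n l)" using l(2) by (metis iml card_image)
    then have inj: "inj_on ?t (off n i)" using l(1) ij(1) by (intro eq_card_imp_inj_on) auto
    have "cyl_eq n i (atom n t \<kappa>) (atom n ?t \<kappa>')" using s(2) \<kappa>' by simp
    moreover have "inj_on t (off n i)" using inj by (rule inj_on_cong[THEN iffD1, rotated]) auto
    moreover have "t ` off n i = ?t ` off n i" by (intro image_cong) auto
    ultimately have "\<kappa> (?t ` off n i) = \<kappa>' (?t ` off n i)"
      using cyl_eq_atom[of n i t ?t \<kappa> \<kappa>'] ij by simp
    then show "\<kappa> (?t ` off n l) = \<kappa>' (?t ` off n l)" by (simp only: iml)
  qed simp
qed

text \<open>The new label must concentrate on \<open>X\<close> and keep its projection to
  \<open>F\<close>. For the finite intersection property, take a colouring in the old label that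
  lies in the cylinder and meets the constraint on \<open>F\<close>, pass to an equivalent atom of
  \<open>X\<close>, and realise it on the tuple with \<open>x\<close>. The equivalence preserves the
  colour of \<open>F\<close>.\<close>

lemma witness_extension:
  fixes t :: "nat \<Rightarrow> 'p"
  assumes net: "net M \<Lambda>" and t: "t ` {..<n} \<subseteq> M" and i: "i < n" and x: "x \<notin> M"
    and X: "X \<subseteq> atoms n adj V" "\<And>s j. s \<in> X \<Longrightarrow> j \<in> off n i \<Longrightarrow> (i, j) \<notin> keq s"
    and lab: "lab \<Lambda> t (cyl i X)"
  obtains \<Lambda>' where "net (insert x M) \<Lambda>'" "\<And>G. x \<notin> G \<Longrightarrow> \<Lambda>' G = \<Lambda> G" "lab \<Lambda>' (t(i := x)) X"
proof -
  define t' where "t' = t(i := x)"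
  define F where "F = t ` off n i"
  have FM: "F \<subseteq> M" "finite F" and xF: "x \<notin> F" using t x by (auto simp: F_def)
  have "card F \<le> card (off n i)" unfolding F_def by (intro card_image_le) simp
  then have cF: "card F \<le> n - 1" using i by simp
  have t'eq: "t' a = t a" if "a \<in> off n i" for a using that by (simp add: t'_def)
  have t'n: "t' ` {..<n} = insert x F"
  proof -
    have "{..<n} = insert i (off n i)" using i by auto
    moreover have "t' ` off n i = F" unfolding F_def using t'eq by (intro image_cong) auto
    ultimately show ?thesis by (metis image_insert fun_upd_same t'_def)
  qed
  note nt = net_tuple[OF net t]
  have inj_iff: "inj_on t (off n i)" if "card F = n - 1"
    using that i unfolding F_def by (intro eq_card_imp_inj_on) auto
  \<comment> \<open>With fewer than \<open>n - 1\<close> points \<open>F\<close> is not a coloured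
    face, so no projection is prescribed.\<close>
  let ?H = "if card F = n - 1 then {F} else {}"
  have uF: "ultra (push (\<lambda>\<kappa>. \<kappa> F) (\<Lambda> F))" if "card F = n - 1"
    using net FM cF unfolding net_def by (intro ultra_push) auto
  obtain W where W: "ultra W" "{\<kappa>. proper \<kappa>} \<in> W" "{\<kappa>. atom n t' \<kappa> \<in> X} \<in> W"
    "\<And>H. H \<in> ?H \<Longrightarrow> push (\<lambda>\<kappa>. \<kappa> H) W = push (\<lambda>\<kappa>. \<kappa> F) (\<Lambda> F)"
  proof (rule amalgam[of ?H "\<lambda>_. push (\<lambda>\<kappa>. \<kappa> F) (\<Lambda> F)" "\<lambda>\<kappa>. atom n t' \<kappa> \<in> X"])
    fix H assume "H \<in> ?H"
    then show "ultra (push (\<lambda>\<kappa>. \<kappa> F) (\<Lambda> F))" using uF by (auto split: if_splits)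
  next
    fix Y assume Y: "\<And>H. H \<in> ?H \<Longrightarrow> Y H \<in> push (\<lambda>\<kappa>. \<kappa> F) (\<Lambda> F)"
    define B where "B = {\<kappa>. card F = n - 1 \<longrightarrow> \<kappa> F \<in> Y F}"
    have "B \<in> \<Lambda> (t ` {..<n})"
    proof (cases "card F = n - 1")
      case True
      then have "Y F \<in> push (\<lambda>\<kappa>. \<kappa> F) (\<Lambda> F)" using Y by simp
      then have "Y F \<in> push (\<lambda>\<kappa>. \<kappa> F) (\<Lambda> (t ` {..<n}))"
        using nt(4)[of F] True by (auto simp: F_def)
      then show ?thesis using True by (simp add: push_def B_def vimage_def)
    qed (simp add: B_def ultra_UNIV[OF nt(1)])
    then have "B \<inter> {\<kappa>. atom n t \<kappa> \<in> cyl i X} \<in> \<Lambda> (t ` {..<n})"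
      using lab nt(1) unfolding lab_def by (intro ultra_Int)
    from ultra_nonempty[OF nt(1) this] obtain \<kappa> where \<kappa>: "\<kappa> \<in> B" "atom n t \<kappa> \<in> cyl i X" by blast
    then obtain s where s: "s \<in> X" "cyl_eq n i (atom n t \<kappa>) s" by (auto simp: cylinder_def)
    have sA: "s \<in> atoms n adj V" using s X by blast
    obtain t0 :: "nat \<Rightarrow> nat" where t0: "\<And>a b. (a, b) \<in> keq s \<longleftrightarrow> a < n \<and> b < n \<and> t0 a = t0 b"
      using keq_atoms[OF sA] by metis
    have ker: "(a, b) \<in> keq s \<longleftrightarrow> t' a = t' b" if ab: "a < n" "b < n" for a b
    proof -
      consider "a = i" "b = i" | "a = i" "b \<in> off n i" | "a \<in> off n i" "b = i" | "a \<in> off n i" "b \<in> off n i"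
        using ab by blast
      then show ?thesis
      proof cases
        case 2
        then have "(i, b) \<notin> keq s" using X(2)[OF s(1)] by blast
        moreover have "t' b \<noteq> x" using 2 xF t'eq by (auto simp: F_def)
        ultimately show ?thesis using 2 by (auto simp: t'_def)
      next
        case 3
        then have "(i, a) \<notin> keq s" using X(2)[OF s(1)] by blast
        then have "(a, i) \<notin> keq s" using t0 by auto
        moreover have "t' a \<noteq> x" using 3 xF t'eq by (auto simp: F_def)
        ultimately show ?thesis using 3 by (auto simp: t'_def)
      next
        case 4
        then have "(a, b) \<in> keq s \<longleftrightarrow> t a = t b" using s(2) ab by (auto simp: cyl_eq_def)
        then show ?thesis using 4 t'eq by simp
      qed (use t0 ab in simp)
    qed
    obtain \<kappa>' where \<kappa>': "s = atom n t' \<kappa>'" "proper \<kappa>'"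
      using atom_of_kernel[OF sA ker V_nonempty] n3 unfolding proper_def by auto
    have "\<kappa>' F \<in> Y F" if c: "card F = n - 1"
    proof -
      have "\<kappa> F = \<kappa>' F"
        using cyl_eq_atom[of n i t t' \<kappa> \<kappa>'] s(2) \<kappa>'(1) inj_iff[OF c] t'eq i by (simp add: F_def)
      then show ?thesis using \<kappa>(1) c by (simp add: B_def)
    qed
    then show "\<exists>\<kappa>. proper \<kappa> \<and> atom n t' \<kappa> \<in> X \<and> (\<forall>H\<in>?H. \<kappa> H \<in> Y H)"
      using \<kappa>' s(1) by (intro exI[of _ \<kappa>']) (simp split: if_split)
  qed blast
  have "{\<kappa>. good (insert x F) \<kappa>} \<in> W" if c: "card F = n - 1"
  proof -
    have "card (t' ` {..<n}) = n" using t'n xF FM c n3 by simp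
    then have inj: "inj_on t' {..<n}" by (intro eq_card_imp_inj_on) auto
    show ?thesis
    proof (rule ultra_mono[OF W(1,3)], intro subsetI CollectI)
      fix \<kappa> assume "\<kappa> \<in> {\<kappa>. atom n t' \<kappa> \<in> X}"
      then have "atom n t' \<kappa> \<in> atoms n adj V" using X by blast
      from atom_in_atomsE[OF this inj] show "good (insert x F) \<kappa>"
        using good_iff[OF inj, of \<kappa>] t'n by simp
    qed
  qed
  moreover have "push (\<lambda>\<kappa>. \<kappa> F) W = push (\<lambda>\<kappa>. \<kappa> F) (\<Lambda> F)" if "card F = n - 1"
    using W(4)[of F] that by simp
  ultimately obtain \<Lambda>' where \<Lambda>': "net (insert x M) \<Lambda>'" "\<And>G. x \<notin> G \<Longrightarrow> \<Lambda>' G = \<Lambda> G" "\<Lambda>' (insert x F) = W"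
    using net_extend[OF net x FM cF W(1,2)] by blast
  moreover have "lab \<Lambda>' (t(i := x)) X"
    unfolding lab_def t'_def[symmetric] t'n \<Lambda>'(3) by (rule W(3))
  ultimately show ?thesis using that by blast
qed

lemma lab_mono:
  assumes "net M \<Lambda>" "t ` {..<n} \<subseteq> M" "lab \<Lambda> t X" "X \<subseteq> Y"
  shows "lab \<Lambda> t Y"
  using assms(3) unfolding lab_def
  by (rule ultra_mono[OF net_tuple(1)[OF assms(1,2)]]) (use assms(4) in auto)

text \<open>An ultrafilter picks one part of a finite union, so the demand splits according to
  whether the entry \<open>i\<close> of the witness repeats an entry \<open>j\<close> or is new. In
  the first case \<open>t j\<close> is a witness. In the second \<open>New t i (Y i)\<close> belongs
  to \<open>M\<close> already, since otherwise the network could be enlarged by it.\<close>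

lemma sys_saturated:
  assumes sys: "sys M \<Lambda>"
    and max: "\<And>M' \<Lambda>'. sys M' \<Lambda>' \<Longrightarrow> M \<subseteq> M' \<Longrightarrow> (\<And>G. G \<subseteq> M \<Longrightarrow> finite G \<Longrightarrow> \<Lambda>' G = \<Lambda> G) \<Longrightarrow> M' = M"
    and t: "t ` {..<n} \<subseteq> M" and i: "i < n" and X: "X \<subseteq> atoms n adj V" and lab: "lab \<Lambda> t (cyl i X)"
  shows "\<exists>x\<in>M. lab \<Lambda> (t(i := x)) X"
proof -
  have net: "net M \<Lambda>" using sys by (simp add: sys_def)
  note nt = net_tuple[OF net t]
  have upd: "(t(i := x)) ` {..<n} \<subseteq> M" if "x \<in> M" for x using t that by auto
  define Y where "Y = (\<lambda>j. if j = i then {s \<in> X. \<forall>j\<in>off n i. (i, j) \<notin> keq s} else {s \<in> X. (i, j) \<in> keq s})"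
  have YX: "Y j \<subseteq> X" for j by (auto simp: Y_def)
  have "X \<subseteq> (\<Union>j\<in>{..<n}. Y j)"
  proof
    fix s assume s: "s \<in> X"
    show "s \<in> (\<Union>j\<in>{..<n}. Y j)"
    proof (cases "\<forall>j\<in>off n i. (i, j) \<notin> keq s")
      case True
      then have "s \<in> Y i" using s by (simp add: Y_def)
      then show ?thesis using i by blast
    next
      case False
      then obtain j where j: "j \<in> off n i" "(i, j) \<in> keq s" by blast
      then have "s \<in> Y j" using s by (simp add: Y_def)
      then show ?thesis using j by blast
    qed
  qed
  then have "{\<kappa>. atom n t \<kappa> \<in> cyl i X} \<subseteq> (\<Union>j\<in>{..<n}. {\<kappa>. atom n t \<kappa> \<in> cyl i (Y j)})"
    unfolding cylinder_def by blast
  then have "(\<Union>j\<in>{..<n}. {\<kappa>. atom n t \<kappa> \<in> cyl i (Y j)}) \<in> \<Lambda> (t ` {..<n})"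
    using lab ultra_mono[OF nt(1)] unfolding lab_def by blast
  from ultra_finite_UN[OF nt(1) _ this] obtain j where j: "j < n" "lab \<Lambda> t (cyl i (Y j))"
    unfolding lab_def by auto
  show ?thesis
  proof (cases "j = i")
    case False
    have "{\<kappa>. atom n t \<kappa> \<in> cyl i (Y j)} \<subseteq> {\<kappa>. atom n (t(i := t j)) \<kappa> \<in> X}"
    proof (intro subsetI CollectI)
      fix \<kappa> assume "\<kappa> \<in> {\<kappa>. atom n t \<kappa> \<in> cyl i (Y j)}"
      then obtain s where s: "s \<in> Y j" "cyl_eq n i (atom n t \<kappa>) s" by (auto simp: cylinder_def)
      then have "s \<in> X" "(i, j) \<in> keq s" using False by (auto simp: Y_def)
      then show "atom n (t(i := t j)) \<kappa> \<in> X"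
        using atom_update_eq[of s i t \<kappa> j] s(2) i j(1) False X by auto
    qed
    then have "{\<kappa>. atom n (t(i := t j)) \<kappa> \<in> X} \<in> \<Lambda> (t ` {..<n})"
      using j(2) ultra_mono[OF nt(1)] unfolding lab_def by blast
    moreover have "(t(i := t j)) ` {..<n} \<subseteq> t ` {..<n}" using j by auto
    ultimately have "lab \<Lambda> (t(i := t j)) X" using lab_subtuple[OF net t] by blast
    then show ?thesis using t j by blast
  next
    case True
    define x where "x = New t i (Y i)"
    have "x \<in> M"
    proof (rule ccontr)
      assume x: "x \<notin> M"
      obtain \<Lambda>' where \<Lambda>': "net (insert x M) \<Lambda>'" "\<And>G. x \<notin> G \<Longrightarrow> \<Lambda>' G = \<Lambda> G" "lab \<Lambda>' (t(i := x)) (Y i)"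
      proof (rule witness_extension[OF net t i x])
        show "Y i \<subseteq> atoms n adj V" using YX X by blast
        show "(i, j) \<notin> keq s" if "s \<in> Y i" "j \<in> off n i" for s j using that by (simp add: Y_def)
        show "lab \<Lambda> t (cyl i (Y i))" using j True by simp
      qed blast
      have "sys (insert x M) \<Lambda>'"
        unfolding sys_def
      proof (intro conjI allI impI \<Lambda>'(1))
        fix t2 i2 X2 assume N: "New t2 i2 X2 \<in> insert x M" "i2 < n"
        let ?t2 = "t2(i2 := New t2 i2 X2)"
        have "?t2 ` {..<n} \<subseteq> insert x M \<and> lab \<Lambda>' ?t2 X2"
        proof (cases "New t2 i2 X2 = x")
          case True
          then have "t2 = t" "i2 = i" "X2 = Y i" by (auto simp: x_def)
          then show ?thesis using True \<Lambda>'(3) t by auto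
        next
          case False
          then have "New t2 i2 X2 \<in> M" using N by blast
          then have *: "?t2 ` {..<n} \<subseteq> M" "lab \<Lambda> ?t2 X2"
            using sys N(2) unfolding sys_def by blast+
          then have "\<Lambda>' (?t2 ` {..<n}) = \<Lambda> (?t2 ` {..<n})" using x by (intro \<Lambda>'(2)) blast
          then have "lab \<Lambda>' ?t2 X2" using *(2) unfolding lab_def by (simp only:)
          then show ?thesis using *(1) by blast
        qed
        then show "?t2 ` {..<n} \<subseteq> insert x M" "lab \<Lambda>' ?t2 X2" by blast+
      qed
      moreover have "\<Lambda>' G = \<Lambda> G" if "G \<subseteq> M" for G using \<Lambda>'(2) that x by blast
      ultimately have "insert x M = M" by (intro max[of _ \<Lambda>']) auto
      then show False using x by blast
    qed
    then have "lab \<Lambda> (t(i := x)) (Y i)" using sys i unfolding sys_def x_def by blast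
    then have "lab \<Lambda> (t(i := x)) X" using lab_mono[OF net upd[OF \<open>x \<in> M\<close>]] YX by blast
    then show ?thesis using \<open>x \<in> M\<close> by blast
  qed
qed

text \<open>A single tuple realising \<open>s\<close>, with principal ultrafilters as labels. It
  contains no reserved points, so there are no promises to keep.\<close>

lemma sys_initial:
  assumes s: "s \<in> atoms n adj V"
  obtains M \<Lambda> t where "sys M \<Lambda>" "t ` {..<n} \<subseteq> M" "\<And>X. lab \<Lambda> t X \<longleftrightarrow> s \<in> X"
proof -
  obtain t0 :: "nat \<Rightarrow> nat" where t0: "\<And>a b. (a, b) \<in> keq s \<longleftrightarrow> a < n \<and> b < n \<and> t0 a = t0 b"
    using keq_atoms[OF s] by metis
  define t :: "nat \<Rightarrow> 'v atom pt" where "t = (\<lambda>i. Root (t0 i))"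
  obtain \<kappa> where \<kappa>: "s = atom n t \<kappa>" "proper \<kappa>"
    using atom_of_kernel[OF s _ V_nonempty, of t] t0 n3 unfolding proper_def t_def by auto
  define \<Lambda> where "\<Lambda> = (\<lambda>G :: 'v atom pt set. {B. \<kappa> \<in> B})"
  have "good G \<kappa>" if G: "G \<subseteq> t ` {..<n}" "card G = n" for G
  proof -
    have "card (t ` {..<n}) \<le> n" by (metis card_image_le card_lessThan finite_lessThan)
    then have "G = t ` {..<n}" using G by (intro card_seteq) auto
    moreover from this have inj: "inj_on t {..<n}" using G by (intro eq_card_imp_inj_on) auto
    ultimately show ?thesis using good_iff[OF inj, of \<kappa>] atom_in_atomsE[OF _ inj, of \<kappa>] s \<kappa>(1) by simp
  qed
  then have "net (t ` {..<n}) \<Lambda>"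
    unfolding net_def \<Lambda>_def using \<kappa>(2) by (auto simp: ultra_def push_def)
  then have "sys (t ` {..<n}) \<Lambda>" by (auto simp: sys_def t_def)
  then show ?thesis using that[of "t ` {..<n}" \<Lambda> t] \<kappa>(1) by (simp add: lab_def \<Lambda>_def)
qed

lemma saturated_net_exists:
  assumes s: "s \<in> atoms n adj V"
  shows "\<exists>(M :: 'v atom pt set) \<Lambda> t. net M \<Lambda> \<and> t ` {..<n} \<subseteq> M \<and> (\<forall>X. lab \<Lambda> t X \<longleftrightarrow> s \<in> X) \<and>
    (\<forall>t i X. t ` {..<n} \<subseteq> M \<longrightarrow> i < n \<longrightarrow> X \<subseteq> atoms n adj V \<longrightarrow> lab \<Lambda> t (cyl i X) \<longrightarrow>
       (\<exists>x\<in>M. lab \<Lambda> (t(i := x)) X))"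
proof -
  obtain M0 \<Lambda>0 t where 0: "sys M0 \<Lambda>0" "t ` {..<n} \<subseteq> M0" "\<And>X. lab \<Lambda>0 t X \<longleftrightarrow> s \<in> X"
    using sys_initial[OF s] by metis
  obtain M \<Lambda> where M: "sys M \<Lambda>" "M0 \<subseteq> M" "\<And>G. G \<subseteq> M0 \<Longrightarrow> finite G \<Longrightarrow> \<Lambda> G = \<Lambda>0 G"
    "\<And>M' \<Lambda>'. sys M' \<Lambda>' \<Longrightarrow> M \<subseteq> M' \<Longrightarrow> (\<And>G. G \<subseteq> M \<Longrightarrow> finite G \<Longrightarrow> \<Lambda>' G = \<Lambda> G) \<Longrightarrow> M' = M"
    using sys_maximal[OF 0(1)] by blast
  have "lab \<Lambda> t X \<longleftrightarrow> s \<in> X" for X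
    using 0(3) M(3)[OF 0(2)] by (simp add: lab_def)
  moreover have "t ` {..<n} \<subseteq> M" using 0(2) M(2) by blast
  moreover have "net M \<Lambda>" using M(1) by (simp add: sys_def)
  moreover have "\<exists>x\<in>M. lab \<Lambda> (t'(i := x)) X"
    if "t' ` {..<n} \<subseteq> M" "i < n" "X \<subseteq> atoms n adj V" "lab \<Lambda> t' (cyl i X)" for t' i X
    by (rule sys_saturated[OF M(1,4) that])
  ultimately show ?thesis by (intro exI[of _ M] exI[of _ \<Lambda>] exI[of _ t]) blast
qed

text \<open>Each atom \<open>s\<close> gets its own saturated network, with a tuple at which
  precisely the sets containing \<open>s\<close> hold. This makes the product map injective. Working
  in the full signature settles all reducts at once.\<close>

lemma embeddable_complex_algebra:
  "\<exists>U :: 'v atom \<Rightarrow> 'v atom pt set. embeddable (L_PEA n) (complex_algebra (atom_struc n adj V))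
     (prod_alg (atoms n adj V) (\<lambda>s. PEA_set_alg n (U s)))"
proof -
  let ?A = "atoms n adj V" and ?S = "atom_struc n adj V"
  define Q where "Q = (\<lambda>s (M :: 'v atom pt set) \<Lambda> \<tau>. net M \<Lambda> \<and> \<tau> ` {..<n} \<subseteq> M \<and> (\<forall>X. lab \<Lambda> \<tau> X \<longleftrightarrow> s \<in> X) \<and>
    (\<forall>t i X. t ` {..<n} \<subseteq> M \<longrightarrow> i < n \<longrightarrow> X \<subseteq> ?A \<longrightarrow> lab \<Lambda> t (cyl i X) \<longrightarrow>
       (\<exists>x\<in>M. lab \<Lambda> (t(i := x)) X)))"
  have "\<forall>s. \<exists>(M :: 'v atom pt set) \<Lambda> \<tau>. s \<in> ?A \<longrightarrow> Q s M \<Lambda> \<tau>"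
    using saturated_net_exists unfolding Q_def by blast
  from choice[OF this] obtain M :: "'v atom \<Rightarrow> 'v atom pt set" where
    "\<forall>s. \<exists>\<Lambda> \<tau>. s \<in> ?A \<longrightarrow> Q s (M s) \<Lambda> \<tau>" by blast
  from choice[OF this] obtain \<Lambda> where "\<forall>s. \<exists>\<tau>. s \<in> ?A \<longrightarrow> Q s (M s) (\<Lambda> s) \<tau>" by blast
  from choice[OF this] obtain \<tau> where Q: "\<And>s. s \<in> ?A \<Longrightarrow> Q s (M s) (\<Lambda> s) (\<tau> s)" by blast
  note Q = Q[unfolded Q_def]
  note net = Q[THEN conjunct1] and \<tau>1 = Q[THEN conjunct2, THEN conjunct1]
    and \<tau>2 = Q[THEN conjunct2, THEN conjunct2, THEN conjunct1, rule_format]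
    and sat = Q[THEN conjunct2, THEN conjunct2, THEN conjunct2, rule_format]
  define h where "h = (\<lambda>X. \<lambda>s\<in>?A. {t \<in> {..<n} \<rightarrow>\<^sub>E M s. lab (\<Lambda> s) t X})"
  have im: "t ` {..<n} \<subseteq> M s" if "t \<in> {..<n} \<rightarrow>\<^sub>E M s" for t s using that by auto
  have univ: "univ ?S = ?A" by (simp add: atom_struc_def)
  have op: "h (complex_op ?S f Xs) s = set_op n ({..<n} \<rightarrow>\<^sub>E M s) f (map (\<lambda>X. h X s) Xs)"
    if f: "f \<in> L_PEA n" and Xs: "Xs \<in> lists (Pow ?A)" "length Xs = arity f" and s: "s \<in> ?A" for f Xs s
  proof -
    let ?V = "{..<n} \<rightarrow>\<^sub>E M s"
    have u: "ultra (\<Lambda> s (t ` {..<n}))" if "t \<in> ?V" for t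
      using net_tuple(1)[OF net[OF s] im[OF that]] .
    have top: "lab (\<Lambda> s) t ?A" if "t \<in> ?V" for t using lab_atoms[OF net[OF s] im[OF that]] .
    have hs: "h X s = {t \<in> ?V. lab (\<Lambda> s) t X}" for X using s by (simp add: h_def)
    show ?thesis
    proof (cases f)
      case BPlus
      then obtain X Y where XY: "Xs = [X, Y]" using Xs by (auto simp: numeral_2_eq_2 length_Suc_conv)
      have "lab (\<Lambda> s) t (X \<union> Y) \<longleftrightarrow> lab (\<Lambda> s) t X \<or> lab (\<Lambda> s) t Y" if "t \<in> ?V" for t
        using ultra_Collect_conj[OF u[OF that], of "\<lambda>\<kappa>. atom n t \<kappa> \<notin> X" "\<lambda>\<kappa>. atom n t \<kappa> \<notin> Y"]
          ultra_Collect_not[OF u[OF that], of "\<lambda>\<kappa>. atom n t \<kappa> \<in> X"]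
          ultra_Collect_not[OF u[OF that], of "\<lambda>\<kappa>. atom n t \<kappa> \<in> Y"]
          ultra_Collect_not[OF u[OF that], of "\<lambda>\<kappa>. atom n t \<kappa> \<in> X \<union> Y"]
        by (simp add: lab_def) blast
      then show ?thesis using BPlus XY by (auto simp: complex_op_def L_BA_def hs)
    next
      case BMinus
      then obtain X where X: "Xs = [X]" using Xs by (auto simp: length_Suc_conv)
      have "lab (\<Lambda> s) t (?A - X) \<longleftrightarrow> \<not> lab (\<Lambda> s) t X" if "t \<in> ?V" for t
        using ultra_Collect_conj[OF u[OF that], of "\<lambda>\<kappa>. atom n t \<kappa> \<in> ?A" "\<lambda>\<kappa>. atom n t \<kappa> \<notin> X"]
          ultra_Collect_not[OF u[OF that], of "\<lambda>\<kappa>. atom n t \<kappa> \<in> X"] top[OF that]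
        by (simp add: lab_def)
      then show ?thesis using BMinus X by (auto simp: complex_op_def L_BA_def hs univ)
    next
      case BZero
      have "\<not> lab (\<Lambda> s) t {}" if "t \<in> ?V" for t using u[OF that] by (simp add: lab_def ultra_def)
      then show ?thesis using BZero Xs by (auto simp: complex_op_def L_BA_def hs)
    next
      case BOne
      then show ?thesis using Xs top by (auto simp: complex_op_def L_BA_def hs univ)
    next
      case (Cyl i)
      then have i: "i < n" using f by (auto simp: L_PEA_def L_BA_def)
      obtain X where X: "Xs = [X]" using Xs Cyl by (auto simp: length_Suc_conv)
      then have XA: "X \<subseteq> ?A" using Xs by auto
      have *: "lab (\<Lambda> s) t (cyl i X) \<longleftrightarrow> (\<exists>t'\<in>?V. lab (\<Lambda> s) t' X \<and> (\<forall>j<n. j \<noteq> i \<longrightarrow> t' j = t j))"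
        if t: "t \<in> ?V" for t
      proof
        assume "lab (\<Lambda> s) t (cyl i X)"
        from sat[OF s im[OF t] i XA this] obtain x where x: "x \<in> M s" "lab (\<Lambda> s) (t(i := x)) X" by blast
        moreover have "t(i := x) \<in> ?V" using t x(1) i by (auto simp: PiE_iff extensional_def)
        ultimately show "\<exists>t'\<in>?V. lab (\<Lambda> s) t' X \<and> (\<forall>j<n. j \<noteq> i \<longrightarrow> t' j = t j)"
          by (intro bexI[of _ "t(i := x)"]) simp
      next
        assume "\<exists>t'\<in>?V. lab (\<Lambda> s) t' X \<and> (\<forall>j<n. j \<noteq> i \<longrightarrow> t' j = t j)"
        then obtain t' where t': "t' \<in> ?V" "lab (\<Lambda> s) t' X" "\<forall>j<n. j \<noteq> i \<longrightarrow> t' j = t j" by blast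
        show "lab (\<Lambda> s) t (cyl i X)"
          by (rule lab_cyl[OF net[OF s] im[OF t'(1)] im[OF t] _ i t'(2)]) (use t'(3) in auto)
      qed
      have "{t \<in> ?V. lab (\<Lambda> s) t (cyl i X)} =
          {t \<in> ?V. \<exists>t'\<in>{t \<in> ?V. lab (\<Lambda> s) t X}. \<forall>j<n. j \<noteq> i \<longrightarrow> t' j = t j}"
        by (intro Collect_cong conj_cong refl) (simp only: * bex_simps mem_Collect_eq Bex_def conj_assoc)
      then show ?thesis using complex_op_atom_struc(1)[OF XA, of i] by (simp add: Cyl X hs)
    next
      case (Diag i j)
      then have ij: "i < n" "j < n" using f by (auto simp: L_PEA_def L_BA_def)
      have "lab (\<Lambda> s) t {s' \<in> ?A. (i, j) \<in> keq s'} \<longleftrightarrow> t i = t j" if "t \<in> ?V" for t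
        using ultra_Collect_conj[OF u[OF that], of "\<lambda>\<kappa>. atom n t \<kappa> \<in> ?A" "\<lambda>\<kappa>. t i = t j"]
          ultra_UNIV[OF u[OF that]] top[OF that] u[OF that] ij
        by (cases "t i = t j") (simp_all add: lab_def ultra_def)
      then show ?thesis
        using Diag Xs complex_op_atom_struc(2)[of "{}" n adj V i j] by (auto simp: hs)
    next
      case (Subst \<sigma>)
      then have \<sigma>: "\<sigma> \<in> {..<n} \<rightarrow> {..<n}" using f by (auto simp: L_PEA_def L_BA_def)
      obtain X where X: "Xs = [X]" using Xs Subst by (auto simp: length_Suc_conv)
      then have XA: "X \<subseteq> ?A" using Xs by auto
      have "lab (\<Lambda> s) t {s' \<in> ?A. sub_atom n \<sigma> s' \<in> X} \<longleftrightarrow> compose {..<n} t \<sigma> \<in> h X s" if t: "t \<in> ?V" for t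
      proof -
        have cV: "compose {..<n} t \<sigma> \<in> ?V" using t \<sigma> by (auto simp: compose_def)
        have eq: "atom n (t \<circ> \<sigma>) \<kappa> = atom n (compose {..<n} t \<sigma>) \<kappa>" for \<kappa> :: "'v atom pt set \<Rightarrow> 'v \<times> nat"
          by (rule atom_cong) (auto simp: compose_def)
        have "lab (\<Lambda> s) t {s' \<in> ?A. sub_atom n \<sigma> s' \<in> X} \<longleftrightarrow>
            {\<kappa>. atom n (compose {..<n} t \<sigma>) \<kappa> \<in> X} \<in> \<Lambda> s (t ` {..<n})"
          using ultra_Collect_conj[OF u[OF t], of "\<lambda>\<kappa>. atom n t \<kappa> \<in> ?A"
              "\<lambda>\<kappa>. atom n (compose {..<n} t \<sigma>) \<kappa> \<in> X"] top[OF t]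
          by (simp add: lab_def sub_atom_atom[OF \<sigma>] eq)
        also have "\<dots> \<longleftrightarrow> lab (\<Lambda> s) (compose {..<n} t \<sigma>) X"
          by (rule lab_subtuple[OF net[OF s] im[OF t]]) (use \<sigma> in \<open>auto simp: compose_def\<close>)
        finally show ?thesis using cV by (simp add: hs)
      qed
      then have "{t \<in> ?V. lab (\<Lambda> s) t {s' \<in> ?A. sub_atom n \<sigma> s' \<in> X}} =
          {t \<in> ?V. compose {..<n} t \<sigma> \<in> h X s}"
        by (intro Collect_cong conj_cong refl)
      then show ?thesis using complex_op_atom_struc(3)[OF XA, of \<sigma>] by (simp add: Subst X) (simp add: hs)
    qed
  qed
  have "hom_alg (L_PEA n) (complex_algebra ?S) (prod_alg ?A (\<lambda>s. PEA_set_alg n (M s))) h"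
    unfolding hom_alg_def
  proof (intro conjI ballI impI)
    show "h \<in> carr (complex_algebra ?S) \<rightarrow> carr (prod_alg ?A (\<lambda>s. PEA_set_alg n (M s)))"
      by (auto simp: h_def prod_alg_def PEA_set_alg_def set_alg_def)
    fix f Xs assume "f \<in> L_PEA n" "Xs \<in> lists (carr (complex_algebra ?S))" "length Xs = arity f"
    then have "h (complex_op ?S f Xs) s = set_op n ({..<n} \<rightarrow>\<^sub>E M s) f (map (\<lambda>X. h X s) Xs)" if "s \<in> ?A" for s
      using op that by (simp add: complex_algebra_def univ)
    then show "h (oper (complex_algebra ?S) f Xs) = oper (prod_alg ?A (\<lambda>s. PEA_set_alg n (M s))) f (map h Xs)"
      by (auto simp: fun_eq_iff complex_algebra_def prod_alg_def PEA_set_alg_def set_alg_def comp_def)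
        (auto simp: h_def)
  qed
  moreover have "inj_on h (carr (complex_algebra ?S))"
  proof (rule inj_onI)
    fix X Y assume XY: "X \<in> carr (complex_algebra ?S)" "Y \<in> carr (complex_algebra ?S)" "h X = h Y"
    then have sub: "X \<subseteq> ?A" "Y \<subseteq> ?A" by (auto simp: complex_algebra_def univ)
    have "s \<in> X \<longleftrightarrow> s \<in> Y" if s: "s \<in> ?A" for s
    proof -
      define t where "t = restrict (\<tau> s) {..<n}"
      have tV: "t \<in> {..<n} \<rightarrow>\<^sub>E M s" using \<tau>1[OF s] by (auto simp: t_def)
      have "atom n t \<kappa> = atom n (\<tau> s) \<kappa>" for \<kappa> :: "'v atom pt set \<Rightarrow> 'v \<times> nat"
        by (rule atom_cong) (auto simp: t_def)
      moreover have "t ` {..<n} = \<tau> s ` {..<n}" by (auto simp: t_def)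
      ultimately have "lab (\<Lambda> s) t Z \<longleftrightarrow> s \<in> Z" for Z
        using \<tau>2[OF s, of Z] by (simp add: lab_def)
      then have "t \<in> h Z s \<longleftrightarrow> s \<in> Z" for Z using tV s by (simp add: h_def)
      then show ?thesis using XY(3) by metis
    qed
    then show "X = Y" using sub by blast
  qed
  ultimately show ?thesis
    using embeddableI[OF is_algebra_complex_algebra[OF order_refl]] by blast
qed

end

section \<open>Non-representability for finitely colourable graphs\<close>

lemma sorted_list_of_set_strict_mono:
  fixes q :: "nat \<Rightarrow> nat"
  assumes "strict_mono q"
  shows "sorted_list_of_set (q ` {a..<b}) = map q [a..<b]"
proof (rule sorted_distinct_set_unique)
  show "sorted (map q [a..<b])"
    using assms by (auto simp: sorted_iff_nth_mono strict_mono_less_eq)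
  show "distinct (map q [a..<b])"
    using inj_on_subset[OF strict_mono_imp_inj_on[OF assms] subset_UNIV] by (simp add: distinct_map)
qed auto

text \<open>One factor of a representation of the diagonal-free reduct. The bases of different
  coordinates are unrelated, and diagonals are not respected as operations, so they survive only as
  elements \<open>D i j\<close> of the algebra. The last assumption supplies the tuple from which
  infinitely many points are drawn.\<close>

locale df_hom =
  fixes n :: nat and adj :: "'v \<Rightarrow> 'v \<Rightarrow> bool" and V :: "'v set" and U :: "nat \<Rightarrow> 'u set"
    and g :: "'v atom set \<Rightarrow> (nat \<Rightarrow> 'u) set"
  assumes n3: "n \<ge> 3" and infV: "infinite V"
    and g_Un: "\<And>X Y. X \<subseteq> atoms n adj V \<Longrightarrow> Y \<subseteq> atoms n adj V \<Longrightarrow> g (X \<union> Y) = g X \<union> g Y"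
    and g_Diff: "\<And>X. X \<subseteq> atoms n adj V \<Longrightarrow> g (atoms n adj V - X) = (\<Pi>\<^sub>E i\<in>{..<n}. U i) - g X"
    and g_empty: "g {} = {}"
    and g_cyl: "\<And>X i. X \<subseteq> atoms n adj V \<Longrightarrow> i < n \<Longrightarrow>
      g (cylinder n adj V i X) = {x \<in> (\<Pi>\<^sub>E i\<in>{..<n}. U i). \<exists>y\<in>g X. \<forall>j<n. j \<noteq> i \<longrightarrow> y j = x j}"
    and g_inj: "\<exists>s\<in>atoms n adj V. hue s (n - 1) \<noteq> None \<and> g {s} \<noteq> {}"
begin

abbreviation "A \<equiv> atoms n adj V"
abbreviation "W \<equiv> \<Pi>\<^sub>E i\<in>{..<n}. U i"

definition D :: "nat \<Rightarrow> nat \<Rightarrow> 'v atom set" where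
  "D i j = {s \<in> A. (i, j) \<in> keq s}"

definition Q :: "nat \<Rightarrow> ('v \<times> nat) set \<Rightarrow> 'v atom set" where
  "Q i C = {s \<in> A. \<exists>\<gamma>\<in>C. hue s i = Some \<gamma>}"

lemma DA: "D i j \<subseteq> A" and QA: "Q i C \<subseteq> A"
  by (auto simp: D_def Q_def)

lemma V_nonempty: "V \<noteq> {}"
  using infV by auto

lemma atomE:
  assumes "s \<in> A"
  obtains t :: "nat \<Rightarrow> nat" and \<kappa> where "s = atom n t \<kappa>" "range \<kappa> \<subseteq> V \<times> {..<n}"
proof -
  obtain t :: "nat \<Rightarrow> nat" and \<kappa>0 where s: "s = atom n t \<kappa>0" using assms by (auto simp: atoms_def)
  have "\<exists>\<kappa>. s = atom n t \<kappa> \<and> range \<kappa> \<subseteq> V \<times> {..<n}"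
    by (rule atom_of_kernel[OF assms _ V_nonempty]) (use s n3 in auto)
  then show ?thesis using that by blast
qed

lemma g_A: "g A = W"
  using g_Diff[of "{}"] g_empty by simp

lemma g_mono:
  assumes "X \<subseteq> Y" "Y \<subseteq> A"
  shows "g X \<subseteq> g Y"
proof -
  have "X \<union> Y = Y" using assms by auto
  then show ?thesis using g_Un[of X Y] assms by auto
qed

lemma g_sub: "X \<subseteq> A \<Longrightarrow> g X \<subseteq> W"
  using g_mono[of X A] g_A by simp

lemma g_Int:
  assumes "X \<subseteq> A" "Y \<subseteq> A"
  shows "g (X \<inter> Y) = g X \<inter> g Y"
proof -
  have "X \<inter> Y = A - ((A - X) \<union> (A - Y))" using assms by auto
  moreover have "g ((A - X) \<union> (A - Y)) = (W - g X) \<union> (W - g Y)"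
    using g_Un[of "A - X" "A - Y"] g_Diff assms by simp
  ultimately have "g (X \<inter> Y) = W - ((W - g X) \<union> (W - g Y))"
    using g_Diff[of "(A - X) \<union> (A - Y)"] by auto
  then show ?thesis using g_sub assms by auto
qed

lemma g_UN:
  assumes "finite I" "\<And>i. i \<in> I \<Longrightarrow> X i \<subseteq> A"
  shows "g (\<Union>i\<in>I. X i) = (\<Union>i\<in>I. g (X i))"
  using assms
proof (induction I rule: finite_induct)
  case (insert i I)
  have "(\<Union>i\<in>I. X i) \<subseteq> A" using insert.prems by blast
  then have "g (X i \<union> (\<Union>i\<in>I. X i)) = g (X i) \<union> g (\<Union>i\<in>I. X i)"
    using insert.prems by (intro g_Un) auto
  then show ?case using insert by simp
qed (simp add: g_empty)

definition closed :: "nat \<Rightarrow> 'v atom set \<Rightarrow> bool" where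
  "closed i X \<longleftrightarrow> X \<subseteq> A \<and> (\<forall>s\<in>A. \<forall>s'\<in>X. cyl_eq n i s s' \<longrightarrow> s \<in> X)"

text \<open>\<open>X\<close> equals its own cylinder along \<open>i\<close> and \<open>g\<close>
  respects cylinders, so the coordinate \<open>i\<close> is irrelevant for the image.\<close>

lemma closed_invariant1:
  assumes X: "closed i X" "i < n" and y: "y \<in> g X" "y' \<in> W" "\<And>j. j < n \<Longrightarrow> j \<noteq> i \<Longrightarrow> y j = y' j"
  shows "y' \<in> g X"
proof -
  have "cylinder n adj V i X = X"
    using X cyl_eq_refl by (auto simp: closed_def cylinder_def)
  moreover have "y' \<in> g (cylinder n adj V i X)"
    using g_cyl[of X i] X y by (auto simp: closed_def)
  ultimately show ?thesis by simp
qed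

lemma closed_invariant:
  assumes "finite K" "\<And>k. k \<in> K \<Longrightarrow> k < n \<and> closed k X" "X \<subseteq> A" "y \<in> g X" "y' \<in> W"
    "\<And>j. j < n \<Longrightarrow> j \<notin> K \<Longrightarrow> y j = y' j"
  shows "y' \<in> g X"
  using assms
proof (induction K arbitrary: y rule: finite_induct)
  case empty
  have "y \<in> W" using g_sub empty.prems by blast
  then have "y = y'" by (rule PiE_ext[OF _ empty.prems(4)]) (simp add: empty.prems(5))
  then show ?case using empty.prems by simp
next
  case (insert k K)
  define z where "z = y(k := y' k)"
  have k: "k < n" "closed k X" using insert.prems by auto
  have "y \<in> W" using g_sub insert.prems by blast
  then have "z \<in> W" using k insert.prems(4) by (auto simp: z_def PiE_iff extensional_def)
  then have "z \<in> g X"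
    by (rule closed_invariant1[OF k(2,1) insert.prems(3)]) (simp add: z_def)
  then show ?case
    by (rule insert.IH[rotated 2]) (use insert.prems in \<open>auto simp: z_def\<close>)
qed

lemma closed_D: "k \<noteq> i \<Longrightarrow> k \<noteq> j \<Longrightarrow> i < n \<Longrightarrow> j < n \<Longrightarrow> closed k (D i j)"
  by (auto simp: closed_def D_def cyl_eq_def)

lemma closed_Q: "closed i (Q i C)"
  by (auto simp: closed_def Q_def cyl_eq_def)

lemma cylinder_D:
  assumes "i < n" "j < n" "i \<noteq> j"
  shows "cylinder n adj V i (D i j) = A"
proof -
  have "\<exists>s'\<in>D i j. cyl_eq n i s s'" if sA: "s \<in> A" for s
  proof -
    obtain t :: "nat \<Rightarrow> nat" and \<kappa> where s: "s = atom n t \<kappa>" "range \<kappa> \<subseteq> V \<times> {..<n}"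
      using atomE[OF sA] .
    let ?t = "t(i := t j)"
    have "\<not> inj_on ?t {..<n}" using assms by (auto simp: inj_on_def)
    then have "atom n ?t \<kappa> \<in> A" using s n3 by (intro atom_in_atomsI) auto
    then have "atom n ?t \<kappa> \<in> D i j" using assms by (simp add: D_def)
    moreover have "cyl_eq n i s (atom n ?t \<kappa>)"
      unfolding s using cyl_eq_atom[of n i t ?t \<kappa> \<kappa>] assms by simp
    ultimately show ?thesis by blast
  qed
  then show ?thesis by (auto simp: cylinder_def)
qed

lemma D_sym: "D i j = D j i"
  by (auto simp: D_def atoms_def)

lemma D_trans: "D i j \<inter> D j k \<subseteq> D i k"
  by (auto simp: D_def atoms_def)

lemma image_off_repeat:
  assumes "t i = t j" "i \<noteq> j" "j < n"
  shows "t ` off n i = t ` {..<n}"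
proof (intro equalityI subsetI)
  fix y assume "y \<in> t ` {..<n}"
  then obtain a where "a < n" "y = t a" by blast
  then show "y \<in> t ` off n i" using assms by (cases "a = i") (auto simp: image_iff)
qed blast

text \<open>Where the entries \<open>i\<close> and \<open>j\<close> coincide, omitting either leaves
  the same set of points, so both faces are one.\<close>

lemma D_Int_Q:
  assumes "i < n" "j < n" "i \<noteq> j"
  shows "D i j \<inter> Q i C = D i j \<inter> Q j C"
proof -
  have "hue s i = hue s j" if s: "s \<in> D i j" for s
  proof -
    obtain t :: "nat \<Rightarrow> nat" and \<kappa> where st: "s = atom n t \<kappa>" using s by (auto simp: D_def atoms_def)
    then have tij: "t i = t j" using s by (simp add: D_def)
    have "t ` off n i = t ` {..<n}" "t ` off n j = t ` {..<n}"
      using image_off_repeat[of t i j] image_off_repeat[of t j i] assms tij by simp_all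
    moreover have "inj_on t (off n l) \<longleftrightarrow> card (t ` off n l) = n - 1" if "l < n" for l
      using that by (auto simp: card_image intro: eq_card_imp_inj_on)
    ultimately show ?thesis using assms by (simp add: st hue_atom)
  qed
  then show ?thesis by (auto simp: D_def Q_def)
qed

lemma Q_UNIV:
  assumes "i < n" "s \<in> A" "\<And>a b. a \<in> off n i \<Longrightarrow> b \<in> off n i \<Longrightarrow> a < b \<Longrightarrow> s \<notin> D a b"
  shows "s \<in> Q i (V \<times> {..<n})"
proof -
  obtain t :: "nat \<Rightarrow> nat" and \<kappa> where s: "s = atom n t \<kappa>" "range \<kappa> \<subseteq> V \<times> {..<n}"
    using atomE[OF assms(2)] .
  have "inj_on t (off n i)"
    using assms(2,3) by (intro linorder_inj_onI') (auto simp: D_def s)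
  then have "hue s i = Some (\<kappa> (t ` off n i))" using assms(1) by (simp add: s hue_atom)
  then show ?thesis using s(2) assms(2) unfolding Q_def by blast
qed

lemma Q_independent:
  assumes "\<And>\<gamma> \<delta>. \<gamma> \<in> C \<Longrightarrow> \<delta> \<in> C \<Longrightarrow> \<not> cadj adj \<gamma> \<delta>" "s \<in> A"
  shows "\<exists>i<n. s \<notin> Q i C"
proof (rule ccontr)
  assume "\<not> ?thesis"
  then have *: "\<exists>\<gamma>\<in>C. hue s i = Some \<gamma>" if "i < n" for i using that by (auto simp: Q_def)
  then have "\<forall>i<n. hue s i \<noteq> None" by blast
  then obtain i j where ij: "i < n" "j < n" "cadj adj (the (hue s i)) (the (hue s j))"
    using assms(2) unfolding atoms_def by blast
  have "the (hue s i) \<in> C" "the (hue s j) \<in> C" using * ij(1,2) by fastforce+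
  then show False using assms(1) ij(3) by blast
qed

text \<open>After replacing the last point by a fresh one, the face \<open>n - 1\<close> keeps its
  colour, the face \<open>n - 2\<close> gets \<open>\<gamma>\<close>, and the others get a colour of
  another copy, which provides the adjacent pair. In a representation this gives a last entry for
  every colour over one fixed tuple.\<close>

lemma any_face_colour:
  assumes s: "s \<in> A" "hue s (n - 1) \<noteq> None" and \<gamma>: "\<gamma> \<in> V \<times> {..<n}"
  shows "s \<in> cylinder n adj V (n - 1) (Q (n - 2) {\<gamma>})"
proof -
  obtain t :: "nat \<Rightarrow> nat" and \<kappa> where st: "s = atom n t \<kappa>" "range \<kappa> \<subseteq> V \<times> {..<n}"
    using atomE[OF s(1)] .
  have inj0: "inj_on t (off n (n - 1))" using s(2) by (auto simp: st hue_atom split: if_splits)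
  obtain x where x: "x \<notin> t ` {..<n}" using ex_new_if_finite[of "t ` {..<n}"] by auto
  define t' where "t' = t(n - 1 := x)"
  have "inj_on t' (off n (n - 1))" using inj0 by (simp add: t'_def inj_on_def)
  moreover have "t' (n - 1) \<notin> t' ` off n (n - 1)" using x by (auto simp: t'_def)
  ultimately have "inj_on t' (insert (n - 1) (off n (n - 1)))"
    unfolding inj_on_insert by (simp only: Diff_idemp simp_thms)
  moreover have "insert (n - 1) (off n (n - 1)) = {..<n}" using n3 by auto
  ultimately have inj: "inj_on t' {..<n}" by (simp only:)
  have off: "t' ` off n i = t' ` off n j \<longleftrightarrow> i = j" if "i < n" "j < n" for i j
  proof -
    have "off n i = off n j \<longleftrightarrow> i = j" using that by auto
    then show ?thesis using inj_on_image_eq_iff[OF inj, of "off n i" "off n j"] by auto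
  qed
  have injo: "inj_on t' (off n i)" for i by (rule inj_on_subset[OF inj]) auto
  obtain v where v: "v \<in> V" using V_nonempty by blast
  define \<delta> where "\<delta> = (v, if snd \<gamma> = 0 then 1 else 0 :: nat)"
  have \<delta>: "\<delta> \<in> V \<times> {..<n}" "cadj adj \<gamma> \<delta>" using v n3 by (auto simp: \<delta>_def cadj_def)
  define \<kappa>' where "\<kappa>' = (\<lambda>H. if H = t' ` off n (n - 1) then \<kappa> H else if H = t' ` off n (n - 2) then \<gamma> else \<delta>)"
  have \<kappa>2: "\<kappa>' (t' ` off n (n - 2)) = \<gamma>" and \<kappa>0: "\<kappa>' (t' ` off n 0) = \<delta>"
    using off[of "n - 2" "n - 1"] off[of 0 "n - 1"] off[of 0 "n - 2"] n3 by (auto simp: \<kappa>'_def)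
  have "\<kappa>' H \<in> V \<times> {..<n}" for H using st(2) \<gamma> \<delta>(1) unfolding \<kappa>'_def by auto
  then have "range \<kappa>' \<subseteq> V \<times> {..<n}" by blast
  moreover have "\<exists>i<n. \<exists>j<n. cadj adj (\<kappa>' (t' ` off n i)) (\<kappa>' (t' ` off n j))"
    by (rule exI[of _ "n - 2"], rule conjI, use n3 in simp, rule exI[of _ 0])
      (use n3 \<kappa>2 \<kappa>0 \<delta> in simp)
  ultimately have s'A: "atom n t' \<kappa>' \<in> A" using n3 by (intro atom_in_atomsI)
  have "hue (atom n t' \<kappa>') (n - 2) = Some \<gamma>" using injo \<kappa>2 n3 by (simp add: hue_atom)
  then have "atom n t' \<kappa>' \<in> Q (n - 2) {\<gamma>}" using s'A by (simp add: Q_def)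
  moreover have "t ` off n (n - 1) = t' ` off n (n - 1)" by (intro image_cong) (auto simp: t'_def)
  then have "\<kappa> (t ` off n (n - 1)) = \<kappa>' (t ` off n (n - 1))" by (simp add: \<kappa>'_def)
  then have "cyl_eq n (n - 1) s (atom n t' \<kappa>')"
    unfolding st(1) using n3 by (subst cyl_eq_atom) (auto simp: t'_def)
  ultimately show ?thesis using s(1) by (auto simp: cylinder_def)
qed

text \<open>A substitute for equality between points of \<open>U i\<close> and points of
  \<open>U j\<close>. It is symmetric, transitive across three different coordinates, and total; it
  is not claimed to be single-valued.\<close>

definition R :: "nat \<Rightarrow> nat \<Rightarrow> 'u \<Rightarrow> 'u \<Rightarrow> bool" where
  "R i j p q \<longleftrightarrow> (\<exists>y\<in>g (D i j). y i = p \<and> y j = q)"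

lemma R_D:
  assumes "R i j p q" "i < n" "j < n" "y \<in> W" "y i = p" "y j = q"
  shows "y \<in> g (D i j)"
proof -
  obtain z where z: "z \<in> g (D i j)" "z i = p" "z j = q" using assms(1) by (auto simp: R_def)
  show ?thesis
    by (rule closed_invariant[of "{..<n} - {i, j}" _ z]) (use z assms DA closed_D in auto)
qed

lemma R_U: "R i j p q \<Longrightarrow> i < n \<Longrightarrow> j < n \<Longrightarrow> p \<in> U i \<and> q \<in> U j"
  using g_sub[OF DA] unfolding R_def by (fastforce simp: PiE_iff)

lemma R_sym: "R i j p q \<Longrightarrow> R j i q p"
  unfolding R_def using D_sym by metis

text \<open>Membership in \<open>g (D i j)\<close> depends on the coordinates \<open>i\<close> and
  \<open>j\<close> alone, so the coordinate \<open>k\<close> may be set to \<open>r\<close> without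
  leaving it.\<close>

lemma R_trans:
  assumes "R i j p q" "R j k q r" "i < n" "j < n" "k < n" "i \<noteq> k" "j \<noteq> k"
  shows "R i k p r"
proof -
  obtain y where y: "y \<in> g (D i j)" "y i = p" "y j = q" using assms by (auto simp: R_def)
  define z where "z = y(k := r)"
  have "r \<in> U k" using R_U[OF assms(2)] assms by blast
  moreover have "y \<in> W" using y g_sub[OF DA] by blast
  ultimately have zW: "z \<in> W" using assms by (auto simp: z_def PiE_iff extensional_def)
  have "z \<in> g (D i j)" by (rule R_D[OF assms(1) _ _ zW]) (use assms y in \<open>auto simp: z_def\<close>)
  moreover have "z \<in> g (D j k)" by (rule R_D[OF assms(2) _ _ zW]) (use assms y in \<open>auto simp: z_def\<close>)
  ultimately have "z \<in> g (D i j \<inter> D j k)" using g_Int DA by simp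
  then have "z \<in> g (D i k)" using g_mono[OF D_trans DA] by blast
  then show ?thesis unfolding R_def using y assms by (intro bexI[of _ z]) (auto simp: z_def)
qed

lemma R_total:
  assumes "y \<in> W" "i < n" "j < n" "i \<noteq> j"
  shows "\<exists>p. R i j p (y j)"
proof -
  have "y \<in> g (cylinder n adj V i (D i j))" using cylinder_D[OF assms(2-4)] g_A assms(1) by simp
  then obtain z where "z \<in> g (D i j)" "\<forall>l<n. l \<noteq> i \<longrightarrow> z l = y l"
    using g_cyl[OF DA assms(2)] by auto
  then show ?thesis unfolding R_def using assms by auto
qed

text \<open>Each \<open>b m\<close> acts as one point with a name in every base: names of the same
  point are related, names of different points at increasing coordinates are not. The points come
  from the infinitely many colours, as last entries over a fixed tuple \<open>y0\<close> that give
  the face \<open>n - 2\<close> different colours.\<close>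

lemma separated_points:
  obtains b :: "nat \<Rightarrow> nat \<Rightarrow> 'u" where
    "\<And>m i. i < n \<Longrightarrow> b m i \<in> U i"
    "\<And>m i j. i < n \<Longrightarrow> j < n \<Longrightarrow> i \<noteq> j \<Longrightarrow> R i j (b m i) (b m j)"
    "\<And>m m' i j. m \<noteq> m' \<Longrightarrow> i < j \<Longrightarrow> j < n \<Longrightarrow> \<not> R i j (b m i) (b m' j)"
proof -
  let ?Col = "V \<times> {..<n}"
  define l where "l = n - 1"
  define k where "k = n - 2"
  have kl: "k < l" "l < n" "k < n" using n3 by (auto simp: k_def l_def)
  obtain s y0 where s: "s \<in> A" "hue s l \<noteq> None" "y0 \<in> g {s}"
    using g_inj unfolding l_def by blast
  have y0: "y0 \<in> W" using s g_sub[of "{s}"] by blast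
  have "\<exists>z\<in>g (Q k {\<gamma>}). \<forall>j<n. j \<noteq> l \<longrightarrow> z j = y0 j" if "\<gamma> \<in> ?Col" for \<gamma>
  proof -
    have "{s} \<subseteq> cylinder n adj V l (Q k {\<gamma>})"
      using any_face_colour[OF s(1) _ that] s(2) by (simp add: k_def l_def)
    then have "y0 \<in> g (cylinder n adj V l (Q k {\<gamma>}))"
      using g_mono[of "{s}" "cylinder n adj V l (Q k {\<gamma>})"] s(3) unfolding cylinder_def by blast
    then show ?thesis using g_cyl[OF QA kl(2)] by auto
  qed
  then obtain z where z: "\<And>\<gamma>. \<gamma> \<in> ?Col \<Longrightarrow> z \<gamma> \<in> g (Q k {\<gamma>})"
    "\<And>\<gamma> j. \<gamma> \<in> ?Col \<Longrightarrow> j < n \<Longrightarrow> j \<noteq> l \<Longrightarrow> z \<gamma> j = y0 j"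
    by metis
  have zW: "z \<gamma> \<in> W" if "\<gamma> \<in> ?Col" for \<gamma> using z(1)[OF that] g_sub[OF QA] by blast
  define x where "x = (\<lambda>\<gamma>. z \<gamma> l)"
  \<comment> \<open>A common partner \<open>p\<close> is put at the coordinate \<open>k\<close>.
    Then the faces \<open>k\<close> and \<open>l\<close> coincide in \<open>w \<gamma>\<close> and
    in \<open>w \<delta>\<close>. These tuples differ only at \<open>l\<close>, which the face
    \<open>l\<close> does not see, so this face would have both colours.\<close>
  have apart: False if c: "\<gamma> \<in> ?Col" "\<delta> \<in> ?Col" "\<gamma> \<noteq> \<delta>" "R k l p (x \<gamma>)" "R k l p (x \<delta>)" for \<gamma> \<delta> p
  proof -
    have pU: "p \<in> U k" using R_U[OF c(4)] kl by blast
    define w where "w = (\<lambda>\<gamma>. (z \<gamma>)(k := p))"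
    have wW: "w \<gamma> \<in> W" if "\<gamma> \<in> ?Col" for \<gamma>
      using zW[OF that] pU kl by (auto simp: w_def PiE_iff extensional_def)
    have wQ: "w \<gamma> \<in> g (Q k {\<gamma>})" if "\<gamma> \<in> ?Col" for \<gamma>
      by (rule closed_invariant1[OF closed_Q kl(3) z(1)[OF that] wW[OF that]]) (simp add: w_def)
    have wD: "w \<gamma> \<in> g (D k l)" "w \<delta> \<in> g (D k l)"
      by (rule R_D[OF c(4)] R_D[OF c(5)]; use kl wW c in \<open>simp add: w_def x_def\<close>)+
    have DQ: "g (D k l) \<inter> g (Q k C) = g (D k l) \<inter> g (Q l C)" for C
      using g_Int[OF DA QA, of k l k C] g_Int[OF DA QA, of k l l C] D_Int_Q[of k l C] kl by simp
    have "w \<gamma> \<in> g (Q l {\<gamma>})" using wQ[OF c(1)] wD(1) DQ by blast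
    then have "w \<delta> \<in> g (Q l {\<gamma>})"
      by (rule closed_invariant1[OF closed_Q kl(2) _ wW[OF c(2)]])
        (use z(2)[OF c(1)] z(2)[OF c(2)] in \<open>simp add: w_def\<close>)
    then have "w \<delta> \<in> g (Q k {\<gamma>})" using wD(2) DQ by blast
    then have "w \<delta> \<in> g (Q k {\<gamma>} \<inter> Q k {\<delta>})" using wQ[OF c(2)] g_Int[OF QA QA] by blast
    moreover have "Q k {\<gamma>} \<inter> Q k {\<delta>} = {}" using c(3) by (auto simp: Q_def)
    ultimately show False using g_empty by simp
  qed
  have "\<forall>\<gamma> i. \<exists>p. \<gamma> \<in> ?Col \<longrightarrow> i < l \<longrightarrow> R i l p (x \<gamma>)"
    using R_total[OF zW] kl unfolding x_def by (metis less_trans less_irrefl)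
  then obtain a0 where a0: "\<And>\<gamma> i. \<gamma> \<in> ?Col \<Longrightarrow> i < l \<Longrightarrow> R i l (a0 \<gamma> i) (x \<gamma>)" by metis
  \<comment> \<open>All names of the point of \<open>\<gamma>\<close> are partners of
    \<open>x \<gamma>\<close>, so any two of them are related through the coordinate
    \<open>l\<close>.\<close>
  define a where "a = (\<lambda>\<gamma> i. if i = l then x \<gamma> else a0 \<gamma> i)"
  have less_n: "i < l" if "i < n" "i \<noteq> l" for i using that by (simp add: l_def)
  have al: "R i l (a \<gamma> i) (a \<gamma> l)" if "\<gamma> \<in> ?Col" "i < n" "i \<noteq> l" for \<gamma> i
    using a0[OF that(1) less_n[OF that(2,3)]] that by (simp add: a_def)
  have same: "R i j (a \<gamma> i) (a \<gamma> j)" if c: "\<gamma> \<in> ?Col" "i < n" "j < n" "i \<noteq> j" for \<gamma> i j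
  proof -
    consider "j = l" | "i = l" "j \<noteq> l" | "i \<noteq> l" "j \<noteq> l" by blast
    then show ?thesis
    proof cases
      case 1
      then show ?thesis using al[OF c(1,2)] c by simp
    next
      case 2
      then show ?thesis using R_sym[OF al[OF c(1,3)]] by simp
    next
      case 3
      show ?thesis
        by (rule R_trans[OF al[OF c(1,2)] R_sym[OF al[OF c(1,3)]]]) (use 3 c kl in auto)
    qed
  qed
  have aU: "a \<gamma> i \<in> U i" if "\<gamma> \<in> ?Col" "i < n" for \<gamma> i
  proof (cases "i = l")
    case True
    then show ?thesis using zW[OF that(1)] that by (auto simp: a_def x_def)
  next
    case False
    then show ?thesis using R_U[OF al[OF that False]] that kl by blast
  qed
  \<comment> \<open>A relation between names of different points could be carried over to the
    coordinates \<open>k\<close> and \<open>l\<close>, where \<open>apart\<close> excludes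
    it.\<close>
  have diff: "\<not> R i j (a \<gamma> i) (a \<delta> j)" if c: "\<gamma> \<in> ?Col" "\<delta> \<in> ?Col" "\<gamma> \<noteq> \<delta>" "i < j" "j < n" for \<gamma> \<delta> i j
  proof
    assume r: "R i j (a \<gamma> i) (a \<delta> j)"
    have il: "i < n" "i \<noteq> l" using c(4,5) by (auto simp: l_def)
    have "R i l (a \<gamma> i) (a \<delta> l)"
    proof (cases "j = l")
      case False
      then show ?thesis
        using R_trans[OF r al[OF c(2,5)]] il c kl by blast
    qed (use r in simp)
    then have "R k l (a \<gamma> k) (a \<delta> l)"
    proof (cases "i = k")
      case False
      assume "R i l (a \<gamma> i) (a \<delta> l)"
      then show ?thesis
        using R_trans[OF same[OF c(1) kl(3) il(1)]] False il kl by blast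
    qed simp
    moreover have "R k l (a \<gamma> k) (a \<gamma> l)" using al[OF c(1) kl(3)] kl by simp
    ultimately show False using apart[OF c(1-3), of "a \<gamma> k"] by (simp add: a_def)
  qed
  have "infinite ?Col" using infV n3 by (auto simp: finite_cartesian_product_iff lessThan_empty_iff)
  then obtain e :: "nat \<Rightarrow> 'v \<times> nat" where e: "inj e" "range e \<subseteq> ?Col"
    using infinite_countable_subset by blast
  have eC: "e m \<in> ?Col" for m using e by blast
  show ?thesis
  proof (rule that[of "\<lambda>m. a (e m)"])
    show "a (e m) i \<in> U i" if "i < n" for m i using aU[OF eC that] .
    show "R i j (a (e m) i) (a (e m) j)" if "i < n" "j < n" "i \<noteq> j" for m i j using same[OF eC that] .
    show "\<not> R i j (a (e m) i) (a (e m') j)" if "m \<noteq> m'" "i < j" "j < n" for m m' i j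
      using diff[OF eC eC _ that(2,3)] that(1) e(1) by (auto dest: injD)
  qed
qed

text \<open>The colours split into \<open>m * n\<close> independent classes. Finite unions are
  respected, so each face of an injective tuple falls into a class, and Ramsey's theorem makes the
  class constant for points from an infinite set. A tuple of such points has all faces in one class
  \<open>d\<close>, although the sets \<open>A - Q i (I d)\<close> cover all atoms.\<close>

lemma not_finitely_colourable:
  fixes c :: "'v \<Rightarrow> nat"
  assumes c: "\<And>v. v \<in> V \<Longrightarrow> c v < m" "\<And>v w. v \<in> V \<Longrightarrow> w \<in> V \<Longrightarrow> adj v w \<Longrightarrow> c v \<noteq> c w"
  shows False
proof -
  obtain b :: "nat \<Rightarrow> nat \<Rightarrow> 'u" where bU: "\<And>m i. i < n \<Longrightarrow> b m i \<in> U i"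
    and same: "\<And>m i j. i < n \<Longrightarrow> j < n \<Longrightarrow> i \<noteq> j \<Longrightarrow> R i j (b m i) (b m j)"
    and diff: "\<And>m m' i j. m \<noteq> m' \<Longrightarrow> i < j \<Longrightarrow> j < n \<Longrightarrow> \<not> R i j (b m i) (b m' j)"
    using separated_points by blast
  \<comment> \<open>Since \<open>k < n\<close>, the number \<open>c v * n + k\<close> encodes the
    colour of the vertex together with its copy.\<close>
  define I where "I = (\<lambda>d. {(v, k) | v k. v \<in> V \<and> k < n \<and> c v * n + k = d})"
  have ind: "\<not> cadj adj \<gamma> \<delta>" if \<gamma>\<delta>: "\<gamma> \<in> I d" "\<delta> \<in> I d" for \<gamma> \<delta> d
  proof -
    obtain v k w l where vw: "\<gamma> = (v, k)" "\<delta> = (w, l)" "v \<in> V" "w \<in> V" "k < n" "l < n"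
      "c v * n + k = d" "c w * n + l = d" using \<gamma>\<delta> by (auto simp: I_def)
    have "(c v * n + k) div n = (c w * n + l) div n" "(c v * n + k) mod n = (c w * n + l) mod n"
      using vw by simp_all
    then have "c v = c w" "k = l" using vw(5,6) by simp_all
    then show ?thesis using c(2)[of v w] vw by (auto simp: cadj_def)
  qed
  have IV: "V \<times> {..<n} \<subseteq> (\<Union>d<m * n. I d)"
  proof
    fix \<gamma> assume "\<gamma> \<in> V \<times> {..<n}"
    then obtain v k where vk: "\<gamma> = (v, k)" "v \<in> V" "k < n" by auto
    have "c v * n + k < Suc (c v) * n" using vk by simp
    also have "\<dots> \<le> m * n" using c(1)[OF vk(2)] by (intro mult_le_mono1) simp
    finally show "\<gamma> \<in> (\<Union>d<m * n. I d)" using vk by (auto simp: I_def)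
  qed
  define tup where "tup = (\<lambda>p :: nat \<Rightarrow> nat. \<lambda>i\<in>{..<n}. b (p i) i)"
  have tupW: "tup p \<in> W" for p using bU by (auto simp: tup_def)
  have R_tup: "tup p \<in> g (D i j) \<longleftrightarrow> R i j (b (p i) i) (b (p j) j)" if "i < n" "j < n" for p i j
  proof
    assume "tup p \<in> g (D i j)"
    then show "R i j (b (p i) i) (b (p j) j)"
      unfolding R_def by (rule bexI[rotated]) (use that in \<open>simp add: tup_def\<close>)
  next
    assume "R i j (b (p i) i) (b (p j) j)"
    then show "tup p \<in> g (D i j)" by (rule R_D[OF _ that tupW]) (use that in \<open>auto simp: tup_def\<close>)
  qed
  have invQ: "tup p \<in> g (Q i C) \<longleftrightarrow> tup p' \<in> g (Q i C)"
    if "i < n" "\<And>j. j < n \<Longrightarrow> j \<noteq> i \<Longrightarrow> p j = p' j" for p p' i C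
    using closed_invariant1[OF closed_Q that(1) _ tupW, of "tup p" C p']
      closed_invariant1[OF closed_Q that(1) _ tupW, of "tup p'" C p] that(2) by (auto simp: tup_def)
  have QQ: "tup p \<in> g (Q i C) \<longleftrightarrow> tup p \<in> g (Q j C)" if "i < n" "j < n" "i \<noteq> j" "p i = p j" for p i j C
  proof -
    have "tup p \<in> g (D i j)" using R_tup[OF that(1,2)] same[OF that(1-3)] that(4) by simp
    moreover have "g (D i j) \<inter> g (Q i C) = g (D i j) \<inter> g (Q j C)"
      using g_Int[OF DA QA, of i j i C] g_Int[OF DA QA, of i j j C] D_Int_Q[OF that(1-3), of C] by simp
    ultimately show ?thesis by blast
  qed
  \<comment> \<open>\<open>\<tau> q j\<close> repeats the entry \<open>q j\<close> at the positions \<open>j\<close> and \<open>j + 1\<close>. Lowering \<open>j\<close> step by step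
    carries the colour of the face \<open>q\<close> from the last coordinate to any other.\<close>
  define \<tau> where "\<tau> = (\<lambda>(q :: nat \<Rightarrow> nat) j. tup (\<lambda>k. if k \<le> j then q k else q (k - 1)))"
  \<comment> \<open>Going from \<open>\<tau> q j\<close> to \<open>\<tau> q (Suc j)\<close> changes
    only the entry \<open>Suc j\<close>, which the face \<open>Suc j\<close> omits. Afterwards the
    entries \<open>Suc j\<close> and \<open>Suc (Suc j)\<close> agree, so their faces
    coincide.\<close>
  have shift: "\<tau> q j \<in> g (Q (Suc j) C) \<longleftrightarrow> \<tau> q (n - 2) \<in> g (Q (n - 1) C)" if "j \<le> n - 2" for q j C
    using that
  proof (induction rule: inc_induct)
    case base
    have "Suc (n - 2) = n - 1" using n3 by simp
    then show ?case by simp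
  next
    case (step j)
    have "\<tau> q j \<in> g (Q (Suc j) C) \<longleftrightarrow> \<tau> q (Suc j) \<in> g (Q (Suc j) C)"
      unfolding \<tau>_def by (rule invQ) (use step in \<open>auto simp: le_Suc_eq\<close>)
    also have "\<dots> \<longleftrightarrow> \<tau> q (Suc j) \<in> g (Q (Suc (Suc j)) C)"
      unfolding \<tau>_def by (rule QQ) (use step in auto)
    finally show ?case using step.IH by simp
  qed
  \<comment> \<open>The entries before the last position are distinct, so the tuple avoids the
    images of all \<open>D a b\<close> there. What remains is the set of atoms with a coloured last
    face, a finite union over the classes.\<close>
  have face_class: "\<exists>d<m * n. \<tau> q (n - 2) \<in> g (Q (n - 1) (I d))" if q: "inj_on q {..<n - 1}" for q
  proof -
    define B where "B = {(a, b). a < b \<and> b < n - 1}"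
    have "finite B" by (rule finite_subset[of _ "{..<n} \<times> {..<n}"]) (auto simp: B_def)
    have "A \<subseteq> Q (n - 1) (V \<times> {..<n}) \<union> (\<Union>(a, b)\<in>B. D a b)"
    proof
      fix s assume "s \<in> A"
      show "s \<in> Q (n - 1) (V \<times> {..<n}) \<union> (\<Union>(a, b)\<in>B. D a b)"
      proof (cases "\<exists>(a, b)\<in>B. s \<in> D a b")
        case False
        then have "s \<in> Q (n - 1) (V \<times> {..<n})"
          using n3 \<open>s \<in> A\<close> by (intro Q_UNIV) (auto simp: B_def)
        then show ?thesis by blast
      qed blast
    qed
    moreover have "Q (n - 1) (V \<times> {..<n}) \<subseteq> (\<Union>d<m * n. Q (n - 1) (I d))"
    proof
      fix s assume "s \<in> Q (n - 1) (V \<times> {..<n})"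
      then obtain \<gamma> where "s \<in> A" "\<gamma> \<in> V \<times> {..<n}" "hue s (n - 1) = Some \<gamma>" unfolding Q_def by blast
      moreover from this obtain d where "d < m * n" "\<gamma> \<in> I d" using IV by blast
      ultimately show "s \<in> (\<Union>d<m * n. Q (n - 1) (I d))" unfolding Q_def by blast
    qed
    ultimately have sub: "A \<subseteq> (\<Union>d<m * n. Q (n - 1) (I d)) \<union> (\<Union>p\<in>B. D (fst p) (snd p))"
      by (fastforce simp: case_prod_beta)
    have U1: "(\<Union>d<m * n. Q (n - 1) (I d)) \<subseteq> A" "(\<Union>p\<in>B. D (fst p) (snd p)) \<subseteq> A" using QA DA by blast+
    have "W \<subseteq> g ((\<Union>d<m * n. Q (n - 1) (I d)) \<union> (\<Union>p\<in>B. D (fst p) (snd p)))"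
      using g_mono[OF sub] U1 g_A by simp
    also have "\<dots> = (\<Union>d<m * n. g (Q (n - 1) (I d))) \<union> (\<Union>p\<in>B. g (D (fst p) (snd p)))"
      using g_Un[OF U1] g_UN[of "{..<m * n}" "\<lambda>d. Q (n - 1) (I d)"]
        g_UN[OF \<open>finite B\<close>, of "\<lambda>p. D (fst p) (snd p)"] QA DA by simp
    finally have "\<tau> q (n - 2) \<in> (\<Union>d<m * n. g (Q (n - 1) (I d))) \<union> (\<Union>p\<in>B. g (D (fst p) (snd p)))"
      using tupW unfolding \<tau>_def by blast
    moreover have "\<tau> q (n - 2) \<notin> g (D a b)" if "(a, b) \<in> B" for a b
    proof -
      have ab: "a < b" "b < n - 1" using that by (auto simp: B_def)
      then have "q a \<noteq> q b" using q by (auto simp: inj_on_def)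
      then show ?thesis unfolding \<tau>_def using ab diff[of "q a" "q b" a b] by (subst R_tup) auto
    qed
    ultimately show ?thesis by auto
  qed
  \<comment> \<open>The class might depend on the order of the points, so a set gets the class of
    its increasing enumeration.\<close>
  define f where "f = (\<lambda>X. SOME d. d < m * n \<and> \<tau> (\<lambda>k. sorted_list_of_set X ! k) (n - 2) \<in> g (Q (n - 1) (I d)))"
  have f: "f X < m * n \<and> \<tau> (\<lambda>k. sorted_list_of_set X ! k) (n - 2) \<in> g (Q (n - 1) (I (f X)))"
    if "finite X" "card X = n - 1" for X
    unfolding f_def
  proof (rule someI_ex)
    have "inj_on (\<lambda>k. sorted_list_of_set X ! k) {..<n - 1}"
      using that by (auto simp: inj_on_def nth_eq_iff_index_eq)
    from face_class[OF this] show "\<exists>d<m * n. \<tau> (\<lambda>k. sorted_list_of_set X ! k) (n - 2) \<in> g (Q (n - 1) (I d))" .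
  qed
  obtain Y d where Y: "infinite Y" "\<And>X. X \<subseteq> Y \<Longrightarrow> finite X \<Longrightarrow> card X = n - 1 \<Longrightarrow> f X = d"
  proof -
    have "\<forall>X. X \<subseteq> (UNIV :: nat set) \<and> finite X \<and> card X = n - 1 \<longrightarrow> f X < m * n" using f by simp
    from Ramsey[OF infinite_UNIV_nat this] show ?thesis using that by auto
  qed
  define p where "p = enumerate Y"
  have p: "strict_mono p" "\<And>k. p k \<in> Y"
    unfolding p_def using Y(1) by (auto simp: strict_mono_enumerate enumerate_in_set)
  have inQ: "\<tau> q (n - 2) \<in> g (Q (n - 1) (I d))"
    if q: "strict_mono q" "range q \<subseteq> Y" for q :: "nat \<Rightarrow> nat"
  proof -
    define X where "X = q ` {..<n - 1}"
    have "inj q" using q(1) by (simp add: strict_mono_imp_inj_on)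
    then have cX: "finite X" "card X = n - 1" "X \<subseteq> Y"
      using q(2) inj_on_subset[of q UNIV] by (auto simp: X_def card_image)
    have "sorted_list_of_set X = map q [0..<n - 1]"
      using sorted_list_of_set_strict_mono[OF q(1), of 0 "n - 1"] by (simp add: X_def atLeast0LessThan)
    then have "tup (\<lambda>k. if k \<le> n - 2 then sorted_list_of_set X ! k else sorted_list_of_set X ! (k - 1)) =
        tup (\<lambda>k. if k \<le> n - 2 then q k else q (k - 1))"
      using n3 unfolding tup_def by (intro restrict_ext) auto
    then show ?thesis using f[OF cX(1,2)] Y(2)[OF cX(3,1,2)] unfolding \<tau>_def by simp
  qed
  have "tup p \<in> g (Q i (I d))" if i: "i < n" for i
  proof -
    \<comment> \<open>\<open>q\<close> is \<open>p\<close> with the entry \<open>i\<close> skipped.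
      Then \<open>tup p\<close> and \<open>\<tau> q i\<close> differ only at the coordinate
      \<open>i\<close>, so they have the same face there.\<close>
    define q where "q = (\<lambda>k. if k < i then p k else p (Suc k))"
    have "strict_mono q" by (rule strict_monoI) (auto simp: q_def strict_mono_less[OF p(1)])
    moreover have "range q \<subseteq> Y" using p(2) by (auto simp: q_def)
    ultimately have *: "\<tau> q (n - 2) \<in> g (Q (n - 1) (I d))" using inQ by blast
    show ?thesis
    proof (cases "i = n - 1")
      case True
      have "\<tau> q (n - 2) \<in> g (Q i (I d)) \<longleftrightarrow> tup p \<in> g (Q i (I d))"
        unfolding \<tau>_def by (rule invQ[OF i]) (use True in \<open>auto simp: q_def\<close>)
      then show ?thesis using * True by simp
    next
      case False
      then have i2: "i \<le> n - 2" using i by simp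
      have "tup p \<in> g (Q i (I d)) \<longleftrightarrow> \<tau> q i \<in> g (Q i (I d))"
        unfolding \<tau>_def by (rule invQ[OF i]) (auto simp: q_def)
      also have "\<dots> \<longleftrightarrow> \<tau> q i \<in> g (Q (Suc i) (I d))"
        unfolding \<tau>_def by (rule QQ) (use i False in auto)
      finally show ?thesis using * shift[OF i2] by simp
    qed
  qed
  moreover have "tup p \<in> (\<Union>i<n. g (A - Q i (I d)))"
  proof -
    have "(\<Union>i<n. A - Q i (I d)) = A" using Q_independent[of "I d"] ind by blast
    moreover have "g (\<Union>i<n. A - Q i (I d)) = (\<Union>i<n. g (A - Q i (I d)))" by (rule g_UN) auto
    ultimately have "g A = (\<Union>i<n. g (A - Q i (I d)))" by (simp only:)
    then show ?thesis using tupW[of p] unfolding g_A by blast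
  qed
  ultimately show False using g_Diff[OF QA] by blast
qed

end

section \<open>Shift graphs\<close>

definition shift_vertices :: "nat \<Rightarrow> nat list set" where
  "shift_vertices k = {xs. length xs = k \<and> sorted_wrt (<) xs}"

definition shift_adj :: "nat list \<Rightarrow> nat list \<Rightarrow> bool" where
  "shift_adj xs ys \<longleftrightarrow> tl xs = butlast ys \<or> tl ys = butlast xs"

definition walk :: "('v \<Rightarrow> 'v \<Rightarrow> bool) \<Rightarrow> 'v set \<Rightarrow> ('v \<times> 'v) set" where
  "walk adj V = {(x, y). x \<in> V \<and> y \<in> V \<and> adj x y}"

lemma map_shift_vertices: "strict_mono q \<Longrightarrow> map q [a..<a + k] \<in> shift_vertices k"
  by (auto simp: shift_vertices_def sorted_wrt_map strict_mono_less sorted_wrt_iff_nth_less)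

text \<open>Colour each set of \<open>k\<close> numbers by an independent set containing its
  increasing list. On an infinite homogeneous set two consecutive windows of length \<open>k\<close>
  fall into the same independent set, yet they are adjacent.\<close>

lemma infinite_chromatic_shift:
  assumes "k \<ge> 1"
  shows "infinite_chromatic shift_adj (shift_vertices k)"
  unfolding infinite_chromatic_def
proof (intro allI impI notI)
  fix \<I> assume \<I>: "finite \<I> \<and> (\<forall>I\<in>\<I>. \<forall>x\<in>I. \<forall>y\<in>I. \<not> shift_adj x y)"
    and cover: "shift_vertices k \<subseteq> \<Union>\<I>"
  obtain m :: nat and I where I: "\<I> = I ` {i. i < m}"
    using \<I> finite_imp_nat_seg_image_inj_on[of \<I>] by auto
  define f where "f = (\<lambda>X. SOME i. i < m \<and> sorted_list_of_set X \<in> I i)"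
  have f: "f X < m \<and> sorted_list_of_set X \<in> I (f X)" if "finite X" "card X = k" for X
    unfolding f_def
  proof (rule someI_ex)
    have "sorted_list_of_set X \<in> shift_vertices k"
      using that by (simp add: shift_vertices_def)
    then have "sorted_list_of_set X \<in> \<Union>\<I>" using cover by blast
    then show "\<exists>i<m. sorted_list_of_set X \<in> I i" unfolding I by blast
  qed
  obtain Y d where Y: "infinite Y" "\<And>X. X \<subseteq> Y \<Longrightarrow> finite X \<Longrightarrow> card X = k \<Longrightarrow> f X = d"
  proof -
    have "\<forall>X. X \<subseteq> (UNIV :: nat set) \<and> finite X \<and> card X = k \<longrightarrow> f X < m" using f by simp
    from Ramsey[OF infinite_UNIV_nat this] show ?thesis using that by auto
  qed
  define p where "p = enumerate Y"
  have p: "strict_mono p" "\<And>k. p k \<in> Y"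
    unfolding p_def using Y(1) by (auto simp: strict_mono_enumerate enumerate_in_set)
  have *: "map p [a..<a + k] \<in> I d" "d < m" for a
  proof -
    have "inj_on p {a..<a + k}" using strict_mono_imp_inj_on[OF p(1)] by (rule inj_on_subset) auto
    then have "card (p ` {a..<a + k}) = k" by (simp add: card_image)
    moreover have "p ` {a..<a + k} \<subseteq> Y" using p(2) by auto
    ultimately have "f (p ` {a..<a + k}) = d" using Y(2) by simp
    then show "map p [a..<a + k] \<in> I d" "d < m"
      using f[of "p ` {a..<a + k}"] \<open>card _ = k\<close> sorted_list_of_set_strict_mono[OF p(1), of a "a + k"] by auto
  qed
  have "I d \<in> \<I>" using *(2) unfolding I by blast
  moreover have "shift_adj (map p [0..<0 + k]) (map p [1..<1 + k])"
    using assms by (simp add: shift_adj_def map_tl map_butlast flip: map_tl map_butlast)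
  ultimately show False using *(1)[of 0] *(1)[of 1] \<I> by blast
qed

text \<open>Each step moves the entries by one position in either direction and loses control of one
  entry at each end. The middle part after \<open>m\<close> steps is thus a translate by some
  \<open>d\<close> of the parity of \<open>m\<close>.\<close>

lemma shift_walk:
  assumes "(xs, zs) \<in> walk shift_adj (shift_vertices k) ^^ m"
  shows "\<exists>d. \<bar>d\<bar> \<le> int m \<and> (odd d \<longleftrightarrow> odd m) \<and>
    (\<forall>i. m \<le> i \<longrightarrow> i + m < k \<longrightarrow> zs ! i = xs ! nat (int i + d))"
  using assms
proof (induction m arbitrary: zs)
  case 0
  then show ?case by (intro exI[of _ 0]) simp
next
  case (Suc m)
  then obtain ys where ys: "(xs, ys) \<in> walk shift_adj (shift_vertices k) ^^ m"
    "(ys, zs) \<in> walk shift_adj (shift_vertices k)" by auto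
  then obtain d where d: "\<bar>d\<bar> \<le> int m" "odd d \<longleftrightarrow> odd m"
    "\<And>i. m \<le> i \<Longrightarrow> i + m < k \<Longrightarrow> ys ! i = xs ! nat (int i + d)" using Suc.IH by blast
  have len: "length ys = k" "length zs = k" and adj: "tl ys = butlast zs \<or> tl zs = butlast ys"
    using ys(2) by (auto simp: walk_def shift_vertices_def shift_adj_def)
  from adj show ?case
  proof
    assume eq: "tl ys = butlast zs"
    have "zs ! i = xs ! nat (int i + (d + 1))" if i: "Suc m \<le> i" "i + Suc m < k" for i
    proof -
      have "zs ! i = butlast zs ! i" using i len by (simp add: nth_butlast)
      also have "\<dots> = ys ! Suc i" using i len by (simp add: nth_tl flip: eq)
      also have "\<dots> = xs ! nat (int (Suc i) + d)" using i by (intro d(3)) auto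
      finally show ?thesis by (simp add: algebra_simps)
    qed
    then show ?thesis using d(1,2) by (intro exI[of _ "d + 1"]) auto
  next
    assume eq: "tl zs = butlast ys"
    have "zs ! i = xs ! nat (int i + (d - 1))" if i: "Suc m \<le> i" "i + Suc m < k" for i
    proof -
      have "zs ! i = tl zs ! (i - 1)" using i len by (simp add: nth_tl)
      also have "\<dots> = ys ! (i - 1)" using i len by (simp add: nth_butlast eq)
      also have "\<dots> = xs ! nat (int (i - 1) + d)" using i by (intro d(3)) auto
      also have "int (i - 1) + d = int i + (d - 1)" using i by simp
      finally show ?thesis .
    qed
    then show ?thesis using d(1,2) by (intro exI[of _ "d - 1"]) auto
  qed
qed

text \<open>The entries at \<open>m\<close> and \<open>m + d\<close> agree, and both positions are
  at most \<open>2 * m < k\<close>. As the entries are distinct, \<open>d = 0\<close>, which has the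
  wrong parity.\<close>

lemma shift_no_odd_closed_walk:
  assumes "odd m" "2 * m < k"
  shows "(xs, xs) \<notin> walk shift_adj (shift_vertices k) ^^ m"
proof
  assume w: "(xs, xs) \<in> walk shift_adj (shift_vertices k) ^^ m"
  obtain d where d: "\<bar>d\<bar> \<le> int m" "odd d \<longleftrightarrow> odd m"
    "\<And>i. m \<le> i \<Longrightarrow> i + m < k \<Longrightarrow> xs ! i = xs ! nat (int i + d)" using shift_walk[OF w] by blast
  have "m \<noteq> 0" using assms(1) by (metis even_zero)
  then obtain m' where "m = Suc m'" using not0_implies_Suc by blast
  then have "xs \<in> shift_vertices k" using w by (auto simp: walk_def)
  then have xs: "length xs = k" "distinct xs"
    by (auto simp: shift_vertices_def strict_sorted_iff)
  have "xs ! m = xs ! nat (int m + d)" using assms(2) by (intro d(3)) auto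
  moreover have "nat (int m + d) < k" "m < k" using d(1) assms(2) by auto
  ultimately have "m = nat (int m + d)" using xs by (simp add: nth_eq_iff_index_eq)
  then have "d = 0" using d(1) by linarith
  then show False using d(2) assms(1) by simp
qed

text \<open>The colour is the parity of a walk from a root of the component. Adjacent vertices are
  reachable from the same vertices, so they get the same root. Even walks to both would close up
  with the edge to an odd walk, while an odd walk to one extends by the edge to an even walk to the
  other.\<close>

lemma two_colouring:
  assumes sym: "\<And>x y. adj x y \<Longrightarrow> adj y x"
    and odd: "\<And>m x. odd m \<Longrightarrow> (x, x) \<notin> walk adj V ^^ m"
  obtains c :: "'v \<Rightarrow> nat" where "\<And>v. c v < 2" "\<And>u v. u \<in> V \<Longrightarrow> v \<in> V \<Longrightarrow> adj u v \<Longrightarrow> c u \<noteq> c v"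
proof -
  let ?E = "walk adj V"
  have symE: "sym ?E" using sym by (auto simp: walk_def sym_def)
  have sym_pow: "(y, x) \<in> ?E ^^ m" if "(x, y) \<in> ?E ^^ m" for x y m
    using that
  proof (induction m arbitrary: y)
    case (Suc m)
    then obtain z where "(x, z) \<in> ?E ^^ m" "(z, y) \<in> ?E" by auto
    then have "(y, z) \<in> ?E" "(z, x) \<in> ?E ^^ m" using Suc.IH symE by (auto dest: symD)
    then show ?case by (rule relpow_Suc_I2)
  qed simp
  define r where "r = (\<lambda>v. SOME w. (w, v) \<in> ?E\<^sup>*)"
  have r: "(r v, v) \<in> ?E\<^sup>*" for v unfolding r_def by (rule someI[of _ v]) simp
  define c :: "'v \<Rightarrow> nat" where "c = (\<lambda>v. if \<exists>k. even k \<and> (r v, v) \<in> ?E ^^ k then 0 else 1)"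
  have "c u \<noteq> c v" if uv: "u \<in> V" "v \<in> V" "adj u v" for u v
  proof
    assume eq: "c u = c v"
    have e: "(u, v) \<in> ?E" "(v, u) \<in> ?E" using uv sym by (auto simp: walk_def)
    have "(w, u) \<in> ?E\<^sup>* \<longleftrightarrow> (w, v) \<in> ?E\<^sup>*" for w using e by (meson rtrancl.rtrancl_into_rtrancl)
    then have ruv: "r u = r v" by (simp add: r_def)
    show False
    proof (cases "c u = 0")
      case True
      then obtain k l where kl: "even k" "(r u, u) \<in> ?E ^^ k" "even l" "(r u, v) \<in> ?E ^^ l"
        using eq ruv unfolding c_def by (metis zero_neq_one)
      have "(r u, v) \<in> ?E ^^ Suc k" using kl(2) e(1) by (rule relpow_Suc_I)
      then have "(r u, r u) \<in> ?E ^^ (Suc k + l)" using sym_pow[OF kl(4)] by (auto simp only: relpow_add)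
      then show False using odd[of "Suc k + l"] kl by auto
    next
      case False
      obtain k where k: "(r u, u) \<in> ?E ^^ k" using r[of u] by (auto dest: rtrancl_imp_relpow)
      have "odd k" using False k unfolding c_def by metis
      moreover have "(r v, v) \<in> ?E ^^ Suc k" using relpow_Suc_I[OF k e(1)] ruv by simp
      ultimately have "c v = 0" unfolding c_def by (metis even_Suc)
      then show False using eq False by simp
    qed
  qed
  moreover have "c v < 2" for v by (simp add: c_def)
  ultimately show ?thesis using that by blast
qed

section \<open>Ultraproducts of the atom structures\<close>

text \<open>\<open>S\<close> plays the ultraproduct without being a quotient, with
  \<open>p k\<close> as projection to the factor \<open>k\<close>. By \<open>lift\<close>, a family
  of elements agrees almost everywhere with the projections of a single element; the existential
  case needs this for witnesses chosen coordinatewise.\<close>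

lemma los:
  assumes D: "ultra D"
    and eq: "\<And>a b. a \<in> univ S \<Longrightarrow> b \<in> univ S \<Longrightarrow> a = b \<longleftrightarrow> {k. p k a = p k b} \<in> D"
    and mem: "\<And>a. a \<in> univ S \<Longrightarrow> {k. p k a \<in> univ (F k)} \<in> D"
    and lift: "\<And>a. {k. a k \<in> univ (F k)} \<in> D \<Longrightarrow> \<exists>s\<in>univ S. {k. p k s = a k} \<in> D"
    and rel: "\<And>f as. f \<in> L_plus L \<Longrightarrow> length as = Suc (arity f) \<Longrightarrow> set as \<subseteq> univ S \<Longrightarrow>
      as \<in> rel S f \<longleftrightarrow> {k. map (p k) as \<in> rel (F k) f} \<in> D"
    and "formula_of L \<phi>" "range e \<subseteq> univ S"
  shows "sat S e \<phi> \<longleftrightarrow> {k. sat (F k) (\<lambda>v. p k (e v)) \<phi>} \<in> D"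
  using assms(6,7)
proof (induction \<phi> arbitrary: e)
  case (Eql u v)
  then show ?case using eq[of "e u" "e v"] by (auto simp: image_subset_iff)
next
  case (Atm f vs)
  have "set (map e vs) \<subseteq> univ S" using Atm.prems by auto
  then show ?case using rel[of f "map e vs"] Atm.prems by (simp add: comp_def)
next
  case (Neg \<phi>)
  then show ?case using ultra_Collect_not[OF D] by simp
next
  case (Conj \<phi> \<psi>)
  then show ?case using ultra_Collect_conj[OF D] by simp
next
  case (Exi v \<phi>)
  have IH: "sat S (e(v := a)) \<phi> \<longleftrightarrow> {k. sat (F k) ((\<lambda>u. p k (e u))(v := p k a)) \<phi>} \<in> D"
    if "a \<in> univ S" for a
  proof -
    have "formula_of L \<phi>" "range (e(v := a)) \<subseteq> univ S" using Exi.prems that by auto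
    note IH = Exi.IH[OF this]
    have "(\<lambda>u. p k ((e(v := a)) u)) = (\<lambda>u. p k (e u))(v := p k a)" for k by (rule ext) simp
    with IH show ?thesis by (simp only:)
  qed
  show ?case
  proof
    assume "sat S e (Exi v \<phi>)"
    then obtain a where a: "a \<in> univ S" "{k. sat (F k) ((\<lambda>u. p k (e u))(v := p k a)) \<phi>} \<in> D"
      using IH by auto
    from ultra_Int[OF D mem[OF a(1)] a(2)]
    show "{k. sat (F k) (\<lambda>v. p k (e v)) (Exi v \<phi>)} \<in> D" by (rule ultra_mono[OF D]) auto
  next
    assume *: "{k. sat (F k) (\<lambda>v. p k (e v)) (Exi v \<phi>)} \<in> D"
    define a where "a = (\<lambda>k. SOME a. a \<in> univ (F k) \<and> sat (F k) ((\<lambda>u. p k (e u))(v := a)) \<phi>)"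
    have a: "a k \<in> univ (F k) \<and> sat (F k) ((\<lambda>u. p k (e u))(v := a k)) \<phi>"
      if "sat (F k) (\<lambda>v. p k (e v)) (Exi v \<phi>)" for k
      unfolding a_def by (rule someI_ex) (use that in auto)
    have "{k. a k \<in> univ (F k)} \<in> D" by (rule ultra_mono[OF D *]) (use a in blast)
    from lift[OF this] obtain s where s: "s \<in> univ S" "{k. p k s = a k} \<in> D" by blast
    from ultra_Int[OF D * s(2)] have "{k. sat (F k) ((\<lambda>u. p k (e u))(v := p k s)) \<phi>} \<in> D"
    proof (rule ultra_mono[OF D], intro subsetI CollectI)
      fix k assume "k \<in> {k. sat (F k) (\<lambda>v. p k (e v)) (Exi v \<phi>)} \<inter> {k. p k s = a k}"
      then show "sat (F k) ((\<lambda>u. p k (e u))(v := p k s)) \<phi>" using a[of k] by simp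
    qed
    then show "sat S e (Exi v \<phi>)" using IH[OF s(1)] s(1) by auto
  qed
qed

lemma keq_map_atom [simp]: "keq (map_atom g s) = keq s"
  by (cases s) simp

lemma hue_map_atom: "hue (map_atom g s) i = map_option (map_prod g id) (hue s i)"
  by (cases s) (simp add: id_def)

lemma map_atom_atom: "map_atom g (atom n t \<kappa>) = atom n t (\<lambda>H. map_prod g id (\<kappa> H))"
  by (rule atom.expand) (auto simp: hue_map_atom hue_atom fun_eq_iff atom_def)

lemma map_atom_sub_atom: "map_atom g (sub_atom n \<sigma> s) = sub_atom n \<sigma> (map_atom g s)"
  by (rule atom.expand) (auto simp: hue_map_atom fun_eq_iff sub_atom_def)

lemma rel_atom_struc:
  "[a, b] \<in> rel (atom_struc n adj V) (Cyl i) \<longleftrightarrow>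
    b \<in> atoms n adj V \<and> a \<in> atoms n adj V \<and> cyl_eq n i b a"
  "[a] \<in> rel (atom_struc n adj V) (Diag i j) \<longleftrightarrow> a \<in> atoms n adj V \<and> (i, j) \<in> keq a"
  "[a, b] \<in> rel (atom_struc n adj V) (Subst \<sigma>) \<longleftrightarrow>
    b \<in> atoms n adj V \<and> a \<in> atoms n adj V \<and> a = sub_atom n \<sigma> b"
  by (auto simp: atom_struc_def)

section \<open>The ultraproduct of a sequence of graphs and the atom structure over it\<close>

locale ultraproduct =
  fixes n :: nat and D :: "nat set set" and Vs :: "nat \<Rightarrow> 'v set" and adjs :: "nat \<Rightarrow> 'v \<Rightarrow> 'v \<Rightarrow> bool"
  assumes n3: "n \<ge> 3" and D: "ultra D" and Vs: "\<And>k. Vs k \<noteq> {}"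
begin

text \<open>Choosing a representative in each class modulo \<open>D\<close> avoids the passage to a quotient.\<close>

definition repr :: "(nat \<Rightarrow> 'v) \<Rightarrow> nat \<Rightarrow> 'v" where
  "repr f = (SOME g. (\<forall>k. g k \<in> Vs k) \<and> {k. g k = f k} \<in> D)"

definition uV :: "(nat \<Rightarrow> 'v) set" where
  "uV = {f. (\<forall>k. f k \<in> Vs k) \<and> repr f = f}"

definition uadj :: "(nat \<Rightarrow> 'v) \<Rightarrow> (nat \<Rightarrow> 'v) \<Rightarrow> bool" where
  "uadj f g \<longleftrightarrow> {k. adjs k (f k) (g k)} \<in> D"

lemma repr_cong:
  assumes "{k. f k = g k} \<in> D"
  shows "repr f = repr g"
proof -
  have "{k. h k = f k} \<in> D \<longleftrightarrow> {k. h k = g k} \<in> D" for h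
    by (rule ultra_Collect_cong[OF D], rule ultra_mono[OF D assms]) auto
  then show ?thesis by (simp add: repr_def)
qed

lemma repr:
  assumes "\<And>k. f k \<in> Vs k"
  shows "repr f \<in> uV" "{k. repr f k = f k} \<in> D"
proof -
  have "(\<forall>k. repr f k \<in> Vs k) \<and> {k. repr f k = f k} \<in> D"
    unfolding repr_def by (rule someI[of _ f]) (use assms ultra_UNIV[OF D] in simp)
  then show "{k. repr f k = f k} \<in> D" "repr f \<in> uV" using repr_cong by (auto simp: uV_def)
qed

lemma uV_eq: "f \<in> uV \<Longrightarrow> g \<in> uV \<Longrightarrow> {k. f k = g k} \<in> D \<Longrightarrow> f = g"
  using repr_cong[of f g] by (simp add: uV_def)

abbreviation "uA \<equiv> atoms n uadj uV"
abbreviation "As k \<equiv> atoms n (adjs k) (Vs k)"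
abbreviation "coord k \<equiv> map_atom (\<lambda>f. f k)"

text \<open>Weaker than being an atom, but enough to test equality coordinatewise. It is preserved
  by \<open>sub_atom\<close>, so equations with \<open>sub_atom\<close> can be evaluated without
  first showing that its value is an atom.\<close>

definition standard :: "(nat \<Rightarrow> 'v) atom \<Rightarrow> bool" where
  "standard s \<longleftrightarrow> (\<forall>i f l. hue s i = Some (f, l) \<longrightarrow> f \<in> uV)"

lemma standard_atoms: "s \<in> uA \<Longrightarrow> standard s"
  unfolding standard_def atoms_def by blast

lemma standard_sub_atom: "standard s \<Longrightarrow> standard (sub_atom n \<sigma> s)"
  unfolding standard_def sub_atom_def by (auto split: if_splits)

lemma ultra_const: "{k. P} \<in> D \<longleftrightarrow> P"
  using D ultra_UNIV[OF D] by (cases P) (auto simp: ultra_def)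

text \<open>Whether a hue is defined, and its copy, do not vary with the coordinate. Only the vertex
  does, and representatives that agree almost everywhere are equal.\<close>

lemma hue_eq_iff:
  assumes "standard a" "standard b"
  shows "hue a i = hue b i \<longleftrightarrow> {k. hue (coord k a) i = hue (coord k b) i} \<in> D"
proof
  assume "hue a i = hue b i"
  then show "{k. hue (coord k a) i = hue (coord k b) i} \<in> D" using ultra_UNIV[OF D] by (simp add: hue_map_atom)
next
  assume *: "{k. hue (coord k a) i = hue (coord k b) i} \<in> D"
  then obtain k0 where k0: "hue (coord k0 a) i = hue (coord k0 b) i" using ultra_nonempty[OF D *] by blast
  show "hue a i = hue b i"
  proof (cases "hue a i")
    case None
    then show ?thesis using k0 by (simp add: hue_map_atom)
  next
    case (Some x)
    then obtain f l where a: "hue a i = Some (f, l)" by (cases x) auto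
    then obtain y where "hue b i = Some y" using k0 by (cases "hue b i") (auto simp: hue_map_atom)
    then obtain g l' where b: "hue b i = Some (g, l')" by (cases y) auto
    have l: "l = l'" using k0 a b by (simp add: hue_map_atom)
    have "{k. f k = g k} \<in> D" by (rule ultra_mono[OF D *]) (auto simp: hue_map_atom a b)
    moreover have "f \<in> uV" "g \<in> uV" using assms a b unfolding standard_def by blast+
    ultimately have "f = g" by (intro uV_eq)
    then show ?thesis using a b l by simp
  qed
qed

lemma at_eq_iff:
  assumes "standard a" "standard b"
  shows "a = b \<longleftrightarrow> {k. coord k a = coord k b} \<in> D"
proof
  assume "a = b"
  then show "{k. coord k a = coord k b} \<in> D" using ultra_UNIV[OF D] by simp
next
  assume *: "{k. coord k a = coord k b} \<in> D"
  obtain k0 where "coord k0 a = coord k0 b" using ultra_nonempty[OF D *] by blast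
  then have "keq a = keq b" by (metis keq_map_atom)
  moreover have "hue a i = hue b i" for i
    unfolding hue_eq_iff[OF assms] by (rule ultra_mono[OF D *]) auto
  ultimately show "a = b" by (intro atom.expand) auto
qed

lemma cadj_iff:
  "cadj uadj c d \<longleftrightarrow> {k. cadj (adjs k) (map_prod (\<lambda>f. f k) id c) (map_prod (\<lambda>f. f k) id d)} \<in> D"
proof (cases "snd c = snd d")
  case True
  then show ?thesis by (simp add: cadj_def uadj_def)
next
  case False
  then show ?thesis using ultra_UNIV[OF D] by (simp add: cadj_def)
qed

lemma at_mem:
  assumes "s \<in> uA"
  shows "{k. coord k s \<in> As k} \<in> D"
proof -
  obtain t :: "nat \<Rightarrow> nat" and \<kappa> where s: "s = atom n t \<kappa>" using assms by (auto simp: atoms_def)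
  have col: "c \<in> uV \<times> {..<n}" if "hue s i = Some c" for i c using assms that unfolding atoms_def by blast
  have 2: "c \<in> Vs k \<times> {..<n}" if c: "hue (coord k s) i = Some c" for k i c
  proof -
    obtain d where "hue s i = Some d" "c = map_prod (\<lambda>f. f k) id d" using c by (auto simp: hue_map_atom)
    then show ?thesis using col[of i d] by (auto simp: uV_def)
  qed
  have 3: "\<exists>(t' :: nat \<Rightarrow> nat) \<kappa>'. coord k s = atom n t' \<kappa>'" for k
    unfolding s map_atom_atom by blast
  have 1: "coord k s \<in> As k" if "(\<forall>i<n. hue (coord k s) i \<noteq> None) \<longrightarrow>
      (\<exists>i<n. \<exists>j<n. cadj (adjs k) (the (hue (coord k s) i)) (the (hue (coord k s) j)))" for k
    unfolding atoms_def by (intro CollectI conjI that 3 allI impI 2)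
  show ?thesis
  proof (cases "\<forall>i<n. hue s i \<noteq> None")
    case True
    then obtain i j where ij: "i < n" "j < n" "cadj uadj (the (hue s i)) (the (hue s j))"
      using assms unfolding atoms_def by blast
    have "{k. cadj (adjs k) (map_prod (\<lambda>f. f k) id (the (hue s i))) (map_prod (\<lambda>f. f k) id (the (hue s j)))} \<in> D"
      using ij(3) cadj_iff by blast
    then show ?thesis
    proof (rule ultra_mono[OF D], intro subsetI CollectI)
      fix k assume "k \<in> {k. cadj (adjs k) (map_prod (\<lambda>f. f k) id (the (hue s i))) (map_prod (\<lambda>f. f k) id (the (hue s j)))}"
      moreover have "the (hue (coord k s) l) = map_prod (\<lambda>f. f k) id (the (hue s l))" if "l < n" for l
        using True that by (auto simp: hue_map_atom)
      ultimately show "coord k s \<in> As k" using 1 ij(1,2) by (metis (no_types, lifting) mem_Collect_eq)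
    qed
  next
    case False
    then obtain i where "i < n" "hue s i = None" by blast
    moreover from this have "hue (coord k s) i = None" for k by (simp add: hue_map_atom)
    ultimately have "coord k s \<in> As k" for k using 1[of k] by blast
    then show ?thesis using ultra_UNIV[OF D] by simp
  qed
qed

text \<open>An atom has finitely many data. On a large set of coordinates the kernel, the copies of
  the faces and the position of an adjacent pair are constant, and the vertices are combined into
  sequences. Hence the atom structure over the ultraproduct graph serves as the ultraproduct of the
  atom structures.\<close>

lemma at_lift:
  assumes B: "{k. a k \<in> As k} \<in> D"
  shows "\<exists>s\<in>uA. {k. coord k s = a k} \<in> D"
proof -
  have "{k. a k \<in> As k} \<subseteq> (\<Union>E\<in>Pow ({..<n} \<times> {..<n}). {k. a k \<in> As k \<and> keq (a k) = E})"
  proof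
    fix k assume k: "k \<in> {k. a k \<in> As k}"
    then obtain t :: "nat \<Rightarrow> nat" and \<kappa> where "a k = atom n t \<kappa>" by (auto simp: atoms_def)
    then have "keq (a k) \<in> Pow ({..<n} \<times> {..<n})" by auto
    then show "k \<in> (\<Union>E\<in>Pow ({..<n} \<times> {..<n}). {k. a k \<in> As k \<and> keq (a k) = E})" using k by blast
  qed
  then have "(\<Union>E\<in>Pow ({..<n} \<times> {..<n}). {k. a k \<in> As k \<and> keq (a k) = E}) \<in> D"
    by (rule ultra_mono[OF D B])
  then obtain E where E: "{k. a k \<in> As k \<and> keq (a k) = E} \<in> D"
    using ultra_finite_UN[OF D, of "Pow ({..<n} \<times> {..<n})"] by auto
  define B where "B = {k. a k \<in> As k \<and> keq (a k) = E}"
  obtain k0 where k0: "k0 \<in> B" using ultra_nonempty[OF D E] unfolding B_def by blast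
  then obtain t :: "nat \<Rightarrow> nat" and \<kappa>0 where t: "a k0 = atom n t \<kappa>0" by (auto simp: B_def atoms_def)
  have "\<exists>\<kappa>. a k = atom n t \<kappa> \<and> range \<kappa> \<subseteq> Vs k \<times> {..<n}" if "k \<in> B" for k
  proof (rule atom_of_kernel[of _ _ "adjs k"])
    show "a k \<in> As k" using that by (simp add: B_def)
    have "keq (a k) = keq (atom n t \<kappa>0)" using that k0 t by (simp add: B_def)
    then show "(i, j) \<in> keq (a k) \<longleftrightarrow> t i = t j" if "i < n" "j < n" for i j using that by simp
  qed (use Vs n3 in auto)
  then obtain \<kappa> where \<kappa>: "\<And>k. k \<in> B \<Longrightarrow> a k = atom n t (\<kappa> k)" "\<And>k. k \<in> B \<Longrightarrow> range (\<kappa> k) \<subseteq> Vs k \<times> {..<n}"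
    by metis
  have BD: "B \<in> D" using E by (simp add: B_def)
  have \<kappa>c: "\<kappa> k H \<in> Vs k \<times> {..<n}" if "k \<in> B" for k H using \<kappa>(2)[OF that] by blast
  have "\<exists>l<n. {k \<in> B. snd (\<kappa> k H) = l} \<in> D" for H
  proof -
    have "B \<subseteq> (\<Union>l\<in>{..<n}. {k \<in> B. snd (\<kappa> k H) = l})" using \<kappa>c[of _ H] by (force simp: mem_Times_iff)
    then have "(\<Union>l\<in>{..<n}. {k \<in> B. snd (\<kappa> k H) = l}) \<in> D" by (rule ultra_mono[OF D BD])
    from ultra_finite_UN[OF D _ this] show ?thesis by auto
  qed
  then obtain l where l: "\<And>H. l H < n" "\<And>H. {k \<in> B. snd (\<kappa> k H) = l H} \<in> D" by metis
  \<comment> \<open>Outside \<open>B\<close> nothing is known about \<open>\<kappa> k\<close>.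
    Default vertices keep the sequences \<open>F H\<close> inside \<open>Vs k\<close> at every
    \<open>k\<close>, as \<open>repr\<close> requires.\<close>
  define v where "v = (\<lambda>k. SOME x. x \<in> Vs k)"
  have v: "v k \<in> Vs k" for k unfolding v_def using Vs by (simp add: some_in_eq)
  define F where "F = (\<lambda>H k. if k \<in> B then fst (\<kappa> k H) else v k)"
  have FV: "F H k \<in> Vs k" for H k using \<kappa>c[of k H] v by (auto simp: F_def mem_Times_iff)
  define \<kappa>s where "\<kappa>s = (\<lambda>H. (repr (F H), l H))"
  have loc: "{k. k \<in> B \<and> map_prod (\<lambda>f. f k) id (\<kappa>s H) = \<kappa> k H} \<in> D" for H
  proof (rule ultra_mono[OF D ultra_Int[OF D repr(2)[OF FV] l(2)]], intro subsetI CollectI)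
    fix k assume "k \<in> {k. repr (F H) k = F H k} \<inter> {k \<in> B. snd (\<kappa> k H) = l H}"
    then show "k \<in> B \<and> map_prod (\<lambda>f. f k) id (\<kappa>s H) = \<kappa> k H" by (auto simp: \<kappa>s_def F_def prod_eq_iff)
  qed
  define s where "s = atom n t \<kappa>s"
  \<comment> \<open>The colourings are matched only at the \<open>n\<close> faces of
    \<open>t\<close>; an intersection over all sets \<open>H\<close> could leave
    \<open>D\<close>.\<close>
  define B' where "B' = B \<inter> (\<Inter>i\<in>{..<n}. {k. k \<in> B \<and> map_prod (\<lambda>f. f k) id (\<kappa>s (t ` off n i)) = \<kappa> k (t ` off n i)})"
  have B'D: "B' \<in> D" unfolding B'_def by (intro ultra_Int[OF D] BD ultra_finite_INT[OF D] loc) simp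
  have B': "k \<in> B" "\<And>i. i < n \<Longrightarrow> map_prod (\<lambda>f. f k) id (\<kappa>s (t ` off n i)) = \<kappa> k (t ` off n i)"
    if "k \<in> B'" for k using that by (auto simp: B'_def)
  have coord: "coord k s = a k" if "k \<in> B'" for k
    unfolding s_def map_atom_atom \<kappa>(1)[OF B'(1)[OF that]]
    by (rule atom_cong) (use B'(2)[OF that] in auto)
  have "s \<in> uA"
    unfolding s_def
  proof (rule atom_in_atomsI)
    show "range \<kappa>s \<subseteq> uV \<times> {..<n}" using repr(1)[OF FV] l(1) by (auto simp: \<kappa>s_def)
    assume inj: "inj_on t {..<n}"
    let ?P = "\<lambda>k ij. cadj (adjs k) (\<kappa> k (t ` off n (fst ij))) (\<kappa> k (t ` off n (snd ij)))"
    have "B' \<subseteq> (\<Union>ij\<in>{..<n} \<times> {..<n}. {k. k \<in> B' \<and> ?P k ij})"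
    proof
      fix k assume k: "k \<in> B'"
      have "a k \<in> As k" using B'(1)[OF k] by (simp add: B_def)
      then have "atom n t (\<kappa> k) \<in> As k" using \<kappa>(1)[OF B'(1)[OF k]] by simp
      from atom_in_atomsE[OF this inj] obtain i j where "i < n" "j < n"
        "cadj (adjs k) (\<kappa> k (t ` off n i)) (\<kappa> k (t ` off n j))" by blast
      then have "(i, j) \<in> {..<n} \<times> {..<n}" "?P k (i, j)" by simp_all
      then show "k \<in> (\<Union>ij\<in>{..<n} \<times> {..<n}. {k. k \<in> B' \<and> ?P k ij})" using k by blast
    qed
    then have "(\<Union>ij\<in>{..<n} \<times> {..<n}. {k. k \<in> B' \<and> ?P k ij}) \<in> D" by (rule ultra_mono[OF D B'D])
    then have "\<exists>ij\<in>{..<n} \<times> {..<n}. {k. k \<in> B' \<and> ?P k ij} \<in> D"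
      by (rule ultra_finite_UN[OF D, rotated]) simp
    then obtain ij where
      ij: "ij \<in> {..<n} \<times> {..<n}" "{k. k \<in> B' \<and> ?P k ij} \<in> D" by blast
    have ij': "fst ij < n" "snd ij < n" using ij(1) by auto
    have "cadj uadj (\<kappa>s (t ` off n (fst ij))) (\<kappa>s (t ` off n (snd ij)))"
      unfolding cadj_iff
    proof (rule ultra_mono[OF D ij(2)], intro subsetI CollectI)
      fix k assume "k \<in> {k. k \<in> B' \<and> ?P k ij}"
      then show "cadj (adjs k) (map_prod (\<lambda>f. f k) id (\<kappa>s (t ` off n (fst ij))))
          (map_prod (\<lambda>f. f k) id (\<kappa>s (t ` off n (snd ij))))"
        using B'(2)[of k, OF _ ij'(1)] B'(2)[of k, OF _ ij'(2)] by simp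
    qed
    then show "\<exists>i<n. \<exists>j<n. cadj uadj (\<kappa>s (t ` off n i)) (\<kappa>s (t ` off n j))" using ij' by blast
  qed (rule n3)
  moreover have "{k. coord k s = a k} \<in> D" by (rule ultra_mono[OF D B'D]) (use coord in auto)
  ultimately show ?thesis by blast
qed

lemma cyl_eq_iff:
  assumes "a \<in> uA" "b \<in> uA"
  shows "cyl_eq n i a b \<longleftrightarrow> {k. cyl_eq n i (coord k a) (coord k b)} \<in> D"
proof -
  have "{k. cyl_eq n i (coord k a) (coord k b)} \<in> D \<longleftrightarrow> {k. hue (coord k a) i = hue (coord k b) i} \<in> D \<and>
      {k. \<forall>x\<in>off n i. \<forall>y\<in>off n i. (x, y) \<in> keq a \<longleftrightarrow> (x, y) \<in> keq b} \<in> D"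
    unfolding cyl_eq_def keq_map_atom by (rule ultra_Collect_conj[OF D])
  then show ?thesis
    using hue_eq_iff[OF standard_atoms[OF assms(1)] standard_atoms[OF assms(2)], of i]
    unfolding ultra_const cyl_eq_def by blast
qed

lemma los_atom_struc:
  assumes "L \<subseteq> L_PEA n" "formula_of L \<phi>" "range e \<subseteq> uA"
  shows "sat (atom_struc n uadj uV) e \<phi> \<longleftrightarrow>
    {k. sat (atom_struc n (adjs k) (Vs k)) (\<lambda>v. coord k (e v)) \<phi>} \<in> D"
proof (rule los[OF D, where L = L])
  have u: "univ (atom_struc n adj V) = atoms n adj V" for adj and V :: "'x set" by (simp add: atom_struc_def)
  show "a = b \<longleftrightarrow> {k. coord k a = coord k b} \<in> D"
    if "a \<in> univ (atom_struc n uadj uV)" "b \<in> univ (atom_struc n uadj uV)" for a b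
    using that at_eq_iff standard_atoms by (simp add: u)
  show "{k. coord k a \<in> univ (atom_struc n (adjs k) (Vs k))} \<in> D" if "a \<in> univ (atom_struc n uadj uV)" for a
    using at_mem that by (simp add: u)
  show "\<exists>s\<in>univ (atom_struc n uadj uV). {k. coord k s = a k} \<in> D"
    if "{k. a k \<in> univ (atom_struc n (adjs k) (Vs k))} \<in> D" for a
    using at_lift that by (simp add: u)
  show "as \<in> rel (atom_struc n uadj uV) f \<longleftrightarrow> {k. map (coord k) as \<in> rel (atom_struc n (adjs k) (Vs k)) f} \<in> D"
    if f: "f \<in> L_plus L" "length as = Suc (arity f)" "set as \<subseteq> univ (atom_struc n uadj uV)" for f as
  proof -
    have fL: "f \<in> L_PEA n" "f \<notin> L_BA" using f(1) assms(1) by (auto simp: L_plus_def)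
    have conj3: "{k. P k \<and> Q k \<and> R k} \<in> D \<longleftrightarrow> R' " if "{k. P k} \<in> D" "{k. Q k} \<in> D" "{k. R k} \<in> D \<longleftrightarrow> R'"
      for P Q R R' using that by (simp add: ultra_Collect_conj[OF D])
    show ?thesis
    proof (cases f)
      case (Cyl i)
      then obtain a b where as: "as = [a, b]" "a \<in> uA" "b \<in> uA"
        using f(2,3) by (auto simp: length_Suc_conv u)
      have "{k. coord k b \<in> As k \<and> coord k a \<in> As k \<and> cyl_eq n i (coord k b) (coord k a)} \<in> D \<longleftrightarrow> cyl_eq n i b a"
        using cyl_eq_iff[OF as(3,2)] by (intro conj3 at_mem as) simp
      then show ?thesis using as by (simp add: Cyl atom_struc_def)
    next
      case (Diag i j)
      then obtain a where as: "as = [a]" "a \<in> uA" using f(2,3) by (auto simp: length_Suc_conv u)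
      have "{k. coord k a \<in> As k \<and> (i, j) \<in> keq a} \<in> D \<longleftrightarrow> (i, j) \<in> keq a"
        unfolding ultra_Collect_conj[OF D] ultra_const using at_mem[OF as(2)] by simp
      then show ?thesis using as by (simp add: Diag atom_struc_def)
    next
      case (Subst \<sigma>)
      then obtain a b where as: "as = [a, b]" "a \<in> uA" "b \<in> uA"
        using f(2,3) by (auto simp: length_Suc_conv u)
      have "a = sub_atom n \<sigma> b \<longleftrightarrow> {k. coord k a = coord k (sub_atom n \<sigma> b)} \<in> D"
        by (intro at_eq_iff standard_sub_atom standard_atoms as)
      then have "{k. coord k b \<in> As k \<and> coord k a \<in> As k \<and> coord k a = sub_atom n \<sigma> (coord k b)} \<in> D \<longleftrightarrow> a = sub_atom n \<sigma> b"
        by (intro conj3 at_mem as) (simp add: map_atom_sub_atom)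
      then show ?thesis by (simp only: Subst list.map rel_atom_struc simp_thms as)
    qed (use fL in \<open>auto simp: L_BA_def\<close>)
  qed
  show "range e \<subseteq> univ (atom_struc n uadj uV)" using assms(3) by (simp add: u)
qed (rule assms(2))

text \<open>A walk has finitely many steps, so it is present in almost all factors. This transfers
  the absence of odd closed walks to the ultraproduct, one length at a time.\<close>

lemma walk_at:
  assumes "(f, g) \<in> walk uadj uV ^^ m"
  shows "{k. (f k, g k) \<in> walk (adjs k) (Vs k) ^^ m} \<in> D"
  using assms
proof (induction m arbitrary: g)
  case 0
  then show ?case using ultra_UNIV[OF D] by simp
next
  case (Suc m)
  then obtain h where h: "(f, h) \<in> walk uadj uV ^^ m" "h \<in> uV" "g \<in> uV" "uadj h g" by (auto simp: walk_def)
  have "{k. (f k, h k) \<in> walk (adjs k) (Vs k) ^^ m} \<inter> {k. adjs k (h k) (g k)} \<in> D"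
    using Suc.IH[OF h(1)] h(4) D by (simp add: uadj_def ultra_Int)
  then show ?case
  proof (rule ultra_mono[OF D], intro subsetI CollectI)
    fix k assume k: "k \<in> {k. (f k, h k) \<in> walk (adjs k) (Vs k) ^^ m} \<inter> {k. adjs k (h k) (g k)}"
    have "(h k, g k) \<in> walk (adjs k) (Vs k)" using k h(2,3) by (simp add: walk_def uV_def)
    then show "(f k, g k) \<in> walk (adjs k) (Vs k) ^^ Suc m" using k by auto
  qed
qed

end

section \<open>Elementary substructures and isomorphic copies\<close>

lemma univ_atom_struc [simp]: "univ (atom_struc n adj V) = atoms n adj V"
  by (simp add: atom_struc_def)

lemma atoms_restrict:
  assumes "s \<in> atoms n adj V" "\<And>i c. hue s i = Some c \<Longrightarrow> fst c \<in> C"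
  shows "s \<in> atoms n adj C"
proof -
  have "c \<in> C \<times> {..<n}" if "hue s i = Some c" for i c
  proof -
    have "c \<in> V \<times> {..<n}" using assms(1) that unfolding atoms_def by blast
    then show ?thesis using assms(2)[OF that] by (auto simp: mem_Times_iff)
  qed
  then show ?thesis using assms(1) unfolding atoms_def by blast
qed

lemma atoms_mono:
  assumes "C \<subseteq> V"
  shows "atoms n adj C \<subseteq> atoms n adj V"
proof
  fix s assume s: "s \<in> atoms n adj C"
  show "s \<in> atoms n adj V"
  proof (rule atoms_restrict[OF s])
    fix i c assume "hue s i = Some c"
    then have "c \<in> C \<times> {..<n}" using s unfolding atoms_def by blast
    then show "fst c \<in> V" using assms by auto
  qed
qed

lemma rel_atom_struc_restrict:
  assumes "C \<subseteq> V" "set as \<subseteq> atoms n adj C"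
  shows "as \<in> rel (atom_struc n adj C) f \<longleftrightarrow> as \<in> rel (atom_struc n adj V) f"
proof -
  have "x \<in> atoms n adj C \<and> x \<in> atoms n adj V" if "x \<in> set as" for x
    using assms(2) atoms_mono[OF assms(1), of n adj] that by blast
  then show ?thesis unfolding atom_struc_def by (cases f) auto
qed

lemma finite_free_vars: "finite (free_vars \<phi>)"
  by (induction \<phi>) auto

lemma sat_cong: "(\<And>v. v \<in> free_vars \<phi> \<Longrightarrow> e v = e' v) \<Longrightarrow> sat S e \<phi> \<longleftrightarrow> sat S e' \<phi>"
proof (induction \<phi> arbitrary: e e')
  case (Eql u v)
  then show ?case by simp
next
  case (Neg \<phi>)
  have "sat S e \<phi> \<longleftrightarrow> sat S e' \<phi>" by (rule Neg.IH) (simp add: Neg.prems)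
  then show ?case by simp
next
  case (Atm f vs)
  then have "map e vs = map e' vs" by auto
  then show ?case by (simp only: sat.simps)
next
  case (Conj \<phi> \<psi>)
  have "sat S e \<phi> \<longleftrightarrow> sat S e' \<phi>" by (rule Conj.IH(1)) (simp add: Conj.prems)
  moreover have "sat S e \<psi> \<longleftrightarrow> sat S e' \<psi>" by (rule Conj.IH(2)) (simp add: Conj.prems)
  ultimately show ?case by simp
next
  case (Exi v \<phi>)
  have "sat S (e(v := a)) \<phi> \<longleftrightarrow> sat S (e'(v := a)) \<phi>" for a
    by (rule Exi.IH) (use Exi.prems in auto)
  then show ?case by simp
qed

section \<open>Countability and the downward Loewenheim-Skolem theorem\<close>

lemma countable_L_PEA: "countable (L_PEA n)"
proof -
  have "L_PEA n \<subseteq> L_BA \<union> range Cyl \<union> range (\<lambda>(i, j). Diag i j) \<union> Subst ` ({..<n} \<rightarrow>\<^sub>E {..<n})"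
    by (auto simp: L_PEA_def)
  moreover have "finite ({..<n} \<rightarrow>\<^sub>E {..<n})" by (intro finite_PiE) auto
  then have "countable (L_BA \<union> range Cyl \<union> range (\<lambda>(i, j). Diag i j) \<union> Subst ` ({..<n} \<rightarrow>\<^sub>E {..<n}))"
    by (auto simp: L_BA_def intro: countable_finite)
  ultimately show ?thesis by (rule countable_subset)
qed

lemma countable_formulas:
  assumes "countable L"
  shows "countable {\<phi>. formula_of L \<phi>}"
proof -
  define step where "step = (\<lambda>F. range (\<lambda>(u, v). Eql u v) \<union> (\<lambda>(f, vs). Atm f vs) ` (L \<times> UNIV) \<union> Neg ` F \<union>
    (\<lambda>(\<phi>, \<psi>). Conj \<phi> \<psi>) ` (F \<times> F) \<union> (\<lambda>(v, \<phi>). Exi v \<phi>) ` (UNIV \<times> F))"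
  define Fm where "Fm = (\<lambda>d. (step ^^ d) {})"
  have Suc: "Fm (Suc d) = step (Fm d)" for d by (simp add: Fm_def)
  have count: "countable (Fm d)" for d
  proof (induction d)
    case 0
    then show ?case by (simp add: Fm_def)
  next
    case (Suc d)
    then show ?case unfolding \<open>\<And>d. Fm (Suc d) = step (Fm d)\<close> step_def
      by (intro countable_Un countable_image countable_SIGMA assms) auto
  qed
  have "mono step" by (rule monoI) (auto simp: step_def)
  have inc: "Fm d \<subseteq> Fm (Suc d)" for d
  proof (induction d)
    case (Suc d)
    then show ?case using \<open>mono step\<close> by (simp add: \<open>\<And>d. Fm (Suc d) = step (Fm d)\<close> monoD)
  qed (simp add: Fm_def)
  have mono: "Fm d \<subseteq> Fm d'" if "d \<le> d'" for d d' using inc that by (rule lift_Suc_mono_le)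
  have "\<exists>d. \<phi> \<in> Fm d" if "formula_of L \<phi>" for \<phi>
    using that
  proof (induction \<phi>)
    case (Eql u v)
    have "Eql u v \<in> Fm (Suc 0)" unfolding Suc step_def by auto
    then show ?case by blast
  next
    case (Atm f vs)
    then have "Atm f vs \<in> Fm (Suc 0)" unfolding Suc step_def by (auto simp: L_plus_def image_iff)
    then show ?case by blast
  next
    case (Neg \<phi>)
    then obtain d where "\<phi> \<in> Fm d" by auto
    then have "Neg \<phi> \<in> Fm (Suc d)" unfolding Suc step_def by blast
    then show ?case by blast
  next
    case (Conj \<phi> \<psi>)
    then obtain d d' where "\<phi> \<in> Fm d" "\<psi> \<in> Fm d'" by auto
    then have "\<phi> \<in> Fm (max d d')" "\<psi> \<in> Fm (max d d')" using mono[of d "max d d'"] mono[of d' "max d d'"] by auto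
    then have "Conj \<phi> \<psi> \<in> Fm (Suc (max d d'))" unfolding Suc step_def by auto
    then show ?case by blast
  next
    case (Exi v \<phi>)
    then obtain d where "\<phi> \<in> Fm d" by auto
    then have "Exi v \<phi> \<in> Fm (Suc d)" unfolding Suc step_def by auto
    then show ?case by blast
  qed
  then have "{\<phi>. formula_of L \<phi>} \<subseteq> (\<Union>d. Fm d)" by blast
  then show ?thesis by (rule countable_subset) (use count in auto)
qed

lemma countable_atoms:
  assumes "countable V"
  shows "countable (atoms n adj V)"
proof -
  let ?O = "insert None (Some ` (V \<times> {..<n}))"
  let ?f = "\<lambda>(E, xs). Atom E (\<lambda>i. if i < n then xs ! i else None)"
  have "atoms n adj V \<subseteq> ?f ` (Pow ({..<n} \<times> {..<n}) \<times> lists ?O)"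
  proof
    fix s assume s: "s \<in> atoms n adj V"
    then obtain t :: "nat \<Rightarrow> nat" and \<kappa> where st: "s = atom n t \<kappa>" by (auto simp: atoms_def)
    have O: "hue s i \<in> ?O" for i
    proof (cases "hue s i")
      case (Some c)
      then have "c \<in> V \<times> {..<n}" using s unfolding atoms_def by blast
      then show ?thesis using Some by blast
    qed simp
    have "map (hue s) [0..<n] \<in> lists ?O"
      unfolding in_lists_conv_set set_map by (intro ballI, elim imageE) (simp only: O)
    moreover have "keq s \<in> Pow ({..<n} \<times> {..<n})" unfolding st by auto
    moreover have "s = ?f (keq s, map (hue s) [0..<n])"
      by (rule atom.expand) (auto simp: fun_eq_iff st hue_atom)
    ultimately show "s \<in> ?f ` (Pow ({..<n} \<times> {..<n}) \<times> lists ?O)" by blast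
  qed
  moreover have "countable (?f ` (Pow ({..<n} \<times> {..<n}) \<times> lists ?O))"
    by (intro countable_image countable_SIGMA countable_lists countable_insert assms) (auto intro: countable_finite)
  ultimately show ?thesis by (rule countable_subset)
qed

text \<open>The substructure is sought among the atom structures over subsets of \<open>V\<close>,
  so that it is again given by a graph and its infinity and colourability can be read off from
  \<open>C\<close>. An atom uses finitely many vertices, so each witness adds only a finite
  set.\<close>

lemma loewenheim_skolem:
  assumes C0: "countable C0" "C0 \<subseteq> V" and L: "countable L"
  obtains C where "C0 \<subseteq> C" "C \<subseteq> V" "countable C"
    "\<And>\<phi> e. formula_of L \<phi> \<Longrightarrow> range e \<subseteq> atoms n adj C \<Longrightarrow>
      sat (atom_struc n adj C) e \<phi> \<longleftrightarrow> sat (atom_struc n adj V) e \<phi>"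
proof -
  let ?S = "atom_struc n adj V" and ?A = "atoms n adj"
  define supp :: "'a atom \<Rightarrow> 'a set" where "supp = (\<lambda>s. {v. \<exists>i<n. \<exists>l. hue s i = Some (v, l)})"
  have supp_count: "finite (supp s)" for s
  proof -
    have "supp s \<subseteq> (\<lambda>i. fst (the (hue s i))) ` {..<n}"
    proof
      fix v assume "v \<in> supp s"
      then obtain i l where "i < n" "hue s i = Some (v, l)" unfolding supp_def by blast
      then show "v \<in> (\<lambda>i. fst (the (hue s i))) ` {..<n}" by (intro image_eqI[of _ _ i]) simp_all
    qed
    then show ?thesis by (rule finite_subset) simp
  qed
  have hue_n: "i < n" if s: "s \<in> ?A V" "hue s i = Some c" for s i c
  proof -
    obtain t :: "nat \<Rightarrow> nat" and \<kappa> where "s = atom n t \<kappa>" using s(1) unfolding atoms_def by blast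
    then show ?thesis using s(2) by (simp add: hue_atom split: if_splits)
  qed
  have suppI: "s \<in> ?A C" if "s \<in> ?A V" "supp s \<subseteq> C" for s C
  proof (rule atoms_restrict[OF that(1)])
    fix i c assume c: "hue s i = Some c"
    then have "fst c \<in> supp s" using hue_n[OF that(1) c] unfolding supp_def by (cases c) auto
    then show "fst c \<in> C" using that(2) by blast
  qed
  have suppD: "supp s \<subseteq> C" if "s \<in> ?A C" for s C
    using that unfolding supp_def atoms_def by blast
  \<comment> \<open>Valuations are replaced by finite lists of their first values, of which there
    are countably many. The list will be long enough to cover all free variables.\<close>
  define wit where "wit = (\<lambda>(\<phi>, v, xs). SOME a. a \<in> ?A V \<and> sat ?S (((!) xs)(v := a)) \<phi>)"
  \<comment> \<open>If there is no witness, \<open>wit\<close> is arbitrary; the intersection with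
    \<open>V\<close> keeps the new vertices legal even then.\<close>
  define step where "step = (\<lambda>C. C \<union>
    (\<Union>p\<in>{\<phi>. formula_of L \<phi>} \<times> (UNIV :: nat set) \<times> lists (?A C). supp (wit p) \<inter> V))"
  define Cs where "Cs = (\<lambda>j. (step ^^ j) C0)"
  have Suc: "Cs (Suc j) = step (Cs j)" for j by (simp add: Cs_def)
  have count: "countable (Cs j)" for j
  proof (induction j)
    case 0
    then show ?case using C0 by (simp add: Cs_def)
  next
    case (Suc j)
    have "countable ({\<phi>. formula_of L \<phi>} \<times> (UNIV :: nat set) \<times> lists (?A (Cs j)))"
      by (intro countable_SIGMA countable_formulas L countable_lists countable_atoms Suc) simp
    moreover have "countable (supp p \<inter> V)" for p using supp_count by (intro countable_finite) simp
    ultimately show ?case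
      unfolding \<open>\<And>j. Cs (Suc j) = step (Cs j)\<close> step_def using Suc by (intro countable_Un countable_UN) auto
  qed
  have inc: "Cs j \<subseteq> Cs (Suc j)" for j unfolding Suc step_def by blast
  have mono: "Cs j \<subseteq> Cs j'" if "j \<le> j'" for j j' using inc that by (rule lift_Suc_mono_le)
  have CsV: "Cs j \<subseteq> V" for j
    by (induction j) (use C0 in \<open>auto simp: Suc step_def Cs_def\<close>)
  define C where "C = (\<Union>j. Cs j)"
  have CV: "C \<subseteq> V" using CsV by (auto simp: C_def)
  have fin: "\<exists>j. F \<subseteq> Cs j" if "finite F" "F \<subseteq> C" for F
    using that
  proof (induction F rule: finite_induct)
    case (insert x F)
    then obtain j j' where "F \<subseteq> Cs j" "x \<in> Cs j'" by (auto simp: C_def)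
    then have "insert x F \<subseteq> Cs (max j j')" using mono[of j "max j j'"] mono[of j' "max j j'"] by auto
    then show ?case by blast
  qed simp
  have tv: "\<exists>a\<in>?A C. sat ?S (e(v := a)) \<phi>"
    if \<phi>: "formula_of L \<phi>" and e: "range e \<subseteq> ?A C" and a: "a \<in> ?A V" "sat ?S (e(v := a)) \<phi>" for \<phi> v e a
  proof -
    obtain N where N: "\<And>u. u \<in> free_vars \<phi> \<Longrightarrow> u < N"
      using finite_free_vars[of \<phi>] unfolding finite_nat_set_iff_bounded by blast
    define xs where "xs = map e [0..<N]"
    have agree: "sat ?S (e(v := b)) \<phi> \<longleftrightarrow> sat ?S (((!) xs)(v := b)) \<phi>" for b
      by (rule sat_cong) (use N in \<open>auto simp: xs_def\<close>)
    have "(\<Union>x\<in>set xs. supp x) \<subseteq> C"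
    proof (rule UN_least)
      fix x assume "x \<in> set xs"
      then have "x \<in> ?A C" using e by (auto simp: xs_def)
      then show "supp x \<subseteq> C" by (rule suppD)
    qed
    moreover have "finite (\<Union>x\<in>set xs. supp x)" using supp_count by simp
    ultimately obtain j where j: "(\<Union>x\<in>set xs. supp x) \<subseteq> Cs j" using fin by blast
    have "x \<in> ?A (Cs j)" if x: "x \<in> set xs" for x
    proof (rule suppI)
      show "x \<in> ?A V" using x e atoms_mono[OF CV, of n adj] by (auto simp: xs_def)
      show "supp x \<subseteq> Cs j" using x j by blast
    qed
    then have p: "(\<phi>, v, xs) \<in> {\<phi>. formula_of L \<phi>} \<times> (UNIV :: nat set) \<times> lists (?A (Cs j))" using \<phi> by auto
    define b where "b = wit (\<phi>, v, xs)"
    have b: "b \<in> ?A V \<and> sat ?S (((!) xs)(v := b)) \<phi>"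
      unfolding b_def wit_def case_prod_conv by (rule someI[of _ a]) (use a agree in blast)
    have "supp b \<subseteq> V" using suppD b by blast
    then have "supp b \<subseteq> Cs (Suc j)" unfolding Suc step_def b_def using p by blast
    then have "supp b \<subseteq> C" unfolding C_def by blast
    then have "b \<in> ?A C" by (rule suppI[OF conjunct1[OF b]])
    moreover have "sat ?S (e(v := b)) \<phi>" using b by (simp only: agree)
    ultimately show ?thesis by (rule bexI[rotated])
  qed
  have elem: "sat (atom_struc n adj C) e \<phi> \<longleftrightarrow> sat ?S e \<phi>" if "formula_of L \<phi>" "range e \<subseteq> ?A C" for \<phi> e
    using that
  proof (induction \<phi> arbitrary: e)
    case (Atm f vs)
    have "set (map e vs) \<subseteq> ?A C" using Atm.prems by auto
    from rel_atom_struc_restrict[OF CV this] show ?case by simp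
  next
    case (Exi v \<phi>)
    have f: "formula_of L \<phi>" using Exi.prems by simp
    have IH: "sat (atom_struc n adj C) (e(v := a)) \<phi> \<longleftrightarrow> sat ?S (e(v := a)) \<phi>" if "a \<in> ?A C" for a
      by (rule Exi.IH[OF f]) (use Exi.prems that in auto)
    have "(\<exists>a\<in>?A C. sat ?S (e(v := a)) \<phi>) \<longleftrightarrow> (\<exists>a\<in>?A V. sat ?S (e(v := a)) \<phi>)"
      using tv[OF f Exi.prems(2)] atoms_mono[OF CV, of n adj] by blast
    then show ?case using IH by simp
  qed auto
  have "Cs 0 = C0" by (simp add: Cs_def)
  then have "C0 \<subseteq> C" unfolding C_def by blast
  moreover have "countable C" unfolding C_def using count by auto
  ultimately show ?thesis by (rule that[OF _ CV _ elem])
qed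

section \<open>Isomorphic copies over another type\<close>

definition image_struc :: "('a \<Rightarrow> 'b) \<Rightarrow> 'a struc \<Rightarrow> 'b struc" where
  "image_struc g S = \<lparr>univ = g ` univ S, rel = (\<lambda>f. map g ` rel S f)\<rparr>"

lemma atom_structure_image:
  assumes "atom_structure L S"
  shows "atom_structure L (image_struc g S)"
  unfolding atom_structure_def
proof (intro conjI ballI subsetI)
  show "univ (image_struc g S) \<noteq> {}" using assms by (simp add: atom_structure_def image_struc_def)
  fix f ys assume f: "f \<in> L_plus L" and "ys \<in> rel (image_struc g S) f"
  then obtain xs where xs: "xs \<in> rel S f" "ys = map g xs" by (auto simp: image_struc_def)
  then have "set xs \<subseteq> univ S" "length xs = Suc (arity f)"
    using assms f unfolding atom_structure_def by auto
  then show "ys \<in> {xs \<in> lists (univ (image_struc g S)). length xs = Suc (arity f)}"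
    using xs(2) by (auto simp: image_struc_def intro!: imageI)
qed

lemma map_mem_image_iff:
  assumes "inj_on g U" "set as \<subseteq> U" "R \<subseteq> lists U"
  shows "map g as \<in> map g ` R \<longleftrightarrow> as \<in> R"
proof
  assume "map g as \<in> map g ` R"
  then obtain bs where bs: "bs \<in> R" "map g as = map g bs" by blast
  have "inj_on g (set as \<union> set bs)" using assms bs(1) by (intro inj_on_subset[OF assms(1)]) auto
  then have "as = bs" using bs(2) by (rule map_inj_on[rotated])
  then show "as \<in> R" using bs(1) by simp
qed blast

lemma sat_image:
  assumes S: "atom_structure L S" and g: "inj_on g (univ S)"
    and "formula_of L \<phi>" "range e \<subseteq> univ S"
  shows "sat (image_struc g S) (g \<circ> e) \<phi> \<longleftrightarrow> sat S e \<phi>"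
  using assms(3,4)
proof (induction \<phi> arbitrary: e)
  case (Eql u v)
  then show ?case using g by (auto simp: inj_on_def image_subset_iff)
next
  case (Atm f vs)
  have R: "rel S f \<subseteq> lists (univ S)" using S Atm.prems(1) unfolding atom_structure_def by auto
  have "set (map e vs) \<subseteq> univ S" using Atm.prems(2) by auto
  from map_mem_image_iff[OF g this R] show ?case by (simp add: image_struc_def comp_def)
next
  case (Exi v \<phi>)
  have "sat (image_struc g S) ((g \<circ> e)(v := g a)) \<phi> \<longleftrightarrow> sat S (e(v := a)) \<phi>" if "a \<in> univ S" for a
  proof -
    have "(g \<circ> e)(v := g a) = g \<circ> e(v := a)" by (rule ext) simp
    moreover have "formula_of L \<phi>" "range (e(v := a)) \<subseteq> univ S" using Exi.prems that by auto
    ultimately show ?thesis using Exi.IH by (simp only:)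
  qed
  then show ?case by (simp add: image_struc_def comp_def)
qed auto

lemma models_image:
  assumes S: "atom_structure L S" and g: "inj_on g (univ S)" and T: "\<And>\<phi>. \<phi> \<in> T \<Longrightarrow> formula_of L \<phi>"
  shows "models (image_struc g S) T \<longleftrightarrow> models S T"
proof
  assume m: "models (image_struc g S) T"
  show "models S T"
    unfolding models_def
  proof (intro ballI allI impI)
    fix \<phi> and e :: "nat \<Rightarrow> _" assume \<phi>: "\<phi> \<in> T" "range e \<subseteq> univ S"
    then have "range (g \<circ> e) \<subseteq> univ (image_struc g S)" by (auto simp: image_struc_def)
    then show "sat S e \<phi>" using m \<phi> sat_image[OF S g T[OF \<phi>(1)] \<phi>(2)] unfolding models_def by blast
  qed
next
  assume m: "models S T"
  show "models (image_struc g S) T"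
    unfolding models_def
  proof (intro ballI allI impI)
    fix \<phi> and e :: "nat \<Rightarrow> _" assume \<phi>: "\<phi> \<in> T" "range e \<subseteq> univ (image_struc g S)"
    define e' where "e' = (\<lambda>v. inv_into (univ S) g (e v))"
    have ev: "e v \<in> g ` univ S" for v using \<phi>(2) by (auto simp: image_struc_def)
    have e': "range e' \<subseteq> univ S" using ev by (auto simp: e'_def intro: inv_into_into)
    moreover have "g \<circ> e' = e" using ev by (auto simp: e'_def fun_eq_iff f_inv_into_f)
    ultimately show "sat (image_struc g S) e \<phi>"
      using m \<phi> sat_image[OF S g T[OF \<phi>(1)] e'] unfolding models_def by simp
  qed
qed

lemma hom_alg_comp:
  assumes "hom_alg L A B h" "hom_alg L B C k"
  shows "hom_alg L A C (k \<circ> h)"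
  unfolding hom_alg_def
proof (intro conjI ballI impI)
  show "k \<circ> h \<in> carr A \<rightarrow> carr C" using assms by (auto simp: hom_alg_def Pi_iff)
  fix f xs assume *: "f \<in> L" "xs \<in> lists (carr A)" "length xs = arity f"
  have "map h xs \<in> lists (carr B)" using assms(1) *(2) by (auto simp: hom_alg_def Pi_iff)
  then show "(k \<circ> h) (oper A f xs) = oper C f (map (k \<circ> h) xs)"
    using assms * by (simp add: hom_alg_def)
qed

lemma hom_alg_inv:
  assumes alg: "is_algebra L A" and h: "hom_alg L A B h" "bij_betw h (carr A) (carr B)"
  shows "hom_alg L B A (inv_into (carr A) h)"
  unfolding hom_alg_def
proof (intro conjI ballI impI)
  let ?k = "inv_into (carr A) h"
  have kA: "?k y \<in> carr A" if "y \<in> carr B" for y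
    using h(2) that unfolding bij_betw_def by (metis inv_into_into)
  then show "?k \<in> carr B \<rightarrow> carr A" by blast
  fix f ys assume *: "f \<in> L" "ys \<in> lists (carr B)" "length ys = arity f"
  have hk: "h (?k y) = y" if "y \<in> carr B" for y using h(2) that by (auto simp: bij_betw_def f_inv_into_f)
  have m: "map ?k ys \<in> lists (carr A)" using *(2) kA by auto
  have "map h (map ?k ys) = ys" using *(2) hk by (auto intro: map_idI)
  moreover have "h (oper A f (map ?k ys)) = oper B f (map h (map ?k ys))"
    using h(1) *(1,3) m unfolding hom_alg_def by (metis length_map)
  moreover have "oper A f (map ?k ys) \<in> carr A" using alg *(1,3) m unfolding is_algebra_def by (metis length_map)
  ultimately show "?k (oper B f ys) = oper A f (map ?k ys)"
    using h(2) by (metis bij_betw_inv_into_left)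
qed

lemma complex_algebra_image:
  assumes S: "atom_structure L S" and g: "inj_on g (univ S)" and L: "L \<subseteq> L_PEA n"
  shows "hom_alg L (complex_algebra S) (complex_algebra (image_struc g S)) ((`) g)"
    and "bij_betw ((`) g) (carr (complex_algebra S)) (carr (complex_algebra (image_struc g S)))"
proof -
  show "bij_betw ((`) g) (carr (complex_algebra S)) (carr (complex_algebra (image_struc g S)))"
    using g by (auto simp: complex_algebra_def image_struc_def bij_betw_def inj_on_image_Pow image_Pow_surj)
  have "g ` complex_op S f Xs = complex_op (image_struc g S) f (map ((`) g) Xs)"
    if f: "f \<in> L" "Xs \<in> lists (Pow (univ S))" "length Xs = arity f" for f Xs
  proof (cases "f \<in> L_BA")
    case True
    have inj: "g ` (univ S - X) = g ` univ S - g ` X" if "X \<subseteq> univ S" for X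
      using g that by (intro inj_on_image_set_diff[of g "univ S"]) auto
    show ?thesis
    proof (cases "f = BMinus")
      case minus: True
      then obtain X where "Xs = [X]" using f(3) by (auto simp: length_Suc_conv)
      then show ?thesis
        using minus f(2) inj[of X] by (simp add: complex_op_def L_BA_def image_struc_def)
    next
      case False
      then show ?thesis using True f(2,3)
        by (auto simp: complex_op_def L_BA_def image_struc_def numeral_2_eq_2 length_Suc_conv)
    qed
  next
    case False
    have R: "rel S f \<subseteq> lists (univ S)" using S f(1) False unfolding atom_structure_def L_plus_def by auto
    show ?thesis
    proof (intro equalityI subsetI)
      fix y assume "y \<in> g ` complex_op S f Xs"
      then obtain s xs where s: "y = g s" "s \<in> univ S" "list_all2 (\<in>) xs Xs" "xs @ [s] \<in> rel S f"
        using False by (auto simp: complex_op_def)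
      have "list_all2 (\<in>) (map g xs) (map ((`) g) Xs)"
        using s(3) by (auto simp: list_all2_conv_all_nth)
      moreover have "map g xs @ [g s] \<in> map g ` rel S f" using s(4) by (intro image_eqI[of _ _ "xs @ [s]"]) simp_all
      ultimately show "y \<in> complex_op (image_struc g S) f (map ((`) g) Xs)"
        using s False by (auto simp: complex_op_def image_struc_def)
    next
      fix y assume "y \<in> complex_op (image_struc g S) f (map ((`) g) Xs)"
      then obtain ys where ys: "list_all2 (\<in>) ys (map ((`) g) Xs)" "ys @ [y] \<in> map g ` rel S f"
        using False by (auto simp: complex_op_def image_struc_def)
      then obtain zs where zs: "zs \<in> rel S f" "map g zs = ys @ [y]" by force
      then obtain xs s where xs: "zs = xs @ [s]" "map g xs = ys" "g s = y"
        by (auto simp: map_eq_append_conv)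
      have xsU: "set xs \<subseteq> univ S" "s \<in> univ S" using zs(1) R xs(1) by auto
      have "list_all2 (\<in>) xs Xs"
        unfolding list_all2_conv_all_nth
      proof (intro conjI allI impI)
        show "length xs = length Xs" using ys(1) xs(2) by (auto dest: list_all2_lengthD)
        fix i assume i: "i < length xs"
        then have "g (xs ! i) \<in> g ` (Xs ! i)" using ys(1) xs(2) by (auto simp: list_all2_conv_all_nth)
        moreover have "xs ! i \<in> univ S" using xsU(1) i by auto
        moreover have "Xs ! i \<subseteq> univ S" using f(2) i \<open>length xs = length Xs\<close> by (auto simp: in_lists_conv_set)
        ultimately show "xs ! i \<in> Xs ! i" using inj_on_image_mem_iff[OF g] by blast
      qed
      then have "s \<in> complex_op S f Xs" using False xsU(2) zs(1) xs(1) by (auto simp: complex_op_def)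
      then show "y \<in> g ` complex_op S f Xs" using xs(3) by blast
    qed
  qed
  then show "hom_alg L (complex_algebra S) (complex_algebra (image_struc g S)) ((`) g)"
    by (auto simp: hom_alg_def complex_algebra_def image_struc_def)
qed

section \<open>The main theorem\<close>

lemma nonprincipal_ultra:
  obtains D :: "nat set set" where "ultra D" "\<And>m. {m..} \<in> D"
proof -
  obtain D :: "nat set set" where "ultra D" "range (\<lambda>m. {m..}) \<subseteq> D"
  proof (rule ultra_extend[of "range (\<lambda>m::nat. {m..})"])
    fix A B assume "A \<in> range (\<lambda>m::nat. {m..})" "B \<in> range (\<lambda>m::nat. {m..})"
    then obtain a b :: nat where "A = {a..}" "B = {b..}" by blast
    then have "{max a b..} \<subseteq> A \<inter> B" by auto
    then show "\<exists>C\<in>range (\<lambda>m::nat. {m..}). C \<subseteq> A \<inter> B" by blast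
  qed auto
  then show ?thesis using that by blast
qed

lemma countable_imp_inj_infinite:
  assumes "countable A" "infinite (UNIV :: 'b set)"
  obtains g :: "'a \<Rightarrow> 'b" where "inj_on g A"
proof -
  obtain f :: "'a \<Rightarrow> nat" where f: "inj_on f A" using assms(1) by (auto simp: countable_def)
  obtain e :: "nat \<Rightarrow> 'b" where "inj e" using infinite_countable_subset[OF assms(2)] by blast
  then have "inj_on (e \<circ> f) A" using f by (intro comp_inj_on) (auto intro: inj_on_subset)
  then show ?thesis by (rule that)
qed

lemma atom_structure_atom_struc:
  assumes "n \<ge> 3" "V \<noteq> {}"
  shows "atom_structure L (atom_struc n adj V)"
proof -
  obtain v where v: "v \<in> V" using assms(2) by blast
  have "atom n (\<lambda>_. 0 :: nat) (\<lambda>_. (v, 0)) \<in> atoms n adj V"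
  proof (rule atom_in_atomsI)
    assume "inj_on (\<lambda>_. 0 :: nat) {..<n}"
    then have "(0 :: nat) = 1" by (rule inj_onD) (use assms(1) in auto)
    then show "\<exists>i<n. \<exists>j<n. cadj adj (v, 0) (v, 0)" by simp
  qed (use assms v in auto)
  then have "univ (atom_struc n adj V) \<noteq> {}" by auto
  moreover have "rel (atom_struc n adj V) f \<subseteq> {xs \<in> lists (univ (atom_struc n adj V)). length xs = Suc (arity f)}" for f
    by (cases f) (auto simp: atom_struc_def)
  ultimately show ?thesis unfolding atom_structure_def by blast
qed

lemma hom_alg_mono: "hom_alg L A B h \<Longrightarrow> L' \<subseteq> L \<Longrightarrow> hom_alg L' A B h"
  unfolding hom_alg_def by blast

lemma PEA_set_alg_eq_Df: "PEA_set_alg n X = Df_set_alg n (\<lambda>_. X)"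
  by (simp add: PEA_set_alg_def Df_set_alg_def)

text \<open>The networks have points of type \<open>'a atom pt\<close>, not of the type built into
  \<open>representable\<close>; the theorems \<open>representable_if_Df\<close> and
  \<open>representable_if_PEA\<close> bridge the gap. For the diagonal-free signature a power of one
  set is read as a product with equal factors.\<close>

lemma strongly_representable_if_infinite_chromatic:
  assumes n: "n \<ge> 3" and L: "L_Df n \<subseteq> L" "L \<subseteq> L_PEA n" and chrom: "infinite_chromatic adj V"
    and g: "inj_on g (atoms n adj V)"
  shows "strongly_representable n L (image_struc g (atom_struc n adj V))"
proof -
  let ?S = "atom_struc n adj V" and ?S' = "image_struc g (atom_struc n adj V)"
  obtain \<mu> where \<mu>: "ultra \<mu>" "V \<in> \<mu>" "\<And>X. X \<in> \<mu> \<Longrightarrow> \<exists>x\<in>X. \<exists>y\<in>X. adj x y"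
    using infinite_chromatic_ultra[OF chrom] by blast
  interpret reflexive_ultrafilter n adj V \<mu> by unfold_locales (use n \<mu> in auto)
  have as: "atom_structure L ?S" using atom_structure_atom_struc[OF n V_nonempty] .
  have gS: "inj_on g (univ ?S)" using g by simp
  obtain U :: "'a atom \<Rightarrow> 'a atom pt set" where
    "embeddable (L_PEA n) (complex_algebra ?S) (prod_alg (atoms n adj V) (\<lambda>s. PEA_set_alg n (U s)))"
    using embeddable_complex_algebra by blast
  then obtain h where h: "hom_alg (L_PEA n) (complex_algebra ?S) (prod_alg (atoms n adj V) (\<lambda>s. PEA_set_alg n (U s))) h"
    "inj_on h (carr (complex_algebra ?S))" by (rule embeddableE)
  let ?k = "inv_into (carr (complex_algebra ?S)) ((`) g)"
  note bij = complex_algebra_image(2)[OF as gS L(2)]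
  have "hom_alg L (complex_algebra ?S') (complex_algebra ?S) ?k"
    by (rule hom_alg_inv[OF is_algebra_complex_algebra[OF L(2)] complex_algebra_image(1)[OF as gS L(2)] bij])
  then have "hom_alg L (complex_algebra ?S') (prod_alg (atoms n adj V) (\<lambda>s. PEA_set_alg n (U s))) (h \<circ> ?k)"
    using hom_alg_mono[OF h(1) L(2)] by (rule hom_alg_comp)
  moreover have "inj_on (h \<circ> ?k) (carr (complex_algebra ?S'))"
    using bij_betw_inv_into[OF bij] h(2) by (auto simp: bij_betw_def intro: comp_inj_on)
  ultimately have emb: "embeddable L (complex_algebra ?S') (prod_alg (atoms n adj V) (\<lambda>s. PEA_set_alg n (U s)))"
    by (rule embeddableI[OF is_algebra_complex_algebra[OF L(2)]])
  have "representable n L (complex_algebra ?S')"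
  proof (cases "L = L_Df n")
    case True
    show ?thesis
      by (rule representable_if_Df[OF True is_algebra_complex_algebra[OF L(2)] emb[unfolded PEA_set_alg_eq_Df]])
  next
    case False
    then show ?thesis by (rule representable_if_PEA[OF L _ is_algebra_complex_algebra[OF L(2)] emb])
  qed
  then show ?thesis
    using atom_structure_image[OF as] unfolding strongly_representable_def by blast
qed

text \<open>Colouring two faces in different copies makes them adjacent whatever the graph
  is.\<close>

lemma injective_atom_exists:
  assumes "n \<ge> 3" "v \<in> V"
  shows "\<exists>s\<in>atoms n adj V. hue s (n - 1) \<noteq> None"
proof -
  define \<kappa> where "\<kappa> = (\<lambda>H. (v, if H = off n 0 then 0 else 1 :: nat))"
  have "0 \<in> off n 1" "0 \<notin> off n 0" "0 < n" "1 < n" using assms(1) by simp_all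
  then have 1: "off n 1 \<noteq> off n 0" by blast
  have "atom n (\<lambda>i. i) \<kappa> \<in> atoms n adj V"
  proof (rule atom_in_atomsI)
    have "cadj adj (\<kappa> ((\<lambda>i. i) ` off n 0)) (\<kappa> ((\<lambda>i. i) ` off n 1))"
      unfolding image_ident using 1 by (simp add: \<kappa>_def cadj_def)
    then show "\<exists>i<n. \<exists>j<n. cadj adj (\<kappa> ((\<lambda>i. i) ` off n i)) (\<kappa> ((\<lambda>i. i) ` off n j))"
      using \<open>0 < n\<close> \<open>1 < n\<close> by blast
    show "range \<kappa> \<subseteq> V \<times> {..<n}" using assms by (auto simp: \<kappa>_def)
  qed (rule assms(1))
  moreover have "hue (atom n (\<lambda>i. i) \<kappa>) (n - 1) \<noteq> None" using assms(1) by (simp add: hue_atom)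
  ultimately show ?thesis by blast
qed

text \<open>Both kinds of representation are read as diagonal-free ones. By injectivity some factor
  does not annihilate the chosen atom with a coloured last face, and this factor alone gives the
  contradiction.\<close>

lemma not_strongly_representable_if_colourable:
  fixes c :: "'v \<Rightarrow> nat" and g :: "'v atom \<Rightarrow> 'a"
  assumes n: "n \<ge> 3" and L: "L_Df n \<subseteq> L" "L \<subseteq> L_PEA n" and V: "infinite V"
    and c: "\<And>v. v \<in> V \<Longrightarrow> c v < m" "\<And>v w. v \<in> V \<Longrightarrow> w \<in> V \<Longrightarrow> adj v w \<Longrightarrow> c v \<noteq> c w"
    and g: "inj_on g (atoms n adj V)"
  shows "\<not> strongly_representable n L (image_struc g (atom_struc n adj V))"
proof
  let ?A = "atoms n adj V" and ?S = "atom_struc n adj V" and ?S' = "image_struc g (atom_struc n adj V)"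
  assume "strongly_representable n L ?S'"
  then have "representable n L (complex_algebra ?S')" by (simp add: strongly_representable_def)
  then obtain I and U :: "'a set \<Rightarrow> nat \<Rightarrow> ('a set + nat) set" where
    "embeddable L (complex_algebra ?S') (prod_alg I (\<lambda>k. Df_set_alg n (U k)))"
    unfolding representable_def PEA_set_alg_eq_Df by (metis (no_types))
  then obtain h where h: "hom_alg L (complex_algebra ?S') (prod_alg I (\<lambda>k. Df_set_alg n (U k))) h"
    "inj_on h (carr (complex_algebra ?S'))" by (rule embeddableE)
  have "V \<noteq> {}" using V by auto
  then have as: "atom_structure L ?S" by (rule atom_structure_atom_struc[OF n])
  have gS: "inj_on g (univ ?S)" using g by simp
  note im = complex_algebra_image[OF as gS L(2)]
  define f where "f = h \<circ> (`) g"
  have f: "hom_alg (L_Df n) (complex_algebra ?S) (prod_alg I (\<lambda>k. Df_set_alg n (U k))) f"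
    unfolding f_def by (rule hom_alg_mono[OF hom_alg_comp[OF im(1) h(1)] L(1)])
  have carr: "carr (complex_algebra ?S) = Pow ?A" by (simp add: complex_algebra_def)
  have f_inj: "inj_on f (Pow ?A)"
    unfolding f_def carr[symmetric] using im(2) h(2) by (auto simp: bij_betw_def intro: comp_inj_on)
  have op: "f (complex_op ?S F Xs) k = set_op n (\<Pi>\<^sub>E i\<in>{..<n}. U k i) F (map (\<lambda>X. f X k) Xs)"
    if "F \<in> L_Df n" "Xs \<in> lists (Pow ?A)" "length Xs = arity F" "k \<in> I" for F Xs k
  proof -
    have "f (complex_op ?S F Xs) = oper (prod_alg I (\<lambda>k. Df_set_alg n (U k))) F (map f Xs)"
      using f that(1-3) unfolding hom_alg_def carr by (simp add: complex_algebra_def)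
    then show ?thesis using that(4) by (simp add: prod_alg_def Df_set_alg_def set_alg_def comp_def)
  qed
  have sym: "BPlus \<in> L_Df n" "BMinus \<in> L_Df n" "BZero \<in> L_Df n" "\<And>i. i < n \<Longrightarrow> Cyl i \<in> L_Df n"
    by (auto simp: L_Df_def L_BA_def)
  have empty: "f {} k = {}" if "k \<in> I" for k
    using op[OF sym(3) _ _ that, of "[]"] by (simp add: complex_op_def L_BA_def)
  obtain v where "v \<in> V" using \<open>V \<noteq> {}\<close> by blast
  then obtain s where s: "s \<in> ?A" "hue s (n - 1) \<noteq> None" using injective_atom_exists[OF n] by metis
  have "\<exists>k\<in>I. f {s} k \<noteq> {}"
  proof (rule ccontr)
    assume "\<not> ?thesis"
    then have eq: "f {s} k = f {} k" if "k \<in> I" for k using that empty by simp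
    have "f X \<in> (\<Pi>\<^sub>E k\<in>I. carr (Df_set_alg n (U k)))" if "X \<in> Pow ?A" for X
      using f that unfolding hom_alg_def carr by (auto simp: prod_alg_def)
    then have "f {s} = f {}" using eq s(1) by (intro PiE_ext[where k = I]) auto
    then show False using f_inj s(1) by (auto dest: inj_onD)
  qed
  then obtain k where k: "k \<in> I" "f {s} k \<noteq> {}" by blast
  interpret df_hom n adj V "U k" "\<lambda>X. f X k"
  proof
    show "f (X \<union> Y) k = f X k \<union> f Y k" if "X \<subseteq> ?A" "Y \<subseteq> ?A" for X Y
      using op[OF sym(1) _ _ k(1), of "[X, Y]"] that by (simp add: complex_op_def L_BA_def)
    show "f (?A - X) k = (\<Pi>\<^sub>E i\<in>{..<n}. U k i) - f X k" if "X \<subseteq> ?A" for X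
      using op[OF sym(2) _ _ k(1), of "[X]"] that by (simp add: complex_op_def L_BA_def)
    show "f (cylinder n adj V i X) k = {x \<in> (\<Pi>\<^sub>E i\<in>{..<n}. U k i). \<exists>y\<in>f X k. \<forall>j<n. j \<noteq> i \<longrightarrow> y j = x j}"
      if "X \<subseteq> ?A" "i < n" for X i
      using op[OF sym(4)[OF that(2)] _ _ k(1), of "[X]"] that by (simp add: complex_op_atom_struc(1))
    show "\<exists>s\<in>?A. hue s (n - 1) \<noteq> None \<and> f {s} k \<noteq> {}" using s k(2) by blast
  qed (use n V empty k in auto)
  show False by (rule not_finitely_colourable[of c m]) (use c in auto)
qed

theorem theorem8p3:
  fixes n :: nat and L :: "fsym set"
  assumes "n \<ge> 3"
    and "L_Df n \<subseteq> L"
    and "L \<subseteq> L_PEA n"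
    and "infinite (UNIV :: 'a set)"
  shows "\<not> elementary_class L {S :: 'a struc. strongly_representable n L S}"
proof
  assume "elementary_class L {S :: 'a struc. strongly_representable n L S}"
  then obtain T where T: "\<And>\<phi>. \<phi> \<in> T \<Longrightarrow> sentence_of L \<phi>"
    and K: "\<And>S :: 'a struc. strongly_representable n L S \<longleftrightarrow> atom_structure L S \<and> models S T"
    unfolding elementary_class_def by blast
  have TL: "formula_of L \<phi>" if "\<phi> \<in> T" for \<phi> using T[OF that] by (simp add: sentence_of_def)
  obtain D :: "nat set set" where ultra_D: "ultra D" and cofinite_D: "\<And>m. {m..} \<in> D" using nonprincipal_ultra by blast
  \<comment> \<open>Growing lengths push the odd closed walks beyond every bound. The length
    \<open>Suc k\<close> is positive, as \<open>infinite_chromatic_shift\<close> requires.\<close>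
  define Vs where "Vs = (\<lambda>k. shift_vertices (Suc k))"
  have window: "[m..<m + Suc k] \<in> Vs k" for m k
    using map_shift_vertices[of "\<lambda>i. i" m "Suc k"] by (simp add: Vs_def strict_mono_def)
  then have Vs: "Vs k \<noteq> {}" for k by blast
  interpret ultraproduct n D Vs "\<lambda>_. shift_adj" by unfold_locales (use assms(1) ultra_D Vs in auto)
  have "models (atom_struc n shift_adj (Vs k)) T" for k
  proof -
    have "countable (As k)" by (rule countable_atoms) simp
    then obtain g :: "nat list atom \<Rightarrow> 'a" where g: "inj_on g (As k)"
      by (rule countable_imp_inj_infinite[OF _ assms(4)])
    have "strongly_representable n L (image_struc g (atom_struc n shift_adj (Vs k)))"
      by (rule strongly_representable_if_infinite_chromatic[OF assms(1-3) _ g])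
        (simp add: Vs_def infinite_chromatic_shift)
    then have "models (image_struc g (atom_struc n shift_adj (Vs k))) T" using K by blast
    then show ?thesis
      using models_image[OF atom_structure_atom_struc[OF assms(1) Vs] _ TL, of g] g by simp
  qed
  note base_models = this
  have uV_sat: "sat (atom_struc n uadj uV) e \<phi>" if \<phi>: "\<phi> \<in> T" and e: "range e \<subseteq> uA" for \<phi> e
  proof -
    \<comment> \<open>At a given \<open>k\<close> the projected valuation may leave the universe of
      the factor. Since \<open>\<phi>\<close> is a sentence, a constant valuation inside it decides
      the same.\<close>
    have "sat (atom_struc n shift_adj (Vs k)) (\<lambda>v. coord k (e v)) \<phi>" for k
    proof -
      have "univ (atom_struc n shift_adj (Vs k)) \<noteq> {}"
        using atom_structure_atom_struc[OF assms(1) Vs, of L] unfolding atom_structure_def by blast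
      then obtain a where "a \<in> univ (atom_struc n shift_adj (Vs k))" by blast
      then have "range (\<lambda>_ :: nat. a) \<subseteq> univ (atom_struc n shift_adj (Vs k))" by auto
      then have "sat (atom_struc n shift_adj (Vs k)) (\<lambda>_. a) \<phi>"
        using base_models[of k] \<phi> unfolding models_def by blast
      moreover have "free_vars \<phi> = {}" using T[OF \<phi>] by (simp add: sentence_of_def)
      ultimately show ?thesis using sat_cong[of \<phi> "\<lambda>_. a"] by blast
    qed
    then show ?thesis
      using los_atom_struc[OF assms(3) TL[OF \<phi>] e] ultra_UNIV[OF ultra_D] by simp
  qed
  \<comment> \<open>Windows starting at different \<open>m\<close> have different heads at every
    \<open>k\<close>, so they represent infinitely many vertices. Placing them in the countable set
    \<open>C\<close> keeps it infinite.\<close>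
  define w where "w = (\<lambda>m. repr (\<lambda>k. [m..<m + Suc k]))"
  have w: "w m \<in> uV" "{k. w m k = [m..<m + Suc k]} \<in> D" for m
    unfolding w_def using repr[OF window] by auto
  have "inj w"
  proof (rule injI)
    fix m m' assume eq: "w m = w m'"
    obtain k where "w m k = [m..<m + Suc k]" "w m' k = [m'..<m' + Suc k]"
      using ultra_nonempty[OF ultra_D ultra_Int[OF ultra_D w(2)[of m] w(2)[of m']]] by blast
    then have "hd [m..<m + Suc k] = hd [m'..<m' + Suc k]" using eq by (simp only:)
    then show "m = m'" by (simp add: hd_upt del: upt_Suc)
  qed
  have "countable (range w)" "range w \<subseteq> uV" using w(1) by auto
  note skolem = loewenheim_skolem[OF this countable_subset[OF assms(3) countable_L_PEA], of n uadj]
  obtain C where C: "range w \<subseteq> C" "C \<subseteq> uV" "countable C"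
    "\<And>\<phi> e. formula_of L \<phi> \<Longrightarrow> range e \<subseteq> atoms n uadj C \<Longrightarrow>
      sat (atom_struc n uadj C) e \<phi> \<longleftrightarrow> sat (atom_struc n uadj uV) e \<phi>"
    by (rule skolem) blast
  have "infinite (range w)" using \<open>inj w\<close> by (simp add: finite_image_iff)
  then have infC: "infinite C" using C(1) infinite_super by blast
  obtain g :: "(nat \<Rightarrow> nat list) atom \<Rightarrow> 'a" where g: "inj_on g (atoms n uadj C)"
    by (rule countable_imp_inj_infinite[OF countable_atoms[OF C(3)] assms(4)])
  have as: "atom_structure L (atom_struc n uadj C)"
    using infC by (intro atom_structure_atom_struc assms(1)) auto
  have "models (atom_struc n uadj C) T"
    unfolding models_def
  proof (intro ballI allI impI)
    fix \<phi> and e :: "nat \<Rightarrow> _" assume \<phi>: "\<phi> \<in> T" and e: "range e \<subseteq> univ (atom_struc n uadj C)"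
    have e': "range e \<subseteq> atoms n uadj C" using e by simp
    then have "range e \<subseteq> uA" using atoms_mono[OF C(2), of n uadj] by blast
    then show "sat (atom_struc n uadj C) e \<phi>" using C(4)[OF TL[OF \<phi>] e'] uV_sat[OF \<phi>] by blast
  qed
  then have "models (image_struc g (atom_struc n uadj C)) T"
    using models_image[OF as _ TL, of g] g by simp
  then have "strongly_representable n L (image_struc g (atom_struc n uadj C))"
    using K atom_structure_image[OF as] by blast
  moreover obtain c :: "(nat \<Rightarrow> nat list) \<Rightarrow> nat" where
    c: "\<And>v. c v < 2" "\<And>u v. u \<in> uV \<Longrightarrow> v \<in> uV \<Longrightarrow> uadj u v \<Longrightarrow> c u \<noteq> c v"
  proof (rule two_colouring[of uadj uV])
    show "uadj y x" if "uadj x y" for x y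
      using that by (simp add: uadj_def shift_adj_def disj_commute)
    show "(x, x) \<notin> walk uadj uV ^^ m" if "odd m" for m x
    proof
      assume "(x, x) \<in> walk uadj uV ^^ m"
      \<comment> \<open>Almost all \<open>k\<close> satisfy \<open>2 * m < Suc k\<close>, where a
        closed walk of odd length \<open>m\<close> is impossible.\<close>
      from ultra_nonempty[OF ultra_D ultra_Int[OF ultra_D walk_at[OF this] cofinite_D[of "2 * m"]]]
      obtain k where "(x k, x k) \<in> walk shift_adj (Vs k) ^^ m" "2 * m \<le> k" by auto
      then show False using shift_no_odd_closed_walk[OF that, of "Suc k"] by (simp add: Vs_def)
    qed
  qed blast
  moreover have "\<not> strongly_representable n L (image_struc g (atom_struc n uadj C))"
    by (rule not_strongly_representable_if_colourable[OF assms(1-3) infC _ _ g, of c 2]) (use c C(2) in auto)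
  ultimately show False by blast
qed

end
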